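(* Let $\alpha\in\mathbb{R}$. (i) If $B(z)=z^n$ for an integer $n\ge1$, then $\mathcal{A}_\alpha$ has a closed subspace that is reducing for $T_B$ and on which $T_B$ is unitarily equivalent to the shift $T_z$ on $\mathcal{A}_\alpha$. (ii) For a general finite Blaschke product $B$ of degree at least $1$, there is a Hilbert space norm $\|\cdot\|_B$ on $\mathcal{A}_\alpha$, equivalent to $\|\cdot\|_\alpha$, such that on $(\mathcal{A}_\alpha,\|\cdot\|_B)$ the operator $T_B$ has a reducing subspace on which it is unitarily equivalent to the shift $T_z$ on $\mathcal{A}_\alpha$ (the latter with its norm $\|\cdot\|_\alpha$).
   Context: $\mathbb{D}$ is the open unit disc. For $\alpha\in\mathbb{R}$, $\mathcal{A}_\alpha$ is the Hilbert space of analytic functions $f(z)=\sum_{k\ge0}a_kz^k$ on $\mathbb{D}$ with norm $\|f\|_\alpha=\big(\sum_{k\ge0}|a_k|^2(k+1)^\alpha\big)^{1/2}<\infty$. A finite Blaschke product of degree $n$ is $B(z)=e^{i\theta}\prod_{i=1}^n\frac{z-\alpha_i}{1-\overline{\alpha_i}z}$ with $\theta\in\mathbb{R}$, $\alpha_i\in\mathbb{D}$ (repetitions allowed). $T_B$ is the operator $f\mapsto Bf$ on $\mathcal{A}_\alpha$, and $T_z$ (the shift) is $f(z)\mapsto zf(z)$. A closed subspace $M$ of a Hilbert space is reducing for an operator $T$ if both $M$ and $M^\perp$ are invariant under $T$ (in (ii), orthogonality is with respect to the inner product inducing $\|\cdot\|_B$). $T_B$ on a reducing subspace $M$ is unitarily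 equivalent to the shift on $\mathcal{A}_\alpha$ if there is a surjective linear isometry $U:(\mathcal{A}_\alpha,\|\cdot\|_\alpha)\to M$ (with $M$ carrying the norm under consideration) such that $U T_z=(T_B|_M)U$. *)

theory Defs
  imports "HOL-Complex_Analysis.Complex_Analysis" "HOL-Library.Function_Algebras"
begin

text \<open>
  Functions on the open unit disc are represented by their extension by \<open>0\<close> to the whole plane,
  so that equality of functions is HOL equality. The vector space operations are pointwise.
\<close>

type_synonym cfun = "complex \<Rightarrow> complex"

definition cscale :: "complex \<Rightarrow> cfun \<Rightarrow> cfun" where
  "cscale c f = (\<lambda>z. c * f z)"

interpretation cfun: vector_space cscale
  by unfold_locales (auto simp: cscale_def fun_eq_iff algebra_simps)

subsection \<open>Hilbert spaces of functions\<close>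

text \<open>Inner products are linear in the first argument.\<close>

definition inner_product_on :: "cfun set \<Rightarrow> (cfun \<Rightarrow> cfun \<Rightarrow> complex) \<Rightarrow> bool" where
  "inner_product_on H ip \<longleftrightarrow>
     cfun.subspace H \<and>
     (\<forall>f\<in>H. \<forall>g\<in>H. \<forall>h\<in>H. ip (f + g) h = ip f h + ip g h) \<and>
     (\<forall>c. \<forall>f\<in>H. \<forall>g\<in>H. ip (cscale c f) g = c * ip f g) \<and>
     (\<forall>f\<in>H. \<forall>g\<in>H. ip g f = cnj (ip f g)) \<and>
     (\<forall>f\<in>H. f \<noteq> 0 \<longrightarrow> Re (ip f f) > 0)"

definition ip_norm :: "(cfun \<Rightarrow> cfun \<Rightarrow> complex) \<Rightarrow> cfun \<Rightarrow> real" where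
  "ip_norm ip f = sqrt (Re (ip f f))"

text \<open>
  The locale \<^locale>\<open>Metric_space\<close> requires symmetry and nonnegativity of the distance also outside
  the carrier, hence the default value \<open>0\<close> there.
\<close>

definition ip_dist :: "cfun set \<Rightarrow> (cfun \<Rightarrow> cfun \<Rightarrow> complex) \<Rightarrow> cfun \<Rightarrow> cfun \<Rightarrow> real" where
  "ip_dist H ip f g = (if f \<in> H \<and> g \<in> H then ip_norm ip (f - g) else 0)"

lemma inner_product_onD:
  assumes "inner_product_on H ip"
  shows "cfun.subspace H"
    and "\<lbrakk>f \<in> H; g \<in> H; h \<in> H\<rbrakk> \<Longrightarrow> ip (f + g) h = ip f h + ip g h"
    and "\<lbrakk>f \<in> H; g \<in> H\<rbrakk> \<Longrightarrow> ip (cscale c f) g = c * ip f g"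
    and "\<lbrakk>f \<in> H; g \<in> H\<rbrakk> \<Longrightarrow> ip g f = cnj (ip f g)"
    and "\<lbrakk>f \<in> H; f \<noteq> 0\<rbrakk> \<Longrightarrow> Re (ip f f) > 0"
proof -
  note * = assms [unfolded inner_product_on_def]
  show "cfun.subspace H" using * by (rule conjunct1)
  note * = * [THEN conjunct2]
  show "ip (f + g) h = ip f h + ip g h" if "f \<in> H" "g \<in> H" "h \<in> H"
    using *[THEN conjunct1, rule_format, OF that] .
  note * = * [THEN conjunct2]
  show "ip (cscale c f) g = c * ip f g" if "f \<in> H" "g \<in> H"
    using *[THEN conjunct1, rule_format, OF that] .
  note * = * [THEN conjunct2]
  show "ip g f = cnj (ip f g)" if "f \<in> H" "g \<in> H"
    using *[THEN conjunct1, rule_format, OF that] .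
  show "Re (ip f f) > 0" if "f \<in> H" "f \<noteq> 0"
    using *[THEN conjunct2, rule_format, OF that] .
qed

lemma inner_product_on_0:
  assumes "inner_product_on H ip" "f \<in> H"
  shows "ip 0 f = 0" "ip f 0 = 0"
proof -
  have "0 \<in> H" using assms by (simp add: inner_product_onD(1) cfun.subspace_0)
  then have "ip (0 + 0) f = ip 0 f + ip 0 f" "ip f 0 = cnj (ip 0 f)"
    using inner_product_onD(2,4)[OF assms(1)] assms(2) by blast+
  then show "ip 0 f = 0" "ip f 0 = 0" by simp_all
qed

lemma ip_norm_triangle:
  assumes ip: "inner_product_on H ip" and fg: "f \<in> H" "g \<in> H"
  shows "ip_norm ip (f + g) \<le> ip_norm ip f + ip_norm ip g"
proof -
  define a b r where "a = Re (ip f f)" and "b = Re (ip g g)" and "r = Re (ip f g)"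
  note sub = inner_product_onD(1)[OF ip] and add = inner_product_onD(2)[OF ip]
    and scl = inner_product_onD(3)[OF ip] and cnj = inner_product_onD(4)[OF ip]
  have nonneg: "Re (ip x x) \<ge> 0" if "x \<in> H" for x
  proof (cases "x = 0")
    case True
    then show ?thesis using inner_product_on_0(1)[OF ip that] by simp
  next
    case False
    have "Re (ip x x) > 0" using inner_product_onD(5)[OF ip that False] .
    then show ?thesis by simp
  qed
  have expand: "Re (ip (x + y) (x + y)) = Re (ip x x) + Re (ip y y) + 2 * Re (ip x y)"
    if "x \<in> H" "y \<in> H" for x y
  proof -
    have xy: "x + y \<in> H" using sub that by (rule cfun.subspace_add)
    have "ip (x + y) (x + y) = ip x (x + y) + ip y (x + y)" by (rule add[OF that xy])
    moreover have "ip x (x + y) = cnj (ip x x + ip y x)"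
      unfolding cnj[OF xy that(1)] add[OF that that(1)] ..
    moreover have "ip y (x + y) = cnj (ip x y + ip y y)"
      unfolding cnj[OF xy that(2)] add[OF that that(2)] ..
    moreover have "Re (ip y x) = Re (ip x y)" unfolding cnj[OF that] by simp
    ultimately show ?thesis by simp
  qed
  have quad: "a * t\<^sup>2 + b + 2 * t * r \<ge> 0" for t :: real
  proof -
    have tf: "cscale t f \<in> H" using sub fg(1) by (rule cfun.subspace_scale)
    have "ip (cscale t f) (cscale t f) = of_real t * ip f (cscale t f)"
      by (rule scl[OF fg(1) tf])
    also have "ip f (cscale t f) = cnj (of_real t * ip f f)"
      unfolding cnj[OF tf fg(1)] scl[OF fg(1) fg(1)] ..
    finally have "Re (ip (cscale t f) (cscale t f)) = a * t\<^sup>2"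
      by (simp add: a_def power2_eq_square)
    moreover have "Re (ip (cscale t f) g) = t * r"
      by (simp add: scl[OF fg] r_def)
    moreover have "Re (ip (cscale t f + g) (cscale t f + g)) \<ge> 0"
      by (rule nonneg[OF cfun.subspace_add[OF sub tf fg(2)]])
    ultimately show ?thesis using expand[OF tf fg(2)] by (simp add: b_def)
  qed
  have a0: "a \<ge> 0" and b0: "b \<ge> 0" using nonneg[OF fg(1)] nonneg[OF fg(2)] by (simp_all add: a_def b_def)
  have "r\<^sup>2 \<le> a * b"
  proof (cases "a = 0")
    case True
    have "r = 0"
    proof (rule ccontr)
      assume "r \<noteq> 0"
      with quad[of "- (b + 1) / (2 * r)"] True show False by (simp add: field_simps)
    qed
    with True show ?thesis by simp
  next
    case False
    then show ?thesis
      using quad[of "- r / a"] a0 by (simp add: field_simps power2_eq_square)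
  qed
  then have "r \<le> sqrt a * sqrt b"
    using real_le_rsqrt[of r "a * b"] by (simp add: real_sqrt_mult)
  then have "a + b + 2 * r \<le> (sqrt a + sqrt b)\<^sup>2"
    using a0 b0 by (simp add: power2_sum)
  then show ?thesis
    using expand[OF fg] a0 b0 real_sqrt_le_mono[of "a + b + 2 * r" "(sqrt a + sqrt b)\<^sup>2"]
    by (simp add: ip_norm_def a_def b_def r_def)
qed

lemma Metric_space_ip_dist:
  assumes ip: "inner_product_on H ip"
  shows "Metric_space H (ip_dist H ip)"
proof
  note sub = inner_product_onD(1)[OF ip]
  have pos: "ip_norm ip f > 0" if "f \<in> H" "f \<noteq> 0" for f
    using inner_product_onD(5)[OF ip that] by (simp add: ip_norm_def)
  have z: "ip_norm ip 0 = 0"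
    using inner_product_on_0(1)[OF ip cfun.subspace_0[OF sub]] by (simp add: ip_norm_def)
  have diff: "f - g \<in> H" if "f \<in> H" "g \<in> H" for f g
    using cfun.subspace_diff[OF sub that] .
  show "0 \<le> ip_dist H ip f g" for f g
    using pos[of "f - g"] z diff[of f g] by (cases "f = g") (auto simp: ip_dist_def)
  show "ip_dist H ip f g = ip_dist H ip g f" for f g
  proof (cases "f \<in> H \<and> g \<in> H")
    case True
    define h where "h = f - g"
    have h: "h \<in> H" "- h \<in> H"
      using True diff[of f g] diff[of g f] by (auto simp: h_def)
    have neg: "- h = cscale (-1) h" by (simp add: cscale_def fun_eq_iff)
    have scl: "ip (- h) x = - ip h x" if "x \<in> H" for x
      unfolding neg using inner_product_onD(3)[OF ip h(1) that, of "-1"] by simp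
    have "ip (- h) (- h) = - ip h (- h)" by (rule scl[OF h(2)])
    also have "ip h (- h) = cnj (ip (- h) h)" using inner_product_onD(4)[OF ip h(2,1)] .
    also have "ip (- h) h = - ip h h" by (rule scl[OF h(1)])
    finally have e: "ip (- h) (- h) = - cnj (- ip h h)" .
    have "ip_norm ip (- h) = ip_norm ip h"
      unfolding ip_norm_def e by simp
    then show ?thesis using True by (simp add: ip_dist_def h_def)
  qed (auto simp: ip_dist_def)
  show "ip_dist H ip f g = 0 \<longleftrightarrow> f = g" if "f \<in> H" "g \<in> H" for f g
    using pos[of "f - g"] z diff[OF that] that by (cases "f = g") (auto simp: ip_dist_def)
  show "ip_dist H ip f h \<le> ip_dist H ip f g + ip_dist H ip g h"
    if "f \<in> H" "g \<in> H" "h \<in> H" for f g h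
    using ip_norm_triangle[OF ip diff[OF that(1,2)] diff[OF that(2,3)]] that
    by (simp add: ip_dist_def)
qed

definition hilbert_space_on :: "cfun set \<Rightarrow> (cfun \<Rightarrow> cfun \<Rightarrow> complex) \<Rightarrow> bool" where
  "hilbert_space_on H ip \<longleftrightarrow> inner_product_on H ip \<and> Metric_space.mcomplete H (ip_dist H ip)"

definition orth_compl :: "cfun set \<Rightarrow> (cfun \<Rightarrow> cfun \<Rightarrow> complex) \<Rightarrow> cfun set \<Rightarrow> cfun set" where
  "orth_compl H ip M = {f \<in> H. \<forall>g\<in>M. ip f g = 0}"

definition closed_subspace :: "cfun set \<Rightarrow> (cfun \<Rightarrow> cfun \<Rightarrow> complex) \<Rightarrow> cfun set \<Rightarrow> bool" where
  "closed_subspace H ip M \<longleftrightarrow>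
     M \<subseteq> H \<and> cfun.subspace M \<and> closedin (Metric_space.mtopology H (ip_dist H ip)) M"

definition reducing_subspace ::
  "cfun set \<Rightarrow> (cfun \<Rightarrow> cfun \<Rightarrow> complex) \<Rightarrow> (cfun \<Rightarrow> cfun) \<Rightarrow> cfun set \<Rightarrow> bool" where
  "reducing_subspace H ip T M \<longleftrightarrow>
     closed_subspace H ip M \<and> T ` M \<subseteq> M \<and> T ` orth_compl H ip M \<subseteq> orth_compl H ip M"

definition equivalent_norms_on :: "cfun set \<Rightarrow> (cfun \<Rightarrow> real) \<Rightarrow> (cfun \<Rightarrow> real) \<Rightarrow> bool" where
  "equivalent_norms_on H N N' \<longleftrightarrow>
     (\<exists>c>0. \<exists>C>0. \<forall>f\<in>H. c * N' f \<le> N f \<and> N f \<le> C * N' f)"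

text \<open>
  \<open>S\<close> acts on \<open>H\<close> with norm \<open>N\<close>, and \<open>T\<close> acts on the subspace \<open>M\<close>, which carries the norm \<open>N'\<close>.
\<close>

definition unitarily_equivalent_on ::
  "cfun set \<Rightarrow> (cfun \<Rightarrow> real) \<Rightarrow> (cfun \<Rightarrow> cfun) \<Rightarrow> cfun set \<Rightarrow> (cfun \<Rightarrow> real) \<Rightarrow> (cfun \<Rightarrow> cfun) \<Rightarrow> bool" where
  "unitarily_equivalent_on H N S M N' T \<longleftrightarrow>
     (\<exists>U. U ` H = M \<and>
          (\<forall>f\<in>H. \<forall>g\<in>H. U (f + g) = U f + U g) \<and>
          (\<forall>c. \<forall>f\<in>H. U (cscale c f) = cscale c (U f)) \<and>
          (\<forall>f\<in>H. N' (U f) = N f) \<and>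
          (\<forall>f\<in>H. U (S f) = T (U f)))"

subsection \<open>The spaces and operators\<close>

definition taylor_coeff :: "cfun \<Rightarrow> nat \<Rightarrow> complex" where
  "taylor_coeff f k = (deriv ^^ k) f 0 / fact k"

definition A_space :: "real \<Rightarrow> cfun set" where
  "A_space \<alpha> =
     {f. f holomorphic_on ball 0 1 \<and> (\<forall>z. z \<notin> ball 0 1 \<longrightarrow> f z = 0) \<and>
         summable (\<lambda>k. (norm (taylor_coeff f k))\<^sup>2 * (real k + 1) powr \<alpha>)}"

definition A_norm :: "real \<Rightarrow> cfun \<Rightarrow> real" where
  "A_norm \<alpha> f = sqrt (\<Sum>k. (norm (taylor_coeff f k))\<^sup>2 * (real k + 1) powr \<alpha>)"

definition A_inner :: "real \<Rightarrow> cfun \<Rightarrow> cfun \<Rightarrow> complex" where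
  "A_inner \<alpha> f g =
     (\<Sum>k. taylor_coeff f k * cnj (taylor_coeff g k) * of_real ((real k + 1) powr \<alpha>))"

lemma ip_norm_A_inner:
  assumes "f \<in> A_space \<alpha>"
  shows "ip_norm (A_inner \<alpha>) f = A_norm \<alpha> f"
proof -
  have "taylor_coeff f k * cnj (taylor_coeff f k) * of_real ((real k + 1) powr \<alpha>)
      = complex_of_real ((norm (taylor_coeff f k))\<^sup>2 * (real k + 1) powr \<alpha>)" for k
    by (simp add: complex_norm_square del: of_real_power)
  then have "A_inner \<alpha> f f
      = (\<Sum>k. complex_of_real ((norm (taylor_coeff f k))\<^sup>2 * (real k + 1) powr \<alpha>))"
    unfolding A_inner_def by presburger
  also have "\<dots> = of_real (\<Sum>k. (norm (taylor_coeff f k))\<^sup>2 * (real k + 1) powr \<alpha>)"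
    using assms by (intro suminf_of_real [symmetric]) (simp add: A_space_def)
  finally show ?thesis
    by (simp add: ip_norm_def A_norm_def)
qed

lemma inner_product_on_A_inner: "inner_product_on (A_space \<alpha>) (A_inner \<alpha>)"
proof -
  define w where "w k = (real k + 1) powr \<alpha>" for k
  have w: "w k > 0" for k by (simp add: w_def)
  have hol: "f holomorphic_on ball 0 1" and out: "\<And>z. z \<notin> ball 0 1 \<Longrightarrow> f z = 0"
    and sm: "summable (\<lambda>k. (norm (taylor_coeff f k))\<^sup>2 * w k)" if "f \<in> A_space \<alpha>" for f
    using that by (auto simp: A_space_def w_def)
  have tadd: "taylor_coeff (f + g) k = taylor_coeff f k + taylor_coeff g k"
    if "f holomorphic_on ball 0 1" "g holomorphic_on ball 0 1" for f g k
    using higher_deriv_add[OF that, of 0 k]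
    by (simp add: taylor_coeff_def plus_fun_def add_divide_distrib)
  have tscl: "taylor_coeff (cscale c f) k = c * taylor_coeff f k"
    if "f holomorphic_on ball 0 1" for c f k
    using higher_deriv_cmult[OF that, of 0 k c] by (simp add: taylor_coeff_def cscale_def)
  have sip: "summable (\<lambda>k. taylor_coeff f k * cnj (taylor_coeff g k) * of_real (w k))"
    if "f \<in> A_space \<alpha>" "g \<in> A_space \<alpha>" for f g
  proof (rule summable_comparison_test')
    show "summable (\<lambda>k. (norm (taylor_coeff f k))\<^sup>2 * w k + (norm (taylor_coeff g k))\<^sup>2 * w k)"
      using sm that by (intro summable_add)
    fix k :: nat
    have "norm (taylor_coeff f k) * norm (taylor_coeff g k)
        \<le> (norm (taylor_coeff f k))\<^sup>2 + (norm (taylor_coeff g k))\<^sup>2"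
      using sum_squares_bound[of "norm (taylor_coeff f k)" "norm (taylor_coeff g k)"]
        mult_nonneg_nonneg[OF norm_ge_zero[of "taylor_coeff f k"] norm_ge_zero[of "taylor_coeff g k"]]
      by linarith
    then show "norm (taylor_coeff f k * cnj (taylor_coeff g k) * of_real (w k))
        \<le> (norm (taylor_coeff f k))\<^sup>2 * w k + (norm (taylor_coeff g k))\<^sup>2 * w k"
      using w[of k] by (simp add: norm_mult mult_right_mono flip: distrib_right)
  qed
  have sub: "cfun.subspace (A_space \<alpha>)"
  proof (rule cfun.subspaceI)
    have "taylor_coeff 0 k = 0" for k
      using tscl[of "\<lambda>_. 0" 0 k] by (simp add: cscale_def zero_fun_def)
    then show "0 \<in> A_space \<alpha>" by (simp add: A_space_def zero_fun_def)
  next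
    fix f g assume fg: "f \<in> A_space \<alpha>" "g \<in> A_space \<alpha>"
    have "summable (\<lambda>k. (norm (taylor_coeff (f + g) k))\<^sup>2 * w k)"
    proof (rule summable_comparison_test')
      show "summable (\<lambda>k. 2 * ((norm (taylor_coeff f k))\<^sup>2 * w k) + 2 * ((norm (taylor_coeff g k))\<^sup>2 * w k))"
        using sm fg by (intro summable_add summable_mult)
      fix k :: nat
      let ?x = "norm (taylor_coeff f k)" and ?y = "norm (taylor_coeff g k)"
      have "(norm (taylor_coeff (f + g) k))\<^sup>2 \<le> (?x + ?y)\<^sup>2"
        using tadd[OF hol hol] fg by (simp add: power_mono norm_triangle_ineq)
      also have "\<dots> \<le> 2 * ?x\<^sup>2 + 2 * ?y\<^sup>2"
        using sum_squares_bound[of ?x ?y] by (simp add: power2_sum)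
      finally have "(norm (taylor_coeff (f + g) k))\<^sup>2 * w k \<le> (2 * ?x\<^sup>2 + 2 * ?y\<^sup>2) * w k"
        using w[of k] by (simp add: mult_right_mono)
      then show "norm ((norm (taylor_coeff (f + g) k))\<^sup>2 * w k) \<le> 2 * (?x\<^sup>2 * w k) + 2 * (?y\<^sup>2 * w k)"
        using w[of k] by (simp add: algebra_simps)
    qed
    moreover have "(f + g) holomorphic_on ball 0 1"
      unfolding plus_fun_def using hol fg by (intro holomorphic_intros)
    ultimately show "f + g \<in> A_space \<alpha>"
      using out fg by (simp add: A_space_def w_def)
  next
    fix c f assume f: "f \<in> A_space \<alpha>"
    have "summable (\<lambda>k. (norm (taylor_coeff (cscale c f) k))\<^sup>2 * w k)"
      using summable_mult[OF sm[OF f], of "(norm c)\<^sup>2"] tscl[OF hol[OF f]]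
      by (simp add: norm_mult power_mult_distrib mult.assoc)
    moreover have "cscale c f holomorphic_on ball 0 1"
      unfolding cscale_def using hol f by (intro holomorphic_intros)
    ultimately show "cscale c f \<in> A_space \<alpha>"
      using out f by (simp add: A_space_def w_def cscale_def)
  qed
  have "A_inner \<alpha> (f + g) h = A_inner \<alpha> f h + A_inner \<alpha> g h"
    if "f \<in> A_space \<alpha>" "g \<in> A_space \<alpha>" "h \<in> A_space \<alpha>" for f g h
    using suminf_add[OF sip sip, of f h g h] that tadd[OF hol hol]
    by (simp add: A_inner_def w_def distrib_right)
  moreover have "A_inner \<alpha> (cscale c f) g = c * A_inner \<alpha> f g"
    if "f \<in> A_space \<alpha>" "g \<in> A_space \<alpha>" for c f g
    using suminf_mult[OF sip, of f g c] that tscl[OF hol]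
    by (simp add: A_inner_def w_def mult.assoc)
  moreover have "A_inner \<alpha> g f = cnj (A_inner \<alpha> f g)"
    if "f \<in> A_space \<alpha>" "g \<in> A_space \<alpha>" for f g
  proof -
    have "(\<lambda>k. cnj (taylor_coeff f k * cnj (taylor_coeff g k) * of_real (w k)))
        sums cnj (A_inner \<alpha> f g)"
      using sip[OF that] unfolding A_inner_def w_def sums_cnj by (rule summable_sums)
    then show ?thesis
      unfolding A_inner_def[of _ g] using sums_unique by (fastforce simp: w_def mult.commute)
  qed
  moreover have "Re (A_inner \<alpha> f f) > 0" if f: "f \<in> A_space \<alpha>" and "f \<noteq> 0" for f
  proof -
    obtain k where k: "taylor_coeff f k \<noteq> 0"
    proof (rule ccontr)
      assume "\<not> thesis"
      then have z: "(deriv ^^ k) f 0 = 0" for k using that by (auto simp: taylor_coeff_def)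
      have "f x = 0" for x
      proof (cases "x \<in> ball 0 1")
        case True
        then show ?thesis
          using holomorphic_fun_eq_0_on_ball[OF hol[OF f] True] z by simp
      qed (use out[OF f] in auto)
      with \<open>f \<noteq> 0\<close> show False by (simp add: fun_eq_iff)
    qed
    have "(\<Sum>k. (norm (taylor_coeff f k))\<^sup>2 * w k) > 0"
      using sm[OF f] by (rule suminf_pos2[where i = k])
        (use w k in \<open>auto intro!: mult_nonneg_nonneg simp: less_imp_le\<close>)
    then have "ip_norm (A_inner \<alpha>) f > 0"
      using ip_norm_A_inner[OF f] by (simp add: A_norm_def w_def)
    then show ?thesis by (simp add: ip_norm_def)
  qed
  ultimately show ?thesis using sub unfolding inner_product_on_def by blast
qed

definition mult_op :: "cfun \<Rightarrow> cfun \<Rightarrow> cfun" where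
  "mult_op B f = (\<lambda>z. B z * f z)"

text \<open>The values of \<open>B\<close> outside the disc are irrelevant, so they are left unconstrained.\<close>

definition finite_blaschke_product :: "nat \<Rightarrow> cfun \<Rightarrow> bool" where
  "finite_blaschke_product n B \<longleftrightarrow>
     (\<exists>(\<theta>::real) a. (\<forall>i<n. a i \<in> ball 0 1) \<and>
        (\<forall>z\<in>ball 0 1. B z = exp (\<i> * of_real \<theta>) * (\<Prod>i<n. (z - a i) / (1 - cnj (a i) * z))))"

end

theory Submission
  imports Defs
begin

text \<open>
  Let \<open>T\<close> be multiplication by \<open>B\<close> and \<open>S\<close> multiplication by \<open>z\<close>. Both parts come from a pair of bounded
  operators \<open>U\<close>, \<open>V\<close> with \<open>V U = 1\<close>, \<open>U S = T U\<close> and \<open>V T = S V\<close>. If moreover \<open>V\<close> is the adjoint of \<open>U\<close>,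
  then \<open>U\<close> is isometric and its range is the orthogonal complement of the kernel of \<open>V\<close>; both are
  invariant under \<open>T\<close>, so the range of \<open>U\<close> reduces \<open>T\<close>, and \<open>U\<close> is the unitary equivalence with the
  shift (lemma \<open>reducing_range\<close>).

  For \<open>B(z) = z\<^sup>n\<close> the map \<open>U f(z) = n\<^bsup>-\<alpha>/2\<^esup> z\<^sup>n\<^sup>-\<^sup>1 f(z\<^sup>n)\<close> is isometric for the given norm, because the
  monomial \<open>z\<^sup>k\<close> goes to a multiple of \<open>z\<^bsup>nk + n - 1\<^esup>\<close>, whose weight is \<open>(n (k + 1))\<^sup>\<alpha>\<close>, and \<open>V\<close> is its adjoint.

  For general \<open>B\<close> the three algebraic relations suffice: for any such pair of bounded operators,
  \<open>\<langle>V f, V g\<rangle> + \<langle>f - U V f, g - U V g\<rangle>\<close> is an inner product with an equivalent norm, and it makes \<open>V\<close> the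
  adjoint of \<open>U\<close> (lemma \<open>renorming\<close>). A pair is found in the Hardy space \<open>H\<^sup>2\<close>, the case \<open>\<alpha> = 0\<close>. There
  multiplication by \<open>B\<close> is isometric; with \<open>b = B(0)\<close>, the function \<open>h = 1 - b\<^sup>* B\<close> is orthogonal to
  \<open>B H\<^sup>2\<close>, so \<open>U f = h (f \<circ> B) / \<surd>(1 - \<bar>b\<bar>\<^sup>2)\<close> is isometric, and \<open>V\<close> is the \<open>H\<^sup>2\<close>-adjoint of \<open>U\<close>
  (theorem \<open>intertwining_pair\<close>).

  What remains is that \<open>U\<close> and \<open>V\<close> are bounded for every exponent \<open>\<alpha>\<close>. Boundedness of \<open>V\<close> for \<open>\<alpha>\<close> is dual
  to that of \<open>U\<close> for \<open>- \<alpha>\<close>, so it suffices to bound the composition operator \<open>f \<mapsto> f \<circ> B\<close> for all real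
  exponents (theorem \<open>isometric_comp_bounded\<close>). Factor \<open>B = \<phi> \<circ> B\<^sub>0\<close> with a Moebius transformation \<open>\<phi>\<close>
  and \<open>B\<^sub>0(0) = 0\<close>. Composition with \<open>B\<^sub>0\<close> does not increase the partial sums of the squared coefficients
  (lemma \<open>rogosinski\<close>), hence is a contraction when \<open>\<alpha> \<le> 0\<close>. Composition with \<open>\<phi>\<close> is bounded for
  \<open>\<alpha> = 0\<close> by the isometry just mentioned, and for \<open>\<alpha> = -2, -4, \<dots>\<close> by the chain rule, since
  differentiation lowers the exponent by two and \<open>1 / \<phi>'\<close> is a polynomial; the negative exponents in
  between are reached by interpolation. The chain rule for \<open>B\<close> itself then leads from \<open>\<alpha>\<close> to \<open>\<alpha> + 2\<close>
  and covers the positive exponents.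

  All estimates are carried out on Taylor coefficients, that is, on formal power series.
\<close>

unbundle no vec_syntax
unbundle fps_syntax

(* The premise of this conditional rewrite rule contains its own left-hand side, so it loops. *)
declare suminf_ennreal [simp del]

section \<open>Weighted sequence spaces and their multipliers\<close>

definition wt :: "real \<Rightarrow> nat \<Rightarrow> real" where
  "wt \<alpha> k = (real k + 1) powr \<alpha>"

lemma wt_pos [simp]: "wt \<alpha> k > 0" and wt_nonneg [simp]: "wt \<alpha> k \<ge> 0" and wt_nz [simp]: "wt \<alpha> k \<noteq> 0"
  and wt_0 [simp]: "wt \<alpha> 0 = 1"
  by (simp_all add: wt_def)

lemma wt_zero_exponent [simp]: "wt 0 k = 1"
  by (simp add: wt_def)

lemma wt_mult_uminus [simp]: "wt \<alpha> k * wt (- \<alpha>) k = 1"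
  by (simp add: wt_def flip: powr_add)

lemma wt_add: "wt (\<alpha> + \<beta>) k = wt \<alpha> k * wt \<beta> k"
  by (simp add: wt_def powr_add)

lemma wt_mono_exponent: "\<alpha> \<le> \<beta> \<Longrightarrow> wt \<alpha> k \<le> wt \<beta> k"
  by (simp add: wt_def powr_mono)

lemma wt_antimono: "\<alpha> \<le> 0 \<Longrightarrow> i \<le> k \<Longrightarrow> wt \<alpha> k \<le> wt \<alpha> i"
  by (simp add: wt_def powr_mono2')

text \<open>
  The weights are submultiplicative up to the sign of the exponent, which is what makes convolution
  with a rapidly decreasing sequence bounded for every exponent.
\<close>

lemma wt_shift:
  assumes "m \<le> k"
  shows "wt \<alpha> k \<le> wt \<bar>\<alpha>\<bar> m * wt \<alpha> (k - m)"
proof (cases "\<alpha> \<ge> 0")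
  case True
  have "real k + 1 \<le> (real m + 1) * (real (k - m) + 1)"
    using assms mult_left_mono[of "real m" "real k" "real m"]
    by (simp add: of_nat_diff algebra_simps)
  then have "(real k + 1) powr \<alpha> \<le> ((real m + 1) * (real (k - m) + 1)) powr \<alpha>"
    using True by (intro powr_mono2) auto
  then show ?thesis using True by (simp add: wt_def powr_mult)
next
  case False
  have "wt \<alpha> k \<le> wt \<alpha> (k - m)" using False by (intro wt_antimono) auto
  also have "\<dots> \<le> wt \<bar>\<alpha>\<bar> m * wt \<alpha> (k - m)"
    using mult_right_mono[of 1 "wt \<bar>\<alpha>\<bar> m" "wt \<alpha> (k - m)"] by (simp add: wt_def ge_one_powr_ge_zero)
  finally show ?thesis .
qed

text \<open>
  Norms are squared and take values in the extended nonnegative reals: divergence needs no side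
  condition, and sums over weights may be exchanged with sums over coefficients. Arbitrary weights,
  not only powers, are admitted because the interpolation argument passes through minima of weights.
\<close>

definition weighted_sqnorm :: "(nat \<Rightarrow> real) \<Rightarrow> complex fps \<Rightarrow> ennreal" where
  "weighted_sqnorm w F = (\<Sum>k. ennreal (w k * (norm (F $ k))\<^sup>2))"

abbreviation sqnorm :: "real \<Rightarrow> complex fps \<Rightarrow> ennreal" where
  "sqnorm \<alpha> \<equiv> weighted_sqnorm (wt \<alpha>)"

definition wl2 :: "real \<Rightarrow> complex fps set" where
  "wl2 \<alpha> = {F. sqnorm \<alpha> F < top}"

lemma weighted_sqnorm_leI:
  assumes "\<And>k. w k \<ge> 0" "\<And>n. ennreal (\<Sum>k<n. w k * (norm (F $ k))\<^sup>2) \<le> C"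
  shows "weighted_sqnorm w F \<le> C"
  unfolding weighted_sqnorm_def
  by (rule suminf_le_const) (use assms in \<open>simp_all add: sum_ennreal\<close>)

lemma weighted_sqnorm_partial:
  assumes "\<And>k. w k \<ge> 0" "finite A"
  shows "ennreal (\<Sum>k\<in>A. w k * (norm (F $ k))\<^sup>2) \<le> weighted_sqnorm w F"
proof -
  have "(\<Sum>k\<in>A. ennreal (w k * (norm (F $ k))\<^sup>2)) \<le> weighted_sqnorm w F"
    unfolding weighted_sqnorm_def by (rule sum_le_suminf) (use assms in auto)
  then show ?thesis using assms by (simp add: sum_ennreal)
qed

lemma weighted_sqnorm_mono:
  assumes "\<And>k. w k * (norm (F $ k))\<^sup>2 \<le> v k * (norm (G $ k))\<^sup>2"
  shows "weighted_sqnorm w F \<le> weighted_sqnorm v G"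
  unfolding weighted_sqnorm_def by (intro suminf_le summableI ennreal_leI assms)

lemma weighted_sqnorm_cmult_weight:
  assumes "c \<ge> 0" "\<And>k. w k \<ge> 0"
  shows "weighted_sqnorm (\<lambda>k. c * w k) F = ennreal c * weighted_sqnorm w F"
  using assms by (simp add: weighted_sqnorm_def ennreal_mult mult.assoc flip: ennreal_suminf_cmult)

lemma ennreal_le_double:
  assumes "x \<le> 2 * a + 2 * b" "a \<ge> 0" "b \<ge> 0"
  shows "ennreal x \<le> 2 * ennreal a + 2 * ennreal b"
proof -
  have "ennreal x \<le> ennreal (2 * a + 2 * b)" by (rule ennreal_leI) fact
  also have "\<dots> = 2 * ennreal a + 2 * ennreal b" using assms(2,3) by (simp add: ennreal_mult)
  finally show ?thesis .
qed

lemma weighted_sqnorm_add: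
  assumes w: "\<And>k. w k \<ge> 0"
  shows "weighted_sqnorm w (F + G) \<le> 2 * weighted_sqnorm w F + 2 * weighted_sqnorm w G"
proof -
  have "(norm (F $ k + G $ k))\<^sup>2 \<le> 2 * (norm (F $ k))\<^sup>2 + 2 * (norm (G $ k))\<^sup>2" for k
  proof -
    have "(norm (F $ k + G $ k))\<^sup>2 \<le> (norm (F $ k) + norm (G $ k))\<^sup>2"
      by (simp add: norm_triangle_ineq power_mono)
    also have "\<dots> \<le> 2 * (norm (F $ k))\<^sup>2 + 2 * (norm (G $ k))\<^sup>2"
      using sum_squares_bound[of "norm (F $ k)" "norm (G $ k)"] by (simp add: power2_sum)
    finally show ?thesis .
  qed
  then have "w k * (norm ((F + G) $ k))\<^sup>2
      \<le> 2 * (w k * (norm (F $ k))\<^sup>2) + 2 * (w k * (norm (G $ k))\<^sup>2)" for k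
    using mult_left_mono[OF _ w[of k]] by (fastforce simp: algebra_simps)
  then have "ennreal (w k * (norm ((F + G) $ k))\<^sup>2)
      \<le> 2 * ennreal (w k * (norm (F $ k))\<^sup>2) + 2 * ennreal (w k * (norm (G $ k))\<^sup>2)" for k
    using w[of k] by (intro ennreal_le_double) auto
  then have "weighted_sqnorm w (F + G) \<le> (\<Sum>k. 2 * ennreal (w k * (norm (F $ k))\<^sup>2) + 2 * ennreal (w k * (norm (G $ k))\<^sup>2))"
    unfolding weighted_sqnorm_def by (intro suminf_le summableI)
  also have "\<dots> = 2 * weighted_sqnorm w F + 2 * weighted_sqnorm w G"
    by (simp add: weighted_sqnorm_def flip: suminf_add)
  finally show ?thesis .
qed

lemma weighted_sqnorm_const_mult:
  assumes w: "\<And>k. w k \<ge> 0"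
  shows "weighted_sqnorm w (fps_const c * F) = ennreal ((norm c)\<^sup>2) * weighted_sqnorm w F"
proof -
  have "ennreal (w k * (norm ((fps_const c * F) $ k))\<^sup>2) = ennreal ((norm c)\<^sup>2) * ennreal (w k * (norm (F $ k))\<^sup>2)" for k
    using w[of k] by (subst ennreal_mult [symmetric]) (simp_all add: norm_mult power_mult_distrib mult_ac)
  then show ?thesis by (simp add: weighted_sqnorm_def)
qed

lemma weighted_sqnorm_uminus [simp]: "weighted_sqnorm w (- F) = weighted_sqnorm w F"
  by (simp add: weighted_sqnorm_def)

lemma sqnorm_finite_iff: "sqnorm \<alpha> F < top \<longleftrightarrow> summable (\<lambda>k. wt \<alpha> k * (norm (F $ k))\<^sup>2)"
proof
  assume "sqnorm \<alpha> F < top"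
  then show "summable (\<lambda>k. wt \<alpha> k * (norm (F $ k))\<^sup>2)"
    unfolding weighted_sqnorm_def by (intro summable_suminf_not_top) (simp_all add: less_imp_neq)
next
  assume "summable (\<lambda>k. wt \<alpha> k * (norm (F $ k))\<^sup>2)"
  then have "sqnorm \<alpha> F \<noteq> top" unfolding weighted_sqnorm_def by (rule ennreal_suminf_neq_top) simp
  then show "sqnorm \<alpha> F < top" by (simp only: less_top)
qed

lemma sqnorm_eq_suminf:
  assumes "sqnorm \<alpha> F < top"
  shows "sqnorm \<alpha> F = ennreal (\<Sum>k. wt \<alpha> k * (norm (F $ k))\<^sup>2)"
proof -
  have "0 \<le> wt \<alpha> k * (norm (F $ k))\<^sup>2" for k by simp
  then show ?thesis unfolding weighted_sqnorm_def
    by (rule suminf_ennreal2) (use assms in \<open>simp add: sqnorm_finite_iff\<close>)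
qed

lemma wl2_iff: "F \<in> wl2 \<alpha> \<longleftrightarrow> summable (\<lambda>k. wt \<alpha> k * (norm (F $ k))\<^sup>2)"
  by (simp add: wl2_def sqnorm_finite_iff)

lemma wl2_add:
  assumes "F \<in> wl2 \<alpha>" "G \<in> wl2 \<alpha>"
  shows "F + G \<in> wl2 \<alpha>"
proof -
  have "sqnorm \<alpha> (F + G) \<le> 2 * sqnorm \<alpha> F + 2 * sqnorm \<alpha> G" by (rule weighted_sqnorm_add) simp
  also have "\<dots> < top" using assms by (simp add: wl2_def ennreal_mult_less_top)
  finally show ?thesis by (simp add: wl2_def)
qed

lemma wl2_cmult: "F \<in> wl2 \<alpha> \<Longrightarrow> fps_const c * F \<in> wl2 \<alpha>"
  by (simp add: wl2_def weighted_sqnorm_const_mult ennreal_mult_less_top)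

lemma wl2_uminus: "F \<in> wl2 \<alpha> \<Longrightarrow> - F \<in> wl2 \<alpha>"
  by (simp add: wl2_def)

lemma wl2_diff: "F \<in> wl2 \<alpha> \<Longrightarrow> G \<in> wl2 \<alpha> \<Longrightarrow> F - G \<in> wl2 \<alpha>"
  using wl2_add[of F \<alpha> "- G"] wl2_uminus[of G \<alpha>] by simp

lemma wl2_bounded:
  assumes "sqnorm \<beta> G \<le> ennreal K * sqnorm \<alpha> F" "F \<in> wl2 \<alpha>"
  shows "G \<in> wl2 \<beta>"
proof -
  note assms(1)
  also have "ennreal K * sqnorm \<alpha> F < top" using assms(2) by (simp add: wl2_def ennreal_mult_less_top)
  finally show ?thesis by (simp add: wl2_def)
qed

lemma sqnorm_mono_exponent: "\<alpha> \<le> \<beta> \<Longrightarrow> sqnorm \<alpha> F \<le> sqnorm \<beta> F"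
  by (rule weighted_sqnorm_mono) (simp add: mult_right_mono wt_mono_exponent)

lemma sqnorm_coeff: "ennreal (wt \<alpha> k * (norm (F $ k))\<^sup>2) \<le> sqnorm \<alpha> F"
  using weighted_sqnorm_partial[of "wt \<alpha>" "{k}" F] by simp

lemma wt_Suc_compare: "wt s k \<le> 2 powr \<bar>s\<bar> * wt s (Suc k)" "wt s (Suc k) \<le> 2 powr \<bar>s\<bar> * wt s k"
proof -
  show "wt s (Suc k) \<le> 2 powr \<bar>s\<bar> * wt s k"
    using wt_shift[of 1 "Suc k" s] by (simp add: wt_def)
  show "wt s k \<le> 2 powr \<bar>s\<bar> * wt s (Suc k)"
  proof (cases "s \<ge> 0")
    case True
    have "wt s k \<le> wt s (Suc k)" using True by (simp add: wt_def powr_mono2)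
    also have "\<dots> \<le> 2 powr \<bar>s\<bar> * wt s (Suc k)"
      using mult_right_mono[of 1 "2 powr \<bar>s\<bar>" "wt s (Suc k)"] by (simp add: ge_one_powr_ge_zero)
    finally show ?thesis .
  next
    case False
    have "((2::real) * (real k + 1)) powr s \<le> (real (Suc k) + 1) powr s"
      using False by (intro powr_mono2') auto
    then have "2 powr s * wt s k \<le> wt s (Suc k)"
      unfolding wt_def by (subst (asm) powr_mult) auto
    then have "2 powr (-s) * (2 powr s * wt s k) \<le> 2 powr (-s) * wt s (Suc k)"
      by (intro mult_left_mono) auto
    then show ?thesis using False by (simp flip: mult.assoc powr_add)
  qed
qed

lemma fps_deriv_term:
  fixes F :: "complex fps"
  shows "wt \<alpha> k * (norm (fps_deriv F $ k))\<^sup>2 = wt (\<alpha> + 2) k * (norm (F $ Suc k))\<^sup>2"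
proof -
  have "norm (fps_deriv F $ k) = real (Suc k) * norm (F $ Suc k)"
    by (simp add: norm_mult del: of_nat_Suc)
  moreover have "wt (\<alpha> + 2) k = wt \<alpha> k * (real (Suc k))\<^sup>2" by (simp add: wt_def powr_add add.commute)
  ultimately show ?thesis by (simp add: power_mult_distrib)
qed

text \<open>
  Differentiation and integration move between the exponents \<open>\<alpha> + 2\<close> and \<open>\<alpha>\<close>: the factor
  \<open>(k + 1)\<^sup>2\<close> from the derivative is absorbed into the weight, and the index shift costs the constant.
\<close>

lemma sqnorm_deriv: "sqnorm \<alpha> (fps_deriv F) \<le> ennreal (2 powr \<bar>\<alpha> + 2\<bar>) * sqnorm (\<alpha> + 2) F"
proof -
  let ?c = "2 powr \<bar>\<alpha> + 2\<bar>"
  have "wt \<alpha> k * (norm (fps_deriv F $ k))\<^sup>2 \<le> ?c * (wt (\<alpha> + 2) (Suc k) * (norm (F $ Suc k))\<^sup>2)" for k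
  proof -
    have "wt \<alpha> k * (norm (fps_deriv F $ k))\<^sup>2 = wt (\<alpha> + 2) k * (norm (F $ Suc k))\<^sup>2"
      by (rule fps_deriv_term)
    also have "\<dots> \<le> (?c * wt (\<alpha> + 2) (Suc k)) * (norm (F $ Suc k))\<^sup>2"
      by (intro mult_right_mono wt_Suc_compare) auto
    finally show ?thesis by (simp add: mult.assoc)
  qed
  then have "sqnorm \<alpha> (fps_deriv F) \<le> (\<Sum>k. ennreal (?c * (wt (\<alpha> + 2) (Suc k) * (norm (F $ Suc k))\<^sup>2)))"
    unfolding weighted_sqnorm_def by (intro suminf_le summableI ennreal_leI)
  also have "\<dots> = ennreal ?c * (\<Sum>k. ennreal (wt (\<alpha> + 2) (Suc k) * (norm (F $ Suc k))\<^sup>2))"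
    by (simp add: ennreal_mult)
  also have "(\<Sum>k. ennreal (wt (\<alpha> + 2) (Suc k) * (norm (F $ Suc k))\<^sup>2)) \<le> sqnorm (\<alpha> + 2) F"
    unfolding weighted_sqnorm_def by (subst (2) suminf_offset[of _ 1]) (auto intro: summableI)
  finally show ?thesis by (simp add: mult_left_mono)
qed

lemma sqnorm_antideriv: "sqnorm (\<alpha> + 2) F \<le> ennreal ((norm (F $ 0))\<^sup>2) + ennreal (2 powr \<bar>\<alpha> + 2\<bar>) * sqnorm \<alpha> (fps_deriv F)"
proof -
  let ?c = "2 powr \<bar>\<alpha> + 2\<bar>"
  have "wt (\<alpha> + 2) (Suc k) * (norm (F $ Suc k))\<^sup>2 \<le> ?c * (wt \<alpha> k * (norm (fps_deriv F $ k))\<^sup>2)" for k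
  proof -
    have "wt \<alpha> k * (norm (fps_deriv F $ k))\<^sup>2 = wt (\<alpha> + 2) k * (norm (F $ Suc k))\<^sup>2"
      by (rule fps_deriv_term)
    moreover have "wt (\<alpha> + 2) (Suc k) * (norm (F $ Suc k))\<^sup>2 \<le> (?c * wt (\<alpha> + 2) k) * (norm (F $ Suc k))\<^sup>2"
      by (intro mult_right_mono wt_Suc_compare) auto
    ultimately show ?thesis by (simp add: mult.assoc)
  qed
  then have "(\<Sum>k. ennreal (wt (\<alpha> + 2) (Suc k) * (norm (F $ Suc k))\<^sup>2))
      \<le> (\<Sum>k. ennreal (?c * (wt \<alpha> k * (norm (fps_deriv F $ k))\<^sup>2)))"
    by (intro suminf_le summableI ennreal_leI)
  also have "\<dots> = ennreal ?c * sqnorm \<alpha> (fps_deriv F)"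
    by (simp add: weighted_sqnorm_def ennreal_mult)
  finally have "(\<Sum>k. ennreal (wt (\<alpha> + 2) (Suc k) * (norm (F $ Suc k))\<^sup>2)) \<le> ennreal ?c * sqnorm \<alpha> (fps_deriv F)" .
  then show ?thesis
    unfolding weighted_sqnorm_def[of _ F] by (subst suminf_offset[of _ 1]) (auto intro: summableI simp: add.commute add_left_mono)
qed

text \<open>
  Since the exponent \<open>\<alpha>\<close> is arbitrary, this says that the coefficients decrease faster than every
  power; on the circle such a series represents a smooth function.
\<close>

definition smooth :: "complex fps \<Rightarrow> bool" where
  "smooth G \<longleftrightarrow> (\<forall>\<alpha>. G \<in> wl2 \<alpha>)"

lemma smoothD: "smooth G \<Longrightarrow> G \<in> wl2 \<alpha>" by (simp add: smooth_def)

lemma smooth_summable: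
  assumes "smooth G"
  shows "summable (\<lambda>k. wt s k * norm (G $ k))"
proof (rule summable_comparison_test')
  have "summable (\<lambda>k. wt (2 * s + 2) k * (norm (G $ k))\<^sup>2)"
    using smoothD[OF assms] by (simp add: wl2_iff)
  moreover have "summable (\<lambda>k. wt (-2) k)"
  proof -
    have "summable (\<lambda>k. real (Suc k) powr (-2))"
      using summable_real_powr_iff[of "-2"] by (subst summable_Suc_iff) auto
    then show ?thesis by (simp add: wt_def add.commute)
  qed
  ultimately show "summable (\<lambda>k. wt (2 * s + 2) k * (norm (G $ k))\<^sup>2 + wt (-2) k)" by (rule summable_add)
  fix k :: nat
  define x where "x = wt (s + 1) k * norm (G $ k)"
  define y where "y = wt (-1) k"
  have "x * y \<le> x\<^sup>2 + y\<^sup>2"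
  proof -
    have "0 \<le> x * y" by (simp add: x_def y_def)
    then show ?thesis using sum_squares_bound[of x y] by linarith
  qed
  moreover have "x * y = wt s k * norm (G $ k)"
    using wt_add[of "s+1" "-1" k] by (simp add: x_def y_def mult_ac)
  moreover have "x\<^sup>2 = wt (2 * s + 2) k * (norm (G $ k))\<^sup>2"
    using wt_add[of "s+1" "s+1" k] by (simp add: x_def power_mult_distrib power2_eq_square mult_ac)
  moreover have "y\<^sup>2 = wt (-2) k" using wt_add[of "-1" "-1" k] by (simp add: y_def power2_eq_square)
  ultimately show "norm (wt s k * norm (G $ k)) \<le> wt (2 * s + 2) k * (norm (G $ k))\<^sup>2 + wt (-2) k"
    by simp
qed

text \<open>
  Young's inequality in weighted form: the Cauchy--Schwarz inequality splits \<open>\<bar>g\<bar>\<close> as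
  \<open>\<surd>\<bar>g\<bar> \<cdot> \<surd>\<bar>g\<bar>\<close>, after which the weights are distributed over the convolution.
\<close>

lemma smooth_multiplier:
  assumes "smooth G"
  shows "\<exists>K>0. \<forall>F. sqnorm \<alpha> (G * F) \<le> ennreal K * sqnorm \<alpha> F"
proof -
  define g where "g k = norm (G $ k)" for k
  define A where "A m = wt \<bar>\<alpha>\<bar> m * g m" for m
  define S where "S = (\<Sum>m. g m)"
  \<comment> \<open>The summand 1 keeps the constant positive, so that the bound is trivial when the norm of \<open>F\<close> is infinite.\<close>
  define K where "K = S * suminf A + 1"
  have sg: "summable g" using smooth_summable[OF assms, of 0] by (simp add: g_def[abs_def])
  have sA: "summable A" using smooth_summable[OF assms, of "\<bar>\<alpha>\<bar>"] by (simp add: A_def[abs_def] g_def)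
  have g0: "g m \<ge> 0" and A0: "A m \<ge> 0" for m by (auto simp: g_def A_def)
  have S0: "S \<ge> 0" using sg g0 by (simp add: S_def suminf_nonneg)
  have K0: "K > 0" using S0 suminf_nonneg[OF sA A0] by (simp add: K_def add_nonneg_pos)
  have "sqnorm \<alpha> (G * F) \<le> ennreal K * sqnorm \<alpha> F" for F
  proof (cases "sqnorm \<alpha> F < top")
    case False
    then have "sqnorm \<alpha> F = top" by (simp flip: less_top)
    then show ?thesis using K0 by (simp add: ennreal_mult_top)
  next
    case True
    define c where "c k = wt \<alpha> k * (norm (F $ k))\<^sup>2" for k
    have sc: "summable c" using True by (simp add: c_def[abs_def] sqnorm_finite_iff)
    have c0: "c k \<ge> 0" for k by (simp add: c_def)
    have term_le: "wt \<alpha> k * (norm ((G * F) $ k))\<^sup>2 \<le> S * (\<Sum>m\<le>k. A m * c (k - m))" for k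
    proof -
      define f where "f m = norm (F $ (k - m))" for m
      have "norm ((G * F) $ k) \<le> (\<Sum>m\<le>k. g m * f m)"
        unfolding fps_mult_nth atLeast0AtMost
        by (rule order_trans[OF norm_sum]) (simp add: g_def f_def norm_mult)
      then have "(norm ((G * F) $ k))\<^sup>2 \<le> (\<Sum>m\<le>k. sqrt (g m) * (sqrt (g m) * f m))\<^sup>2"
        using g0 by (intro power_mono) (simp_all flip: mult.assoc)
      also have "\<dots> \<le> (\<Sum>m\<le>k. (sqrt (g m))\<^sup>2) * (\<Sum>m\<le>k. (sqrt (g m) * f m)\<^sup>2)"
        by (rule Cauchy_Schwarz_ineq_sum)
      also have "\<dots> = (\<Sum>m\<le>k. g m) * (\<Sum>m\<le>k. g m * (f m)\<^sup>2)"
        using g0 by (simp add: power_mult_distrib)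
      also have "\<dots> \<le> S * (\<Sum>m\<le>k. g m * (f m)\<^sup>2)"
        unfolding S_def using sg g0 by (intro mult_right_mono sum_le_suminf sum_nonneg mult_nonneg_nonneg) auto
      finally have "wt \<alpha> k * (norm ((G * F) $ k))\<^sup>2 \<le> wt \<alpha> k * (S * (\<Sum>m\<le>k. g m * (f m)\<^sup>2))"
        by (intro mult_left_mono) auto
      also have "\<dots> = S * (\<Sum>m\<le>k. wt \<alpha> k * (g m * (f m)\<^sup>2))"
        by (simp add: sum_distrib_left mult_ac)
      also have "\<dots> \<le> S * (\<Sum>m\<le>k. A m * c (k - m))"
      proof (intro mult_left_mono sum_mono S0)
        fix m assume "m \<in> {..k}"
        then have "wt \<alpha> k * (g m * (f m)\<^sup>2) \<le> (wt \<bar>\<alpha>\<bar> m * wt \<alpha> (k - m)) * (g m * (f m)\<^sup>2)"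
          using g0 by (intro mult_right_mono wt_shift) auto
        then show "wt \<alpha> k * (g m * (f m)\<^sup>2) \<le> A m * c (k - m)"
          by (simp add: A_def c_def f_def mult_ac)
      qed
      finally show ?thesis .
    qed
    have "(\<lambda>k. \<Sum>m\<le>k. A m * c (k - m)) sums (suminf A * suminf c)"
      using sA sc A0 c0 by (intro Cauchy_product_sums) auto
    then have sums: "(\<lambda>k. S * (\<Sum>m\<le>k. A m * c (k - m))) sums (S * (suminf A * suminf c))"
      by (rule sums_mult)
    have "sqnorm \<alpha> (G * F) \<le> (\<Sum>k. ennreal (S * (\<Sum>m\<le>k. A m * c (k - m))))"
      unfolding weighted_sqnorm_def by (intro suminf_le summableI ennreal_leI term_le)
    also have "\<dots> = ennreal (S * (suminf A * suminf c))"
      using sums S0 A0 c0 by (intro suminf_ennreal_eq) (auto intro!: mult_nonneg_nonneg sum_nonneg)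
    also have "\<dots> \<le> ennreal (K * suminf c)"
      using suminf_nonneg[OF sc c0] by (intro ennreal_leI) (simp add: K_def algebra_simps)
    also have "\<dots> = ennreal K * sqnorm \<alpha> F"
      using K0 suminf_nonneg[OF sc c0] sqnorm_eq_suminf[OF True] by (simp add: ennreal_mult c_def[abs_def])
    finally show ?thesis .
  qed
  with K0 show ?thesis by blast
qed

lemma wl2_smooth_mult: "smooth G \<Longrightarrow> F \<in> wl2 \<alpha> \<Longrightarrow> G * F \<in> wl2 \<alpha>"
  using smooth_multiplier[of G \<alpha>] wl2_bounded by blast

lemma smooth_mult: "smooth G \<Longrightarrow> smooth F \<Longrightarrow> smooth (G * F)"
  unfolding smooth_def using wl2_smooth_mult smooth_def by blast

lemma smooth_add: "smooth G \<Longrightarrow> smooth F \<Longrightarrow> smooth (G + F)"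
  by (auto simp: smooth_def wl2_add)

lemma smooth_diff: "smooth G \<Longrightarrow> smooth F \<Longrightarrow> smooth (G - F)"
  by (auto simp: smooth_def wl2_diff)

lemma smooth_deriv: "smooth G \<Longrightarrow> smooth (fps_deriv G)"
  unfolding smooth_def using sqnorm_deriv wl2_bounded by blast

lemma wl2_finite_support:
  assumes "\<And>k. k \<ge> n \<Longrightarrow> F $ k = 0"
  shows "F \<in> wl2 \<alpha>"
proof -
  have "summable (\<lambda>k. wt \<alpha> k * (norm (F $ k))\<^sup>2)"
    by (rule summable_finite[of "{..<n}"]) (use assms in auto)
  then show ?thesis by (simp add: wl2_iff)
qed

lemma smooth_const [simp]: "smooth (fps_const c)"
  unfolding smooth_def using wl2_finite_support[of 1 "fps_const c"] by auto

lemma smooth_0 [simp]: "smooth 0"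
  using smooth_const[of 0] by simp

lemma smooth_1 [simp]: "smooth 1"
  using smooth_const[of 1] by simp

lemma smooth_X [simp]: "smooth fps_X"
  unfolding smooth_def using wl2_finite_support[of 2 "fps_X"] by (auto simp: fps_X_def)

lemma summable_wt_geometric:
  assumes "0 \<le> s" "s < 1"
  shows "summable (\<lambda>k. wt \<alpha> k * s ^ k)"
proof -
  have "(\<lambda>n. s * (1 + 1 / real (Suc n)) powr \<alpha>) \<longlonglongrightarrow> s * (1 + 0) powr \<alpha>"
    by (intro tendsto_intros LIMSEQ_inverse_real_of_nat[unfolded inverse_eq_divide]) auto
  then have "eventually (\<lambda>n. s * (1 + 1 / real (Suc n)) powr \<alpha> < (1 + s) / 2) sequentially"
    using assms by (intro order_tendstoD) auto
  then obtain n0 where n0: "\<And>n. n \<ge> n0 \<Longrightarrow> s * (1 + 1 / real (Suc n)) powr \<alpha> < (1 + s) / 2"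
    by (auto simp: eventually_sequentially)
  show ?thesis
  proof (rule summable_ratio_test[of "(1 + s) / 2" n0])
    show "(1 + s) / 2 < 1" using assms by simp
    fix n assume n: "n0 \<le> n"
    have "real (Suc n) + 1 = (1 + 1 / real (Suc n)) * (real n + 1)" by (simp add: field_simps)
    then have "wt \<alpha> (Suc n) = (1 + 1 / real (Suc n)) powr \<alpha> * wt \<alpha> n"
      unfolding wt_def by (simp only: powr_mult)
    then have "wt \<alpha> (Suc n) * s ^ Suc n = (s * (1 + 1 / real (Suc n)) powr \<alpha>) * (wt \<alpha> n * s ^ n)"
      by (simp add: mult_ac)
    also have "\<dots> \<le> (1 + s) / 2 * (wt \<alpha> n * s ^ n)"
      using n0[OF n] assms by (intro mult_right_mono) auto
    finally show "norm (wt \<alpha> (Suc n) * s ^ Suc n) \<le> (1 + s) / 2 * norm (wt \<alpha> n * s ^ n)"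
      using assms by simp
  qed
qed

lemma inverse_one_minus_cX:
  fixes c :: complex
  shows "inverse (1 - fps_const c * fps_X) = Abs_fps (\<lambda>k. c ^ k)"
proof (rule fps_inverse_unique)
  show "(1 - fps_const c * fps_X) * Abs_fps (\<lambda>k. c ^ k) = 1"
  proof (rule fps_ext)
    show "((1 - fps_const c * fps_X) * Abs_fps (\<lambda>k. c ^ k)) $ n = 1 $ n" for n
      by (cases n) (simp_all add: left_diff_distrib mult.assoc)
  qed
qed

lemma smooth_geometric:
  assumes "norm c < 1"
  shows "smooth (inverse (1 - fps_const c * fps_X))"
  unfolding smooth_def wl2_iff inverse_one_minus_cX
  using summable_wt_geometric[of "(norm c)\<^sup>2"] assms
  by (simp add: norm_power abs_square_less_1 mult.commute flip: power_mult)

lemma smooth_power: "smooth G \<Longrightarrow> smooth (G ^ n)"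
  by (induction n) (auto intro: smooth_mult)

section \<open>Duality between opposite exponents\<close>

text \<open>
  The inner product of \<open>H\<^sup>2\<close>, which extends to a duality between the spaces with exponents
  \<open>\<alpha>\<close> and \<open>- \<alpha>\<close>.
\<close>

definition pairing :: "complex fps \<Rightarrow> complex fps \<Rightarrow> complex" where
  "pairing F G = (\<Sum>k. F $ k * cnj (G $ k))"

text \<open>
  The parameter \<open>t\<close> is free so that the resulting bound on the pairing can be optimised, which
  replaces the Cauchy--Schwarz inequality between the two dual norms.
\<close>

lemma pairing_term_bound:
  assumes "t > 0"
  shows "norm (F $ k * cnj (G $ k))
    \<le> (t * (wt \<alpha> k * (norm (F $ k))\<^sup>2) + (wt (- \<alpha>) k * (norm (G $ k))\<^sup>2) / t) / 2"
proof -
  define x where "x = t * wt \<alpha> k * norm (F $ k)"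
  define y where "y = norm (G $ k)"
  have c: "t * wt \<alpha> k > 0" using assms by simp
  have inv: "wt (- \<alpha>) k = 1 / wt \<alpha> k" using wt_mult_uminus[of \<alpha> k] by (simp add: field_simps)
  have "2 * x * y \<le> x\<^sup>2 + y\<^sup>2" by (rule sum_squares_bound)
  then have "(2 * x * y) / (t * wt \<alpha> k) \<le> (x\<^sup>2 + y\<^sup>2) / (t * wt \<alpha> k)"
    using c by (intro divide_right_mono) auto
  moreover have "(2 * x * y) / (t * wt \<alpha> k) = 2 * norm (F $ k * cnj (G $ k))"
    using assms by (simp add: x_def y_def norm_mult)
  moreover have "(x\<^sup>2 + y\<^sup>2) / (t * wt \<alpha> k)
      = t * (wt \<alpha> k * (norm (F $ k))\<^sup>2) + (wt (- \<alpha>) k * (norm (G $ k))\<^sup>2) / t"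
    using assms unfolding inv by (simp add: x_def y_def power_mult_distrib power2_eq_square field_simps)
  ultimately show ?thesis by simp
qed

lemma pairing_summable:
  assumes "F \<in> wl2 \<alpha>" "G \<in> wl2 (- \<alpha>)"
  shows "summable (\<lambda>k. norm (F $ k * cnj (G $ k)))"
proof (rule summable_comparison_test')
  show "summable (\<lambda>k. (1 * (wt \<alpha> k * (norm (F $ k))\<^sup>2) + (wt (- \<alpha>) k * (norm (G $ k))\<^sup>2) / 1) / 2)"
    using assms unfolding wl2_iff by (intro summable_divide summable_add summable_mult)
  show "norm (norm (F $ k * cnj (G $ k)))
      \<le> (1 * (wt \<alpha> k * (norm (F $ k))\<^sup>2) + (wt (- \<alpha>) k * (norm (G $ k))\<^sup>2) / 1) / 2" for k
    using pairing_term_bound[of 1 F k G \<alpha>] by simp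
qed

lemma pairing_summable': "F \<in> wl2 \<alpha> \<Longrightarrow> G \<in> wl2 (- \<alpha>) \<Longrightarrow> summable (\<lambda>k. F $ k * cnj (G $ k))"
  by (rule summable_norm_cancel) (rule pairing_summable)

lemma pairing_bound:
  assumes F: "F \<in> wl2 \<alpha>" and G: "G \<in> wl2 (- \<alpha>)" and t: "t > 0"
  shows "norm (pairing F G) \<le> (t * (\<Sum>k. wt \<alpha> k * (norm (F $ k))\<^sup>2)
            + (\<Sum>k. wt (- \<alpha>) k * (norm (G $ k))\<^sup>2) / t) / 2"
proof -
  note sF = F[unfolded wl2_iff] and sG = G[unfolded wl2_iff]
  let ?f = "\<lambda>k. (t * (wt \<alpha> k * (norm (F $ k))\<^sup>2) + (wt (- \<alpha>) k * (norm (G $ k))\<^sup>2) / t) / 2"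
  have "norm (pairing F G) \<le> (\<Sum>k. norm (F $ k * cnj (G $ k)))"
    unfolding pairing_def by (rule summable_norm[OF pairing_summable[OF F G]])
  also have "\<dots> \<le> (\<Sum>k. ?f k)"
    using sF sG by (intro suminf_le pairing_term_bound t pairing_summable[OF F G] summable_divide summable_add summable_mult)
  also have "\<dots> = (t * (\<Sum>k. wt \<alpha> k * (norm (F $ k))\<^sup>2) + (\<Sum>k. wt (- \<alpha>) k * (norm (G $ k))\<^sup>2) / t) / 2"
    using sF sG by (intro sums_unique[symmetric] sums_divide sums_add sums_mult summable_sums)
  finally show ?thesis .
qed

lemma pairing_add_left:
  assumes "F \<in> wl2 \<alpha>" "F' \<in> wl2 \<alpha>" "G \<in> wl2 (- \<alpha>)"
  shows "pairing (F + F') G = pairing F G + pairing F' G"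
  using suminf_add[OF pairing_summable'[OF assms(1,3)] pairing_summable'[OF assms(2,3)]]
  by (simp add: pairing_def distrib_right)

lemma pairing_cmult_left:
  assumes "F \<in> wl2 \<alpha>" "G \<in> wl2 (- \<alpha>)"
  shows "pairing (fps_const c * F) G = c * pairing F G"
  using suminf_mult[OF pairing_summable'[OF assms], of c] by (simp add: pairing_def mult_ac)

lemma pairing_cnj:
  assumes "F \<in> wl2 \<alpha>" "G \<in> wl2 (- \<alpha>)"
  shows "pairing G F = cnj (pairing F G)"
proof -
  have "(\<lambda>k. cnj (F $ k * cnj (G $ k))) sums cnj (pairing F G)"
    unfolding pairing_def sums_cnj by (rule summable_sums[OF pairing_summable'[OF assms]])
  then show ?thesis unfolding pairing_def[of G F] by (simp add: sums_iff mult.commute)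
qed

lemma pairing_add_right:
  assumes "F \<in> wl2 \<alpha>" "G \<in> wl2 (- \<alpha>)" "G' \<in> wl2 (- \<alpha>)"
  shows "pairing F (G + G') = pairing F G + pairing F G'"
  using suminf_add[OF pairing_summable'[OF assms(1,2)] pairing_summable'[OF assms(1,3)]]
  by (simp add: pairing_def distrib_left)

lemma pairing_cmult_right:
  assumes "F \<in> wl2 \<alpha>" "G \<in> wl2 (- \<alpha>)"
  shows "pairing F (fps_const c * G) = cnj c * pairing F G"
  using suminf_mult[OF pairing_summable'[OF assms], of "cnj c"] by (simp add: pairing_def mult_ac)

lemma pairing_diff_left:
  assumes "F \<in> wl2 \<alpha>" "F' \<in> wl2 \<alpha>" "G \<in> wl2 (- \<alpha>)"
  shows "pairing (F - F') G = pairing F G - pairing F' G"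
  using suminf_diff[OF pairing_summable'[OF assms(1,3)] pairing_summable'[OF assms(2,3)]]
  by (simp add: pairing_def left_diff_distrib)

lemma pairing_diff_right:
  assumes "F \<in> wl2 \<alpha>" "G \<in> wl2 (- \<alpha>)" "G' \<in> wl2 (- \<alpha>)"
  shows "pairing F (G - G') = pairing F G - pairing F G'"
  using suminf_diff[OF pairing_summable'[OF assms(1,2)] pairing_summable'[OF assms(1,3)]]
  by (simp add: pairing_def right_diff_distrib)

lemma pairing_1_right [simp]: "pairing F 1 = F $ 0"
proof -
  have "pairing F 1 = (\<Sum>k\<in>{0}. F $ k * cnj (1 $ k))"
    unfolding pairing_def by (rule suminf_finite) auto
  then show ?thesis by simp
qed

lemma pairing_1_left [simp]: "pairing 1 F = cnj (F $ 0)"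
proof -
  have "pairing 1 F = (\<Sum>k\<in>{0}. 1 $ k * cnj (F $ k))"
    unfolding pairing_def by (rule suminf_finite) auto
  then show ?thesis by simp
qed

lemma pairing_self:
  assumes "F \<in> wl2 0"
  shows "pairing F F = of_real (\<Sum>k. (norm (F $ k))\<^sup>2)"
  using assms by (simp add: pairing_def wl2_iff complex_norm_square [symmetric] suminf_of_real)

lemma sqnorm_0_eq_pairing: "F \<in> wl2 0 \<Longrightarrow> sqnorm 0 F = ennreal (Re (pairing F F))"
  by (simp add: pairing_self sqnorm_eq_suminf wl2_def)

lemma wl2_0_mult: "smooth B \<Longrightarrow> F \<in> wl2 0 \<Longrightarrow> B * F \<in> wl2 0"
  by (rule wl2_smooth_mult)

section \<open>Isometric multipliers\<close>

definition isometric :: "complex fps \<Rightarrow> bool" where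
  "isometric B \<longleftrightarrow> smooth B \<and> (\<forall>F\<in>wl2 0. \<forall>G\<in>wl2 0. pairing (B * F) (B * G) = pairing F G)"

lemma isometricD:
  assumes "isometric B"
  shows "smooth B" and "F \<in> wl2 0 \<Longrightarrow> G \<in> wl2 0 \<Longrightarrow> pairing (B * F) (B * G) = pairing F G"
  using assms by (auto simp: isometric_def)

lemma isometric_mult:
  assumes "isometric A" "isometric B"
  shows "isometric (A * B)"
  unfolding isometric_def
proof (intro conjI ballI)
  show "smooth (A * B)" using assms by (simp add: smooth_mult isometricD)
  fix F G assume "F \<in> wl2 0" "G \<in> wl2 0"
  then show "pairing (A * B * F) (A * B * G) = pairing F G"
    using assms by (simp add: mult.assoc isometricD wl2_0_mult)
qed

lemma isometric_const:
  assumes "norm c = 1"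
  shows "isometric (fps_const c)"
proof -
  have "c * cnj c = 1" using assms by (simp flip: complex_norm_square)
  have *: "c * F $ k * (cnj c * cnj (G $ k)) = F $ k * cnj (G $ k)" for F G :: "complex fps" and k
  proof -
    have "c * F $ k * (cnj c * cnj (G $ k)) = (c * cnj c) * (F $ k * cnj (G $ k))"
      by (simp only: mult_ac)
    then show ?thesis using \<open>c * cnj c = 1\<close> by simp
  qed
  show ?thesis by (simp add: isometric_def pairing_def *)
qed

lemma isometric_1: "isometric 1"
  using isometric_const[of 1] by simp

lemma isometric_prod: "(\<And>i. i \<in> I \<Longrightarrow> isometric (f i)) \<Longrightarrow> isometric (prod f I)"
  by (induction I rule: infinite_finite_induct) (auto intro: isometric_1 isometric_mult)

lemma pairing_X:
  assumes "F \<in> wl2 0" "G \<in> wl2 0"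
  shows "pairing (fps_X * F) (fps_X * G) = pairing F G"
proof -
  have "summable (\<lambda>k. (fps_X * F) $ k * cnj ((fps_X * G) $ k))"
    using assms by (intro pairing_summable'[of _ 0]) (auto intro: wl2_0_mult)
  from suminf_split_head[OF this] show ?thesis by (simp add: pairing_def)
qed

text \<open>
  Writing \<open>F = (1 - a\<^sup>* z) P\<close> turns the claim into an identity between \<open>(1 - a\<^sup>* z) P\<close> and
  \<open>(z - a) P\<close>: expanded, both inner products agree because multiplication by \<open>z\<close> is isometric.
\<close>

lemma isometric_blaschke_factor:
  assumes a: "norm a < 1"
  shows "isometric ((fps_X - fps_const a) * inverse (1 - fps_const (cnj a) * fps_X))"
proof -
  define R where "R = inverse (1 - fps_const (cnj a) * fps_X)"
  have R: "smooth R" unfolding R_def using a by (intro smooth_geometric) simp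
  have inv: "(1 - fps_const (cnj a) * fps_X) * R = 1"
    unfolding R_def by (subst mult.commute) (simp add: inverse_mult_eq_1)
  have "pairing ((fps_X - fps_const a) * R * F) ((fps_X - fps_const a) * R * G) = pairing F G"
    if "F \<in> wl2 0" "G \<in> wl2 0" for F G
  proof -
    define P where "P = R * F"
    define Q where "Q = R * G"
    have PQ [simp]: "P \<in> wl2 0" "Q \<in> wl2 0" using that R by (auto simp: P_def Q_def wl2_0_mult)
    have XPQ [simp]: "fps_X * P \<in> wl2 0" "fps_X * Q \<in> wl2 0" by (auto simp: wl2_0_mult)
    note simps = pairing_diff_left[of _ 0] pairing_diff_right[of _ 0] pairing_cmult_left[of _ 0] pairing_cmult_right[of _ 0]
      wl2_diff wl2_cmult pairing_X
    have "pairing (P - fps_const (cnj a) * (fps_X * P)) (Q - fps_const (cnj a) * (fps_X * Q))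
        = pairing (fps_X * P - fps_const a * P) (fps_X * Q - fps_const a * Q)"
      by (simp add: simps) (simp add: algebra_simps)
    moreover have "P - fps_const (cnj a) * (fps_X * P) = F"
    proof -
      have "P - fps_const (cnj a) * (fps_X * P) = ((1 - fps_const (cnj a) * fps_X) * R) * F"
        by (simp add: P_def algebra_simps)
      then show ?thesis unfolding inv by simp
    qed
    moreover have "Q - fps_const (cnj a) * (fps_X * Q) = G"
    proof -
      have "Q - fps_const (cnj a) * (fps_X * Q) = ((1 - fps_const (cnj a) * fps_X) * R) * G"
        by (simp add: Q_def algebra_simps)
      then show ?thesis unfolding inv by simp
    qed
    ultimately show ?thesis by (simp add: P_def Q_def algebra_simps)
  qed
  then show ?thesis using R by (simp add: isometric_def smooth_mult smooth_diff flip: R_def)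
qed

section \<open>Contractive multipliers and subordination\<close>

definition partial_sqnorm :: "nat \<Rightarrow> complex fps \<Rightarrow> real" where
  "partial_sqnorm n F = (\<Sum>k<n. (norm (F $ k))\<^sup>2)"

text \<open>
  Contractivity of every truncation is the form that survives without any convergence assumption
  on \<open>F\<close>, and it is what subordination needs.
\<close>

definition contractive :: "complex fps \<Rightarrow> bool" where
  "contractive B \<longleftrightarrow> (\<forall>F n. partial_sqnorm n (B * F) \<le> partial_sqnorm n F)"

lemma partial_sqnorm_nonneg: "partial_sqnorm n F \<ge> 0"
  by (simp add: partial_sqnorm_def sum_nonneg)

text \<open>
  The first \<open>n\<close> coefficients of a product depend only on the first \<open>n\<close> coefficients of the factor,
  so the estimate for the full norm applies to the truncation.
\<close>

lemma isometric_contractive: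
  assumes "isometric B"
  shows "contractive B"
  unfolding contractive_def
proof (intro allI)
  fix F :: "complex fps" and n
  define C where "C = fps_cutoff n F"
  have C: "C \<in> wl2 0" by (rule wl2_finite_support[of n]) (simp add: C_def)
  have BC: "B * C \<in> wl2 0" using C isometricD(1)[OF assms] by (simp add: wl2_0_mult)
  have "partial_sqnorm n (B * F) = partial_sqnorm n (B * C)"
    by (auto simp: partial_sqnorm_def C_def fps_mult_nth intro!: sum.cong arg_cong[of _ _ "\<lambda>x. (norm x)\<^sup>2"])
  then have "ennreal (partial_sqnorm n (B * F)) \<le> sqnorm 0 (B * C)"
    using weighted_sqnorm_partial[of "wt 0" "{..<n}" "B * C"] by (simp add: partial_sqnorm_def)
  also have "\<dots> = sqnorm 0 C" using C BC assms by (simp add: sqnorm_0_eq_pairing isometricD)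
  also have "\<dots> \<le> ennreal (partial_sqnorm n F)"
  proof (rule weighted_sqnorm_leI)
    fix m
    have "(\<Sum>k<m. wt 0 k * (norm (C $ k))\<^sup>2) = (\<Sum>k\<in>{..<m} \<inter> {..<n}. (norm (F $ k))\<^sup>2)"
      by (intro sum.mono_neutral_cong_right) (auto simp: C_def)
    also have "\<dots> \<le> partial_sqnorm n F" unfolding partial_sqnorm_def by (rule sum_mono2) auto
    finally show "ennreal (\<Sum>k<m. wt 0 k * (norm (C $ k))\<^sup>2) \<le> ennreal (partial_sqnorm n F)" by (rule ennreal_leI)
  qed simp
  finally show "partial_sqnorm n (B * F) \<le> partial_sqnorm n F" using partial_sqnorm_nonneg by simp
qed

lemma moebius_identity:
  fixes x y b :: complex
  shows "(norm (x - cnj b * y))\<^sup>2 - (norm (y - b * x))\<^sup>2 = (1 - (norm b)\<^sup>2) * ((norm x)\<^sup>2 - (norm y)\<^sup>2)"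
  unfolding cmod_power2 by (simp add: power2_eq_square algebra_simps)

text \<open>
  The pointwise identity above, applied to the coefficients of \<open>G\<close> and \<open>B G\<close> and summed, shows that
  the Moebius transform inherits the defect of \<open>B\<close> up to the positive factor \<open>1 - \<bar>b\<bar>\<^sup>2\<close>.
\<close>

lemma contractive_moebius:
  assumes B: "contractive B" and b: "norm b < 1"
  shows "contractive ((B - fps_const b) * inverse (1 - fps_const (cnj b) * B))"
  unfolding contractive_def
proof (intro allI)
  fix F :: "complex fps" and n
  define D where "D = 1 - fps_const (cnj b) * B"
  define G where "G = inverse D * F"
  have "partial_sqnorm 1 (B * 1) \<le> partial_sqnorm 1 1" using B by (simp only: contractive_def)
  then have "norm (B $ 0) \<le> 1" by (simp add: partial_sqnorm_def power2_le_iff_abs_le abs_square_le_1)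
  then have "norm (cnj b * B $ 0) \<noteq> 1"
    using b mult_left_le[of "norm (B $ 0)" "norm b"] by (auto simp: norm_mult)
  then have "D $ 0 \<noteq> 0" unfolding D_def by auto
  then have F: "F = D * G" by (simp add: G_def inverse_mult_eq_1' flip: mult.assoc)
  have "(norm (F $ k))\<^sup>2 - (norm ((B * G - fps_const b * G) $ k))\<^sup>2
      = (1 - (norm b)\<^sup>2) * ((norm (G $ k))\<^sup>2 - (norm ((B * G) $ k))\<^sup>2)" for k
    using moebius_identity[of "G $ k" b "(B * G) $ k"]
    by (simp add: F D_def left_diff_distrib mult.assoc)
  then have "partial_sqnorm n F - partial_sqnorm n (B * G - fps_const b * G) = (1 - (norm b)\<^sup>2) * (partial_sqnorm n G - partial_sqnorm n (B * G))"
    by (simp add: partial_sqnorm_def sum_distrib_left flip: sum_subtractf)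
  also have "\<dots> \<ge> 0"
    using B b by (intro mult_nonneg_nonneg) (auto simp: contractive_def abs_square_le_1)
  finally have "partial_sqnorm n (B * G - fps_const b * G) \<le> partial_sqnorm n F" by simp
  moreover have "(B - fps_const b) * inverse D * F = B * G - fps_const b * G"
    by (simp add: G_def algebra_simps)
  ultimately show "partial_sqnorm n ((B - fps_const b) * inverse (1 - fps_const (cnj b) * B) * F) \<le> partial_sqnorm n F"
    by (simp flip: D_def)
qed

text \<open>
  Rogosinski's theorem on subordinate functions. Split \<open>F = F(0) + z F\<^sub>1\<close>, so that
  \<open>F \<circ> B = F(0) + B (F\<^sub>1 \<circ> B)\<close>: because \<open>B(0) = 0\<close>, the two summands have disjoint supports,
  and multiplication by \<open>B\<close> consumes one coefficient, which feeds the induction.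
\<close>

lemma rogosinski:
  assumes B: "contractive B" and B0: "B $ 0 = 0"
  shows "partial_sqnorm n (F oo B) \<le> partial_sqnorm n F"
proof (induction n arbitrary: F)
  case 0
  then show ?case by (simp add: partial_sqnorm_def)
next
  case (Suc n)
  define F1 where "F1 = fps_shift 1 F"
  define H where "H = F1 oo B"
  define C where "C = fps_cutoff n H"
  have F: "F = fps_const (F $ 0) + fps_X * F1"
    by (rule fps_ext) (simp add: F1_def)
  have FB: "F oo B = fps_const (F $ 0) + B * H"
    by (subst F) (simp add: fps_compose_add_distrib fps_compose_mult_distrib[OF B0] H_def B0)
  have "partial_sqnorm (Suc n) (F oo B) = (norm (F $ 0))\<^sup>2 + (\<Sum>k<n. (norm ((B * H) $ Suc k))\<^sup>2)"
    unfolding partial_sqnorm_def sum.lessThan_Suc_shift FB by (simp add: B0)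
  also have "(\<Sum>k<n. (norm ((B * H) $ Suc k))\<^sup>2) = partial_sqnorm (Suc n) (B * H)"
    unfolding partial_sqnorm_def sum.lessThan_Suc_shift by (simp add: B0)
  \<comment> \<open>As \<open>B(0) = 0\<close>, the coefficients of \<open>B H\<close> up to index \<open>n\<close> involve only those of \<open>H\<close> below \<open>n\<close>.\<close>
  also have "\<dots> = partial_sqnorm (Suc n) (B * C)"
    unfolding partial_sqnorm_def
  proof (intro sum.cong refl)
    fix k assume k: "k \<in> {..<Suc n}"
    have "B $ i * H $ (k - i) = B $ i * C $ (k - i)" if "i \<le> k" for i
      using k that B0 by (cases i) (auto simp: C_def)
    then have "(B * H) $ k = (B * C) $ k" unfolding fps_mult_nth by (intro sum.cong) auto
    then show "(norm ((B * H) $ k))\<^sup>2 = (norm ((B * C) $ k))\<^sup>2" by simp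
  qed
  also have "\<dots> \<le> partial_sqnorm (Suc n) C" using B by (simp add: contractive_def)
  also have "\<dots> = partial_sqnorm n H" by (simp add: partial_sqnorm_def C_def)
  also have "\<dots> \<le> partial_sqnorm n F1" unfolding H_def by (rule Suc.IH)
  also have "(norm (F $ 0))\<^sup>2 + partial_sqnorm n F1 = partial_sqnorm (Suc n) F"
    unfolding partial_sqnorm_def sum.lessThan_Suc_shift by (simp add: F1_def)
  finally show ?case by simp
qed

lemma abel_nonneg:
  fixes w d :: "nat \<Rightarrow> real"
  assumes w: "\<And>k. w k \<ge> 0" "\<And>k. w (Suc k) \<le> w k" and d: "\<And>n. (\<Sum>k<n. d k) \<ge> 0"
  shows "(\<Sum>k<n. w k * d k) \<ge> 0"
proof -
  have *: "(\<Sum>k<Suc n. w k * d k) \<ge> w n * (\<Sum>k<Suc n. d k)" for n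
  proof (induction n)
    case (Suc n)
    have "w (Suc n) * (\<Sum>k<Suc n. d k) \<le> w n * (\<Sum>k<Suc n. d k)"
      by (intro mult_right_mono w d)
    then show ?case using Suc by (simp add: algebra_simps)
  qed simp
  show ?thesis
  proof (cases n)
    case (Suc m)
    have "0 \<le> w m * (\<Sum>k<Suc m. d k)" by (intro mult_nonneg_nonneg w d)
    then show ?thesis using *[of m] unfolding Suc by linarith
  qed simp
qed

text \<open>
  For \<open>\<alpha> \<le> 0\<close> the weights decrease, so summation by parts turns the estimates on all partial sums
  into one for the weighted norm.
\<close>

lemma sqnorm_compose_contractive:
  assumes B: "contractive B" and B0: "B $ 0 = 0" and \<alpha>: "\<alpha> \<le> 0"
  shows "sqnorm \<alpha> (F oo B) \<le> sqnorm \<alpha> F"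
proof (rule weighted_sqnorm_leI)
  fix n
  have "(\<Sum>k<n. wt \<alpha> k * ((norm (F $ k))\<^sup>2 - (norm ((F oo B) $ k))\<^sup>2)) \<ge> 0"
    using rogosinski[OF B B0, of _ F] wt_antimono[OF \<alpha>]
    by (intro abel_nonneg) (auto simp: partial_sqnorm_def sum_subtractf)
  then have "(\<Sum>k<n. wt \<alpha> k * (norm ((F oo B) $ k))\<^sup>2) \<le> (\<Sum>k<n. wt \<alpha> k * (norm (F $ k))\<^sup>2)"
    by (simp add: right_diff_distrib sum_subtractf)
  then have "ennreal (\<Sum>k<n. wt \<alpha> k * (norm ((F oo B) $ k))\<^sup>2) \<le> ennreal (\<Sum>k<n. wt \<alpha> k * (norm (F $ k))\<^sup>2)"
    by (rule ennreal_leI)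
  also have "\<dots> \<le> sqnorm \<alpha> F" by (rule weighted_sqnorm_partial) auto
  finally show "ennreal (\<Sum>k<n. wt \<alpha> k * (norm ((F oo B) $ k))\<^sup>2) \<le> sqnorm \<alpha> F" .
qed simp

section \<open>Substitution into polynomials\<close>

text \<open>
  Composition \<open>p \<circ> B\<close> for a polynomial \<open>p\<close>. Unlike the composition of formal power series it makes
  sense when \<open>B(0) \<noteq> 0\<close>.
\<close>

definition psubst :: "complex poly \<Rightarrow> complex fps \<Rightarrow> complex fps" where
  "psubst p B = poly (map_poly fps_const p) B"

lemma psubst_0 [simp]: "psubst 0 B = 0"
  by (simp add: psubst_def)

lemma psubst_pCons [simp]: "psubst (pCons a p) B = fps_const a + B * psubst p B"
  by (simp add: psubst_def map_poly_pCons)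

lemma psubst_add: "psubst (p + q) B = psubst p B + psubst q B"
proof -
  have "map_poly fps_const (p + q) = map_poly fps_const p + map_poly fps_const q"
    by (rule poly_eqI) (simp add: coeff_map_poly)
  then show ?thesis by (simp add: psubst_def)
qed

lemma psubst_smult: "psubst (smult c p) B = fps_const c * psubst p B"
  by (induction p) (simp_all add: algebra_simps)

lemma fps_of_poly_eq_psubst: "fps_of_poly p = psubst p fps_X"
  by (induction p) (simp_all add: fps_of_poly_pCons mult.commute)

lemma smooth_psubst: "smooth B \<Longrightarrow> smooth (psubst p B)"
  by (induction p) (auto intro: smooth_add smooth_mult)

lemma smooth_of_poly [simp]: "smooth (fps_of_poly p)"
  by (simp add: fps_of_poly_eq_psubst smooth_psubst)

lemma fps_deriv_psubst: "fps_deriv (psubst p B) = psubst (pderiv p) B * fps_deriv B"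
  by (induction p) (simp_all add: pderiv_pCons psubst_add algebra_simps)

lemma psubst_compose:
  assumes "B $ 0 = 0"
  shows "psubst p (F oo B) = psubst p F oo B"
  by (induction p) (simp_all add: fps_compose_add_distrib fps_compose_mult_distrib[OF assms])

text \<open>
  On \<open>H\<^sup>2\<close> the vectors \<open>h B\<^sup>k\<close> are orthogonal, where \<open>h = 1 - b\<^sup>* B\<close> is chosen to be orthogonal to
  \<open>B H\<^sup>2\<close>. It arises by applying to the constant \<open>1\<close> the projection onto the complement of \<open>B H\<^sup>2\<close>.
  Hence \<open>p \<mapsto> h (p \<circ> B)\<close> is a multiple of an isometry.
\<close>

lemma orthonormal_system:
  assumes B: "isometric B" and b: "b = B $ 0"
  defines "h \<equiv> 1 - fps_const (cnj b) * B"
  shows "G \<in> wl2 0 \<Longrightarrow> pairing (B * G) h = 0"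
    and "pairing (h * psubst p B) (h * psubst q B) = of_real (1 - (norm b)\<^sup>2) * pairing (fps_of_poly p) (fps_of_poly q)"
proof -
  note sB = isometricD(1)[OF B]
  have WB [simp]: "B \<in> wl2 0" "1 \<in> wl2 0" "fps_const (cnj b) * B \<in> wl2 0"
    using sB by (auto intro!: smoothD smooth_mult)
  have h: "smooth h" unfolding h_def using sB by (intro smooth_diff smooth_mult) auto
  have orth: "pairing (B * G) h = 0" if G: "G \<in> wl2 0" for G
  proof -
    have "pairing (B * G) (B * 1) = pairing G 1" using G by (intro isometricD(2)[OF B]) auto
    moreover have "pairing (B * G) h = (B * G) $ 0 - b * pairing (B * G) B" using wl2_0_mult[OF sB G]
      by (simp add: h_def pairing_diff_right[of _ 0] pairing_cmult_right[of _ 0])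
    ultimately show ?thesis by (simp add: b)
  qed
  then show "pairing (B * G) h = 0" if "G \<in> wl2 0" using that .
  have "pairing (B * 1) h = 0" by (rule orth) simp
  then have "pairing (1 - fps_const (cnj b) * B) h = pairing 1 h"
    using smoothD[OF h, of 0] by (simp add: pairing_diff_left[of _ 0] pairing_cmult_left[of _ 0])
  then have hh: "pairing h h = of_real (1 - (norm b)\<^sup>2)"
    by (simp add: h_def b mult.commute flip: complex_norm_square)
  show "pairing (h * psubst p B) (h * psubst q B) = of_real (1 - (norm b)\<^sup>2) * pairing (fps_of_poly p) (fps_of_poly q)"
  proof (induction p arbitrary: q)
    case 0
    then show ?case by (simp add: pairing_def)
  next
    case (pCons a p)
    obtain c q' where q: "q = pCons c q'" by (cases q)
    define P where "P = h * psubst p B"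
    define Q where "Q = h * psubst q' B"
    have PQ [simp]: "P \<in> wl2 0" "Q \<in> wl2 0"
      using h sB by (auto simp: P_def Q_def intro!: smoothD smooth_mult smooth_psubst)
    have [simp]: "B * P \<in> wl2 0" "B * Q \<in> wl2 0" "h \<in> wl2 0" using sB h by (auto simp: wl2_0_mult smoothD)
    have e: "h * psubst (pCons a p) B = fps_const a * h + B * P" "h * psubst q B = fps_const c * h + B * Q"
      by (simp_all add: P_def Q_def q algebra_simps)
    have hQ: "pairing h (B * Q) = 0" using orth[of Q] pairing_cnj[of "B * Q" 0 h] by simp
    have "pairing (h * psubst (pCons a p) B) (h * psubst q B) = a * cnj c * pairing h h + pairing P Q"
      unfolding e using orth[of P] hQ isometricD(2)[OF B, of P Q]
      by (simp add: pairing_add_left[of _ 0] pairing_add_right[of _ 0] pairing_cmult_left[of _ 0] pairing_cmult_right[of _ 0]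
            wl2_add wl2_cmult)
    moreover have "pairing (fps_of_poly (pCons a p)) (fps_of_poly q) = a * cnj c + pairing (fps_of_poly p) (fps_of_poly q')"
    proof -
      have "summable (\<lambda>k. fps_of_poly (pCons a p) $ k * cnj (fps_of_poly q $ k))"
        by (intro pairing_summable'[of _ 0] smoothD smooth_of_poly)
      from suminf_split_head[OF this] show ?thesis by (simp add: pairing_def q)
    qed
    ultimately show ?case
      using pCons.IH[of q'] hh by (simp add: P_def Q_def algebra_simps)
  qed
qed

section \<open>Interpolation between weights\<close>

lemma ennreal_bound_trans:
  assumes "x \<le> ennreal K * y" "y \<le> ennreal L * z" "0 \<le> K" "0 \<le> L"
  shows "x \<le> ennreal (K * L) * z"
proof -
  have "x \<le> ennreal K * (ennreal L * z)" by (rule order_trans[OF assms(1) mult_left_mono[OF assms(2)]]) simp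
  then show ?thesis using assms(3,4) by (simp add: ennreal_mult mult.assoc)
qed

lemma ennreal_bound_add:
  assumes "x \<le> ennreal K * z" "y \<le> ennreal L * z" "0 \<le> K" "0 \<le> L"
  shows "x + y \<le> ennreal (K + L) * z"
  using add_mono[OF assms(1,2)] assms(3,4) by (simp add: ennreal_plus distrib_right)

lemma poly_restrict_coeffs: "\<exists>q. \<forall>k. coeff q k = (if P k then coeff p k else 0)"
proof -
  have "eventually (\<lambda>k. (if P k then coeff p k else 0) = 0) cofinite"
    using MOST_coeff_eq_0[of p] by (rule eventually_mono) auto
  then have "coeff (Abs_poly (\<lambda>k. if P k then coeff p k else 0)) = (\<lambda>k. if P k then coeff p k else 0)"
    by (intro Abs_poly_inverse) simp
  then show ?thesis by (intro exI[of _ "Abs_poly (\<lambda>k. if P k then coeff p k else 0)"]) simp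
qed

text \<open>
  Interpolation in its simplest form: cut the polynomial into the coefficients where \<open>u\<close> is the
  smaller weight and those where \<open>v\<close> is, and use the bound for \<open>u\<close> on the first piece and the one
  for \<open>v\<close> on the second.
\<close>

lemma weighted_sqnorm_min_bounded:
  fixes T :: "complex poly \<Rightarrow> complex fps"
  assumes T: "\<And>p q. T (p + q) = T p + T q"
    and u: "\<And>k. u k \<ge> 0" "\<And>p. weighted_sqnorm u (T p) \<le> ennreal K * weighted_sqnorm u (fps_of_poly p)"
    and v: "\<And>k. v k \<ge> 0" "\<And>p. weighted_sqnorm v (T p) \<le> ennreal K * weighted_sqnorm v (fps_of_poly p)"
  shows "weighted_sqnorm (\<lambda>k. min (u k) (v k)) (T p) \<le> 2 * ennreal K * weighted_sqnorm (\<lambda>k. min (u k) (v k)) (fps_of_poly p)"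
proof -
  let ?m = "\<lambda>k. min (u k) (v k)"
  obtain q where q: "\<forall>k. coeff q k = (if u k \<le> v k then coeff p k else 0)"
    using poly_restrict_coeffs[of "\<lambda>k. u k \<le> v k" p] by blast
  define r where "r = p - q"
  have p: "p = q + r" by (simp add: r_def)
  have "weighted_sqnorm ?m (T p) \<le> 2 * weighted_sqnorm ?m (T q) + 2 * weighted_sqnorm ?m (T r)"
    unfolding p T by (rule weighted_sqnorm_add) (simp add: u v)
  also have "\<dots> \<le> 2 * weighted_sqnorm u (T q) + 2 * weighted_sqnorm v (T r)"
    by (intro add_mono mult_left_mono weighted_sqnorm_mono mult_right_mono) auto
  also have "\<dots> \<le> 2 * (ennreal K * weighted_sqnorm u (fps_of_poly q)) + 2 * (ennreal K * weighted_sqnorm v (fps_of_poly r))"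
    by (intro add_mono mult_left_mono u v) auto
  also have "\<dots> = 2 * ennreal K * (weighted_sqnorm u (fps_of_poly q) + weighted_sqnorm v (fps_of_poly r))"
    by (simp add: distrib_left mult.assoc)
  also have "weighted_sqnorm u (fps_of_poly q) + weighted_sqnorm v (fps_of_poly r) = weighted_sqnorm ?m (fps_of_poly p)"
  proof -
    have "ennreal (u k * (norm (fps_of_poly q $ k))\<^sup>2) + ennreal (v k * (norm (fps_of_poly r $ k))\<^sup>2)
        = ennreal (?m k * (norm (fps_of_poly p $ k))\<^sup>2)" for k
      by (simp add: q r_def min_def)
    then show ?thesis by (simp add: weighted_sqnorm_def suminf_add[OF summableI summableI])
  qed
  finally show ?thesis .
qed

lemma ennreal_suminf_swap:
  fixes f :: "nat \<Rightarrow> nat \<Rightarrow> ennreal"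
  shows "(\<Sum>k. \<Sum>j. f j k) = (\<Sum>j. \<Sum>k. f j k)"
  using nn_integral_suminf[of "\<lambda>j. f j" "count_space UNIV"]
  by (simp add: nn_integral_count_space_nat)

lemma weighted_sqnorm_suminf_weight:
  assumes "\<And>j k. w j k \<ge> 0" "\<And>k. summable (\<lambda>j. w j k)"
  shows "weighted_sqnorm (\<lambda>k. \<Sum>j. w j k) F = (\<Sum>j. weighted_sqnorm (w j) F)"
proof -
  have "ennreal ((\<Sum>j. w j k) * (norm (F $ k))\<^sup>2) = (\<Sum>j. ennreal (w j k * (norm (F $ k))\<^sup>2))" for k
    using assms by (subst suminf_ennreal2) (auto intro: summable_mult2 simp: suminf_mult2)
  then have "weighted_sqnorm (\<lambda>k. \<Sum>j. w j k) F = (\<Sum>k. \<Sum>j. ennreal (w j k * (norm (F $ k))\<^sup>2))"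
    unfolding weighted_sqnorm_def by (simp only:)
  also have "\<dots> = (\<Sum>j. weighted_sqnorm (w j) F)" unfolding weighted_sqnorm_def by (rule ennreal_suminf_swap)
  finally show ?thesis .
qed

text \<open>
  A power weight with exponent strictly between \<open>- q\<close> and \<open>0\<close> is comparable to
  \<open>\<Sum>\<^sub>j 2\<^sup>j\<^sup>\<alpha> min 1 ((2\<^sup>j / (k + 1))\<^sup>q)\<close>. The terms grow geometrically until \<open>2\<^sup>j\<close> reaches \<open>k + 1\<close> and
  decay geometrically afterwards, so the sum has the size of its largest term, \<open>(k + 1)\<^sup>\<alpha>\<close>.
\<close>

lemma dyadic_weight:
  assumes \<alpha>: "\<alpha> < 0" "0 < \<alpha> + q"
  obtains w c C where "c > 0" "\<And>j::nat. \<exists>s\<ge>0. \<exists>t\<ge>0. w j = (\<lambda>k. t * min (wt 0 k) (s * wt (- q) k))"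
    "\<And>k. summable (\<lambda>j. w j k)" "\<And>k. c * wt \<alpha> k \<le> (\<Sum>j. w j k)" "\<And>k. (\<Sum>j. w j k) \<le> C * wt \<alpha> k"
proof -
  define x where "x = 2 powr \<alpha>"
  define y where "y = 2 powr q"
  define w where "w j k = x ^ j * min (wt 0 k) (y ^ j * wt (- q) k)" for j k
  have x: "0 < x" "x < 1" using \<alpha> by (auto simp: x_def powr_less_one)
  have y: "0 < y" by (simp add: y_def)
  have xy: "x * y > 1" using \<alpha> by (simp add: x_def y_def flip: powr_add)
  have xp: "x ^ j = (2 ^ j) powr \<alpha>" and yp: "y ^ j = (2 ^ j) powr q" for j
    by (simp_all add: x_def y_def powr_power flip: powr_realpow, simp_all add: powr_powr mult.commute)
  have w0: "w j k \<ge> 0" for j k using x y by (simp add: w_def)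
  have wx: "w j k \<le> x ^ j" for j k
    using x mult_left_mono[of "min 1 (y ^ j * wt (- q) k)" 1 "x ^ j"] by (simp add: w_def)
  have sx: "summable (\<lambda>j. x ^ j)" using x by (intro summable_geometric) auto
  have sw: "summable (\<lambda>j. w j k)" for k
    by (rule summable_comparison_test'[OF sx]) (use w0 wx in auto)
  define C where "C = 2 powr (\<alpha> + q) / (x * y - 1) + 1 / (1 - x)"
  have main: "x * wt \<alpha> k \<le> (\<Sum>j. w j k) \<and> (\<Sum>j. w j k) \<le> C * wt \<alpha> k" for k
  proof -
    define T where "T = real k + 1"
    have T: "T \<ge> 1" by (simp add: T_def)
    \<comment> \<open>The index of the dominant term.\<close>
    define j0 where "j0 = (LEAST j. T \<le> 2 ^ j)"
    obtain n :: nat where "T < 2 ^ n" using real_arch_pow[of 2 T] by auto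
    then have T_le: "T \<le> 2 ^ j0" unfolding j0_def by (intro LeastI[of "\<lambda>j. T \<le> 2 ^ j" n]) simp
    have le_T: "2 ^ j0 \<le> 2 * T"
    proof (cases j0)
      case (Suc j)
      then have "\<not> T \<le> 2 ^ j" unfolding j0_def by (intro not_less_Least) simp
      then show ?thesis by (simp add: Suc)
    qed (use T in simp)
    have wq: "wt (- q) k = T powr (- q)" and w\<alpha>: "wt \<alpha> k = T powr \<alpha>" by (simp_all add: wt_def T_def)
    have "x * wt \<alpha> k = (2 * T) powr \<alpha>" using T by (simp add: x_def w\<alpha> powr_mult)
    also have "\<dots> \<le> (2 ^ j0) powr \<alpha>" using le_T \<alpha> T by (intro powr_mono2') auto
    also have "\<dots> = w j0 k"
    proof -
      have "T powr q \<le> (2 ^ j0) powr q" using \<alpha> T T_le by (intro powr_mono2) auto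
      then have "1 \<le> y ^ j0 * wt (- q) k"
        using T by (simp add: yp wq powr_minus field_simps)
      then show ?thesis by (simp add: w_def xp)
    qed
    also have "\<dots> = (\<Sum>j\<in>{j0}. w j k)" by simp
    also have "\<dots> \<le> (\<Sum>j. w j k)" by (rule sum_le_suminf[OF sw]) (use w0 in auto)
    finally have lower: "x * wt \<alpha> k \<le> (\<Sum>j. w j k)" .
    have "(\<Sum>j<j0. w j k) \<le> (\<Sum>j<j0. (x * y) ^ j * wt (- q) k)"
      using x by (intro sum_mono) (auto simp: w_def power_mult_distrib mult.assoc intro!: mult_left_mono)
    also have "\<dots> = ((x * y) ^ j0 - 1) / (x * y - 1) * wt (- q) k"
      using xy by (simp add: geometric_sum flip: sum_distrib_right)
    also have "\<dots> \<le> (2 * T) powr (\<alpha> + q) / (x * y - 1) * wt (- q) k"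
    proof -
      have "(x * y) ^ j0 = (2 ^ j0) powr (\<alpha> + q)" by (simp add: power_mult_distrib xp yp powr_add)
      also have "\<dots> \<le> (2 * T) powr (\<alpha> + q)" using le_T \<alpha> by (intro powr_mono2) auto
      finally have "(x * y) ^ j0 - 1 \<le> (2 * T) powr (\<alpha> + q)" by simp
      then show ?thesis using xy by (intro mult_right_mono divide_right_mono) auto
    qed
    also have "\<dots> = 2 powr (\<alpha> + q) / (x * y - 1) * wt \<alpha> k"
      using T by (simp add: wq w\<alpha> powr_mult powr_add powr_minus field_simps)
    finally have low: "(\<Sum>j<j0. w j k) \<le> 2 powr (\<alpha> + q) / (x * y - 1) * wt \<alpha> k" .
    have "(\<Sum>j. w (j + j0) k) \<le> (\<Sum>j. x ^ j * x ^ j0)"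
      by (intro suminf_le summable_mult2 sx summable_ignore_initial_segment sw)
        (simp add: wx flip: power_add)
    also have "\<dots> = 1 / (1 - x) * x ^ j0"
      using x by (subst suminf_mult2 [symmetric]) (auto simp: suminf_geometric sx)
    also have "\<dots> \<le> 1 / (1 - x) * wt \<alpha> k"
      unfolding xp w\<alpha> using x T T_le \<alpha> by (intro mult_left_mono powr_mono2') auto
    finally have "(\<Sum>j. w (j + j0) k) \<le> 1 / (1 - x) * wt \<alpha> k" .
    with low have "(\<Sum>j. w j k) \<le> C * wt \<alpha> k"
      by (subst suminf_split_initial_segment[OF sw, of _ j0]) (simp add: C_def distrib_right)
    with lower show ?thesis by simp
  qed
  have "\<exists>s\<ge>0. \<exists>t\<ge>0. w j = (\<lambda>k. t * min (wt 0 k) (s * wt (- q) k))" for j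
    using x y by (intro exI[of _ "y ^ j"] conjI exI[of _ "x ^ j"]) (auto simp: w_def)
  from that[OF x(1) this sw] main show thesis by blast
qed

lemma interpolation:
  fixes T :: "complex poly \<Rightarrow> complex fps"
  assumes T: "\<And>p q. T (p + q) = T p + T q" and \<alpha>: "\<alpha> < 0" "0 < \<alpha> + q" and K: "K > 0"
    and b0: "\<And>p. sqnorm 0 (T p) \<le> ennreal K * sqnorm 0 (fps_of_poly p)"
    and bq: "\<And>p. sqnorm (- q) (T p) \<le> ennreal K * sqnorm (- q) (fps_of_poly p)"
  shows "\<exists>L>0. \<forall>p. sqnorm \<alpha> (T p) \<le> ennreal L * sqnorm \<alpha> (fps_of_poly p)"
proof -
  obtain w c C where c: "c > 0"
    and w: "\<And>j::nat. \<exists>s\<ge>0. \<exists>t\<ge>0. w j = (\<lambda>k. t * min (wt 0 k) (s * wt (- q) k))"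
    and sw: "\<And>k. summable (\<lambda>j. w j k)" and lower: "\<And>k. c * wt \<alpha> k \<le> (\<Sum>j. w j k)"
    and upper: "\<And>k. (\<Sum>j. w j k) \<le> C * wt \<alpha> k"
    by (rule dyadic_weight[OF \<alpha>], rule that)
  have w0: "w j k \<ge> 0" for j k using w[of j] by auto
  have C: "C > 0" using c lower[of 0] upper[of 0] by simp
  define \<Omega> where "\<Omega> k = (\<Sum>j. w j k)" for k
  have wj: "weighted_sqnorm (w j) (T p) \<le> ennreal (2 * K) * weighted_sqnorm (w j) (fps_of_poly p)" for j p
  proof -
    obtain s t where st: "s \<ge> 0" "t \<ge> 0" and wj: "w j = (\<lambda>k. t * min (wt 0 k) (s * wt (- q) k))"
      using w[of j] by blast
    have "weighted_sqnorm (\<lambda>k. s * wt (- q) k) (T p) \<le> ennreal K * weighted_sqnorm (\<lambda>k. s * wt (- q) k) (fps_of_poly p)" for p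
      using mult_left_mono[OF bq[of p], of "ennreal s"] st by (simp add: weighted_sqnorm_cmult_weight mult_ac)
    then have "weighted_sqnorm (\<lambda>k. min (wt 0 k) (s * wt (- q) k)) (T p)
        \<le> 2 * ennreal K * weighted_sqnorm (\<lambda>k. min (wt 0 k) (s * wt (- q) k)) (fps_of_poly p)"
      using st by (intro weighted_sqnorm_min_bounded T b0) auto
    from mult_left_mono[OF this, of "ennreal t"] show ?thesis
      unfolding wj using st K by (subst (1 2) weighted_sqnorm_cmult_weight) (auto simp: ennreal_mult mult_ac)
  qed
  have "sqnorm \<alpha> (T p) \<le> ennreal ((1 / c) * (2 * K * C)) * sqnorm \<alpha> (fps_of_poly p)" for p
  proof (rule ennreal_bound_trans)
    have "sqnorm \<alpha> (T p) \<le> weighted_sqnorm (\<lambda>k. 1 / c * \<Omega> k) (T p)"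
      using lower c by (intro weighted_sqnorm_mono mult_right_mono) (auto simp: \<Omega>_def field_simps)
    also have "\<dots> = ennreal (1 / c) * weighted_sqnorm \<Omega> (T p)"
      using c w0 sw by (intro weighted_sqnorm_cmult_weight) (auto simp: \<Omega>_def suminf_nonneg)
    finally show "sqnorm \<alpha> (T p) \<le> ennreal (1 / c) * weighted_sqnorm \<Omega> (T p)" .
    show "weighted_sqnorm \<Omega> (T p) \<le> ennreal (2 * K * C) * sqnorm \<alpha> (fps_of_poly p)"
    proof (rule ennreal_bound_trans)
      have "weighted_sqnorm \<Omega> (T p) = (\<Sum>j. weighted_sqnorm (w j) (T p))"
        unfolding \<Omega>_def by (rule weighted_sqnorm_suminf_weight[OF w0 sw])
      also have "\<dots> \<le> (\<Sum>j. ennreal (2 * K) * weighted_sqnorm (w j) (fps_of_poly p))"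
        by (intro suminf_le summableI wj)
      also have "\<dots> = ennreal (2 * K) * (\<Sum>j. weighted_sqnorm (w j) (fps_of_poly p))" by (rule ennreal_suminf_cmult)
      also have "(\<Sum>j. weighted_sqnorm (w j) (fps_of_poly p)) = weighted_sqnorm \<Omega> (fps_of_poly p)"
        unfolding \<Omega>_def by (rule weighted_sqnorm_suminf_weight[OF w0 sw, symmetric])
      finally show "weighted_sqnorm \<Omega> (T p) \<le> ennreal (2 * K) * weighted_sqnorm \<Omega> (fps_of_poly p)" .
      have "weighted_sqnorm \<Omega> (fps_of_poly p) \<le> weighted_sqnorm (\<lambda>k. C * wt \<alpha> k) (fps_of_poly p)"
        using upper by (intro weighted_sqnorm_mono mult_right_mono) (auto simp: \<Omega>_def)
      then show "weighted_sqnorm \<Omega> (fps_of_poly p) \<le> ennreal C * sqnorm \<alpha> (fps_of_poly p)"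
        using C by (simp add: weighted_sqnorm_cmult_weight)
    qed (use K C in auto)
  qed (use K C c in auto)
  moreover have "(1 / c) * (2 * K * C) > 0" using K C c by simp
  ultimately show ?thesis by blast
qed

section \<open>Boundedness of composition operators\<close>

text \<open>
  Polynomials are dense, so a uniform bound on them is all that the boundedness of
  \<open>f \<mapsto> f \<circ> B\<close> means.
\<close>

definition comp_bounded :: "complex fps \<Rightarrow> real \<Rightarrow> bool" where
  "comp_bounded B \<alpha> \<longleftrightarrow> (\<exists>K>0. \<forall>p. sqnorm \<alpha> (psubst p B) \<le> ennreal K * sqnorm \<alpha> (fps_of_poly p))"

lemma fps_deriv_of_poly: "fps_deriv (fps_of_poly (p :: complex poly)) = fps_of_poly (pderiv p)"
  unfolding fps_of_poly_eq_psubst fps_deriv_psubst by simp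

text \<open>
  Chain rule: \<open>(p \<circ> B)' = B' (p' \<circ> B)\<close>, and differentiation lowers the exponent by two.
\<close>

lemma comp_bounded_step_up:
  assumes B: "smooth B" and b: "comp_bounded B \<beta>"
  shows "comp_bounded B (\<beta> + 2)"
proof -
  obtain K where K: "K > 0" and bK: "\<And>p. sqnorm \<beta> (psubst p B) \<le> ennreal K * sqnorm \<beta> (fps_of_poly p)"
    using b by (auto simp: comp_bounded_def)
  obtain M where M: "M > 0" and bM: "\<And>F. sqnorm \<beta> (fps_deriv B * F) \<le> ennreal M * sqnorm \<beta> F"
    using smooth_multiplier[OF smooth_deriv[OF B], of \<beta>] by auto
  define C where "C = (2::real) powr \<bar>\<beta> + 2\<bar>"
  have C: "C > 0" by (simp add: C_def)
  have "sqnorm (\<beta> + 2) (psubst p B) \<le> ennreal (K + C * (M * (K * C))) * sqnorm (\<beta> + 2) (fps_of_poly p)" for p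
  proof -
    have "sqnorm (\<beta> + 2) (psubst p B) \<le> ennreal ((norm (psubst p B $ 0))\<^sup>2) + ennreal C * sqnorm \<beta> (fps_deriv (psubst p B))"
      unfolding C_def by (rule sqnorm_antideriv)
    also have "\<dots> \<le> ennreal (K + C * (M * (K * C))) * sqnorm (\<beta> + 2) (fps_of_poly p)"
    proof (rule ennreal_bound_add)
      have "ennreal ((norm (psubst p B $ 0))\<^sup>2) \<le> sqnorm \<beta> (psubst p B)" using sqnorm_coeff[of \<beta> 0] by simp
      also have "\<dots> \<le> ennreal K * sqnorm \<beta> (fps_of_poly p)" by (rule bK)
      also have "\<dots> \<le> ennreal K * sqnorm (\<beta> + 2) (fps_of_poly p)" by (intro mult_left_mono sqnorm_mono_exponent) auto
      finally show "ennreal ((norm (psubst p B $ 0))\<^sup>2) \<le> ennreal K * sqnorm (\<beta> + 2) (fps_of_poly p)" .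
      have "sqnorm \<beta> (fps_deriv (psubst p B)) \<le> ennreal (M * (K * C)) * sqnorm (\<beta> + 2) (fps_of_poly p)"
      proof (rule ennreal_bound_trans)
        show "sqnorm \<beta> (fps_deriv (psubst p B)) \<le> ennreal M * sqnorm \<beta> (psubst (pderiv p) B)"
          using bM[of "psubst (pderiv p) B"] by (simp add: fps_deriv_psubst mult.commute)
        show "sqnorm \<beta> (psubst (pderiv p) B) \<le> ennreal (K * C) * sqnorm (\<beta> + 2) (fps_of_poly p)"
          by (rule ennreal_bound_trans[OF bK])
            (use K C sqnorm_deriv[of \<beta> "fps_of_poly p"] in \<open>auto simp: fps_deriv_of_poly C_def\<close>)
      qed (use K M C in auto)
      from mult_left_mono[OF this, of "ennreal C"]
      show "ennreal C * sqnorm \<beta> (fps_deriv (psubst p B)) \<le> ennreal (C * (M * (K * C))) * sqnorm (\<beta> + 2) (fps_of_poly p)"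
        using K C M by (simp add: ennreal_mult mult.assoc)
    qed (use K M C in auto)
    finally show ?thesis .
  qed
  moreover have "K + C * (M * (K * C)) > 0" using K M C by (simp add: add_pos_pos)
  ultimately show ?thesis unfolding comp_bounded_def by blast
qed

lemma poly_antideriv: "\<exists>P::complex poly. pderiv P = p \<and> coeff P 0 = 0"
proof -
  define P where "P = (\<Sum>i\<le>degree p. monom (coeff p i / of_nat (Suc i)) (Suc i))"
  have "pderiv P = (\<Sum>i\<le>degree p. monom (coeff p i) i)"
  proof -
    have sum: "pderiv (sum f A) = (\<Sum>i\<in>A. pderiv (f i))" for f :: "nat \<Rightarrow> complex poly" and A
      by (induction A rule: infinite_finite_induct) (simp_all add: pderiv_add)
    show ?thesis
      unfolding P_def sum by (intro sum.cong refl) (simp add: pderiv_monom del: of_nat_Suc)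
  qed
  moreover have "coeff P 0 = 0" by (simp add: P_def coeff_sum)
  ultimately show ?thesis by (auto simp: poly_as_sum_of_monoms)
qed

text \<open>
  The chain rule in the other direction: if \<open>P' = p\<close> then \<open>p \<circ> B = (1 / B') (P \<circ> B)'\<close>. This needs
  \<open>1 / B'\<close> to be a multiplier, which fails for a general Blaschke product since \<open>B'\<close> has zeros in the
  disc, but holds for a Moebius transformation.
\<close>

lemma comp_bounded_step_down:
  assumes E: "smooth E" "E * fps_deriv B = 1" and b: "comp_bounded B (\<beta> + 2)"
  shows "comp_bounded B \<beta>"
proof -
  obtain K where K: "K > 0" and bK: "\<And>p. sqnorm (\<beta> + 2) (psubst p B) \<le> ennreal K * sqnorm (\<beta> + 2) (fps_of_poly p)"
    using b by (auto simp: comp_bounded_def)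
  obtain M where M: "M > 0" and bM: "\<And>F. sqnorm \<beta> (E * F) \<le> ennreal M * sqnorm \<beta> F"
    using smooth_multiplier[OF E(1), of \<beta>] by auto
  define C where "C = (2::real) powr \<bar>\<beta> + 2\<bar>"
  have C: "C > 0" by (simp add: C_def)
  have "sqnorm \<beta> (psubst p B) \<le> ennreal (M * (C * (K * C))) * sqnorm \<beta> (fps_of_poly p)" for p
  proof -
    obtain P where P: "pderiv P = p" "coeff P 0 = 0" using poly_antideriv by blast
    show ?thesis
    proof (rule ennreal_bound_trans)
      have "psubst p B = E * fps_deriv (psubst P B)"
        using E(2) by (simp add: fps_deriv_psubst P mult_ac)
      then show "sqnorm \<beta> (psubst p B) \<le> ennreal M * sqnorm \<beta> (fps_deriv (psubst P B))" using bM by simp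
      show "sqnorm \<beta> (fps_deriv (psubst P B)) \<le> ennreal (C * (K * C)) * sqnorm \<beta> (fps_of_poly p)"
      proof (rule ennreal_bound_trans)
        show "sqnorm \<beta> (fps_deriv (psubst P B)) \<le> ennreal C * sqnorm (\<beta> + 2) (psubst P B)"
          unfolding C_def by (rule sqnorm_deriv)
        show "sqnorm (\<beta> + 2) (psubst P B) \<le> ennreal (K * C) * sqnorm \<beta> (fps_of_poly p)"
          by (rule ennreal_bound_trans[OF bK])
            (use K C sqnorm_antideriv[of \<beta> "fps_of_poly P"] P in \<open>auto simp: fps_deriv_of_poly C_def\<close>)
      qed (use K C in auto)
    qed (use K C M in auto)
  qed
  moreover have "M * (C * (K * C)) > 0" using K M C by simp
  ultimately show ?thesis unfolding comp_bounded_def by blast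
qed

text \<open>
  For \<open>\<alpha> = 0\<close> the operator is a multiple of an isometry divided by \<open>h\<close>, and \<open>1 / h\<close> is a multiple of
  the polynomial \<open>1 - a\<^sup>* z\<close>. Stepping down reaches the exponents \<open>-2, -4, \<dots>\<close>, because the inverse of
  \<open>\<phi>'\<close> is a polynomial too, and interpolation reaches those in between.
\<close>

lemma moebius_comp_bounded:
  fixes a :: complex
  assumes a: "norm a < 1" and \<alpha>: "\<alpha> \<le> 0"
  defines "\<phi> \<equiv> (fps_X - fps_const a) * inverse (1 - fps_const (cnj a) * fps_X)"
  shows "comp_bounded \<phi> \<alpha>"
proof -
  define D where "D = 1 - fps_const (cnj a) * fps_X"
  define r where "r = 1 - a * cnj a"
  have r: "r = of_real (1 - (norm a)\<^sup>2)" by (simp only: r_def complex_norm_square of_real_diff of_real_1 mult.commute)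
  have "(norm a)\<^sup>2 < 1" using a by (simp add: abs_square_less_1)
  then have r0: "r \<noteq> 0" unfolding r of_real_eq_0_iff by simp
  have \<phi>: "isometric \<phi>" unfolding \<phi>_def by (rule isometric_blaschke_factor[OF a])
  have \<phi>0: "\<phi> $ 0 = - a" by (simp add: \<phi>_def)
  have D: "smooth D" unfolding D_def by (intro smooth_diff smooth_mult) auto
  have \<phi>D: "\<phi> * D = fps_X - fps_const a"
    unfolding \<phi>_def D_def by (simp add: mult.assoc inverse_mult_eq_1)
  define h where "h = 1 - fps_const (cnj (- a)) * \<phi>"
  have "h * D = D + fps_const (cnj a) * (\<phi> * D)" by (simp add: h_def algebra_simps flip: fps_const_neg)
  then have hD: "h * D = fps_const r"
    unfolding \<phi>D by (simp add: D_def r_def algebra_simps flip: fps_const_sub fps_const_mult)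
  have "comp_bounded \<phi> 0"
  proof -
    define M where "M = fps_const (1 / r) * D"
    have Mh: "M * h = 1"
    proof -
      have "M * h = fps_const (1 / r) * (h * D)" by (simp add: M_def mult_ac)
      then show ?thesis using r0 unfolding hD by simp
    qed
    have "smooth M" unfolding M_def using D by (intro smooth_mult) auto
    then obtain K where K: "K > 0" "\<And>F. sqnorm 0 (M * F) \<le> ennreal K * sqnorm 0 F"
      using smooth_multiplier by blast
    have "sqnorm 0 (psubst p \<phi>) \<le> ennreal K * sqnorm 0 (fps_of_poly p)" for p
    proof -
      have sm: "smooth (h * psubst p \<phi>)" unfolding h_def
        using isometricD(1)[OF \<phi>] by (intro smooth_mult smooth_diff smooth_psubst) auto
      have "sqnorm 0 (psubst p \<phi>) = sqnorm 0 (M * (h * psubst p \<phi>))" by (simp add: Mh flip: mult.assoc)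
      also have "\<dots> \<le> ennreal K * sqnorm 0 (h * psubst p \<phi>)" by (rule K)
      also have "sqnorm 0 (h * psubst p \<phi>) \<le> sqnorm 0 (fps_of_poly p)"
      proof -
        have "pairing (h * psubst p \<phi>) (h * psubst p \<phi>) = of_real (1 - (norm a)\<^sup>2) * pairing (fps_of_poly p) (fps_of_poly p)"
          using orthonormal_system(2)[OF \<phi> refl, where p = p and q = p] unfolding \<phi>0 h_def by simp
        then have "Re (pairing (h * psubst p \<phi>) (h * psubst p \<phi>)) = (1 - (norm a)\<^sup>2) * Re (pairing (fps_of_poly p) (fps_of_poly p))"
          by (simp only: Re_complex_of_real times_complex.simps Im_complex_of_real)
        moreover have "Re (pairing (fps_of_poly p) (fps_of_poly p)) \<ge> 0"
          using smoothD[OF smooth_of_poly[of p], of 0] by (simp add: pairing_self suminf_nonneg wl2_iff)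
        ultimately have "Re (pairing (h * psubst p \<phi>) (h * psubst p \<phi>)) \<le> Re (pairing (fps_of_poly p) (fps_of_poly p))"
          using mult_right_mono[of "1 - (norm a)\<^sup>2" 1] by simp
        then show ?thesis
          using sqnorm_0_eq_pairing[OF smoothD[OF sm]] sqnorm_0_eq_pairing[OF smoothD[OF smooth_of_poly[of p]]] by (simp add: ennreal_leI)
      qed
      finally show ?thesis by (simp add: mult_left_mono)
    qed
    with K(1) show ?thesis by (auto simp: comp_bounded_def)
  qed
  define E where "E = fps_const (1 / r) * D ^ 2"
  have E: "smooth E" unfolding E_def using D by (intro smooth_mult smooth_power) auto
  have "fps_deriv (\<phi> * D) = 1" unfolding \<phi>D by simp
  then have "fps_deriv \<phi> * D = 1 + fps_const (cnj a) * \<phi>"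
    by (simp add: D_def algebra_simps)
  then have "fps_deriv \<phi> * D = h" by (simp add: h_def flip: fps_const_neg)
  then have "fps_deriv \<phi> * D ^ 2 = fps_const r" using hD by (simp add: power2_eq_square flip: mult.assoc)
  moreover have "E * fps_deriv \<phi> = fps_const (1 / r) * (fps_deriv \<phi> * D ^ 2)" by (simp add: E_def mult_ac)
  ultimately have E\<phi>: "E * fps_deriv \<phi> = 1" using r0 by simp
  have even: "comp_bounded \<phi> (- (2 * real m))" for m :: nat
  proof (induction m)
    case 0
    then show ?case using \<open>comp_bounded \<phi> 0\<close> by simp
  next
    case (Suc m)
    show ?case by (rule comp_bounded_step_down[OF E E\<phi>]) (use Suc in \<open>simp add: algebra_simps\<close>)
  qed
  show ?thesis
  proof (cases "\<alpha> = 0")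
    case True
    then show ?thesis using \<open>comp_bounded \<phi> 0\<close> by simp
  next
    case False
    obtain m :: nat where m: "- \<alpha> < real m" using reals_Archimedean2 by blast
    define q where "q = 2 * real m"
    obtain K0 K1 where K: "K0 > 0" "K1 > 0" "\<And>p. sqnorm 0 (psubst p \<phi>) \<le> ennreal K0 * sqnorm 0 (fps_of_poly p)"
      "\<And>p. sqnorm (- q) (psubst p \<phi>) \<le> ennreal K1 * sqnorm (- q) (fps_of_poly p)"
      using even[of m] \<open>comp_bounded \<phi> 0\<close> unfolding comp_bounded_def q_def by blast
    show ?thesis unfolding comp_bounded_def
    proof (rule interpolation[where q = q and K = "max K0 K1"])
      show "sqnorm 0 (psubst p \<phi>) \<le> ennreal (max K0 K1) * sqnorm 0 (fps_of_poly p)" for p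
        by (rule order_trans[OF K(3) mult_right_mono]) (auto intro: ennreal_leI)
      show "sqnorm (- q) (psubst p \<phi>) \<le> ennreal (max K0 K1) * sqnorm (- q) (fps_of_poly p)" for p
        by (rule order_trans[OF K(4) mult_right_mono]) (auto intro: ennreal_leI)
    qed (use m \<alpha> False K in \<open>auto simp: q_def psubst_add\<close>)
  qed
qed

text \<open>
  With \<open>b = B(0)\<close>, write \<open>B = \<phi> \<circ> B\<^sub>0\<close> where \<open>\<phi>(z) = (z + b) / (1 + b\<^sup>* z)\<close> and \<open>B\<^sub>0(0) = 0\<close>. Composition
  with \<open>B\<^sub>0\<close> is a contraction for exponents \<open>\<alpha> \<le> 0\<close> by subordination, which together with the
  Moebius case settles these exponents. The positive ones follow by stepping up.
\<close>

theorem isometric_comp_bounded: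
  assumes B: "isometric B" and b1: "norm (B $ 0) < 1"
  shows "comp_bounded B \<alpha>"
proof -
  define b where "b = B $ 0"
  define D where "D = 1 - fps_const (cnj b) * B"
  define B0 where "B0 = (B - fps_const b) * inverse D"
  define r where "r = 1 - b * cnj b"
  have r: "r = of_real (1 - (norm b)\<^sup>2)" by (simp only: r_def complex_norm_square of_real_diff of_real_1)
  have "(norm b)\<^sup>2 < 1" using b1 by (simp add: abs_square_less_1 b_def)
  then have r0: "r \<noteq> 0" unfolding r of_real_eq_0_iff by simp
  have D0: "D $ 0 = r" by (simp add: D_def r_def b_def mult.commute)
  have cB0: "contractive B0"
    unfolding B0_def D_def using b1 by (intro contractive_moebius isometric_contractive[OF B]) (simp add: b_def)
  have B00: "B0 $ 0 = 0" by (simp add: B0_def b_def)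
  have B0D: "B0 * D = B - fps_const b"
    unfolding B0_def by (simp add: mult.assoc inverse_mult_eq_1 D0 r0)
  define D1 where "D1 = 1 + fps_const (cnj b) * B0"
  \<comment> \<open>Numerator and denominator of \<open>\<phi> \<circ> B\<^sub>0\<close> become multiples of \<open>B\<close> and \<open>1\<close> after multiplication with \<open>D\<close>.\<close>
  have "(B0 + fps_const b) * D = B0 * D + fps_const b * D" by (simp add: algebra_simps)
  also have "\<dots> = fps_const r * B"
    unfolding B0D by (simp add: D_def r_def algebra_simps flip: fps_const_sub fps_const_mult)
  finally have 1: "(B0 + fps_const b) * D = fps_const r * B" .
  have "D1 * D = D + fps_const (cnj b) * (B0 * D)" by (simp add: D1_def algebra_simps)
  also have "\<dots> = fps_const r"
    unfolding B0D by (simp add: D_def r_def algebra_simps flip: fps_const_sub fps_const_mult)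
  finally have 2: "D1 * D = fps_const r" .
  have "(B0 + fps_const b) * D = (B * D1) * D" using 1 2 by (simp add: mult_ac)
  moreover have "D \<noteq> 0" using D0 r0 by auto
  ultimately have B0b: "B0 + fps_const b = B * D1" by simp
  define \<phi> where "\<phi> = (fps_X - fps_const (- b)) * inverse (1 - fps_const (cnj (- b)) * fps_X)"
  have D1_0: "D1 $ 0 = 1" by (simp add: D1_def B00)
  have "\<phi> oo B0 = (B0 + fps_const b) * inverse D1"
    by (simp add: \<phi>_def D1_def fps_compose_mult_distrib[OF B00] fps_inverse_compose[OF B00]
        fps_compose_add_distrib fps_compose_sub_distrib B00 flip: fps_const_neg)
  also have "\<dots> = B" unfolding B0b using D1_0 by (simp add: mult.assoc inverse_mult_eq_1')
  finally have \<phi>B0: "\<phi> oo B0 = B" .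
  have nonpos: "comp_bounded B \<beta>" if \<beta>: "\<beta> \<le> 0" for \<beta>
  proof -
    have "comp_bounded \<phi> \<beta>" unfolding \<phi>_def using b1 \<beta> by (intro moebius_comp_bounded) (auto simp: b_def)
    then obtain K where K: "K > 0" "\<And>p. sqnorm \<beta> (psubst p \<phi>) \<le> ennreal K * sqnorm \<beta> (fps_of_poly p)"
      by (auto simp: comp_bounded_def)
    have "sqnorm \<beta> (psubst p B) \<le> ennreal K * sqnorm \<beta> (fps_of_poly p)" for p
    proof -
      have "psubst p B = psubst p \<phi> oo B0" by (simp add: \<phi>B0 flip: psubst_compose[OF B00])
      then have "sqnorm \<beta> (psubst p B) \<le> sqnorm \<beta> (psubst p \<phi>)" using sqnorm_compose_contractive[OF cB0 B00 \<beta>] by simp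
      also note K(2)
      finally show ?thesis .
    qed
    with K(1) show ?thesis by (auto simp: comp_bounded_def)
  qed
  obtain n :: nat where n: "\<alpha> \<le> real n" using real_arch_simple by blast
  have "comp_bounded B (\<alpha> - 2 * real n + 2 * real m)" for m :: nat
  proof (induction m)
    case 0
    show ?case by (rule nonpos) (use n in simp)
  next
    case (Suc m)
    from comp_bounded_step_up[OF isometricD(1)[OF B] Suc] show ?case by (simp add: algebra_simps)
  qed
  from this[of n] show ?thesis by simp
qed

section \<open>Bounded operators on weighted spaces\<close>

definition bounded_op :: "real \<Rightarrow> (complex fps \<Rightarrow> complex fps) \<Rightarrow> bool" where
  "bounded_op \<alpha> S \<longleftrightarrow>
     (\<forall>F\<in>wl2 \<alpha>. \<forall>G\<in>wl2 \<alpha>. S (F + G) = S F + S G) \<and>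
     (\<forall>c. \<forall>F\<in>wl2 \<alpha>. S (fps_const c * F) = fps_const c * S F) \<and>
     (\<exists>K>0. \<forall>F\<in>wl2 \<alpha>. sqnorm \<alpha> (S F) \<le> ennreal K * sqnorm \<alpha> F)"

lemma bounded_opD:
  assumes "bounded_op \<alpha> S"
  shows "F \<in> wl2 \<alpha> \<Longrightarrow> G \<in> wl2 \<alpha> \<Longrightarrow> S (F + G) = S F + S G"
    and "F \<in> wl2 \<alpha> \<Longrightarrow> S (fps_const c * F) = fps_const c * S F"
    and "\<exists>K>0. \<forall>F\<in>wl2 \<alpha>. sqnorm \<alpha> (S F) \<le> ennreal K * sqnorm \<alpha> F"
    and "F \<in> wl2 \<alpha> \<Longrightarrow> S F \<in> wl2 \<alpha>"
  using assms wl2_bounded unfolding bounded_op_def by blast+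

lemma bounded_op_comp:
  assumes S: "bounded_op \<alpha> S" and T: "bounded_op \<alpha> T"
  shows "bounded_op \<alpha> (\<lambda>F. S (T F))"
proof -
  obtain K where K: "K > 0" "\<And>F. F \<in> wl2 \<alpha> \<Longrightarrow> sqnorm \<alpha> (S F) \<le> ennreal K * sqnorm \<alpha> F"
    using bounded_opD(3)[OF S] by blast
  obtain L where L: "L > 0" "\<And>F. F \<in> wl2 \<alpha> \<Longrightarrow> sqnorm \<alpha> (T F) \<le> ennreal L * sqnorm \<alpha> F"
    using bounded_opD(3)[OF T] by blast
  have "sqnorm \<alpha> (S (T F)) \<le> ennreal (K * L) * sqnorm \<alpha> F" if "F \<in> wl2 \<alpha>" for F
    by (rule ennreal_bound_trans[OF K(2)[OF bounded_opD(4)[OF T that]] L(2)[OF that]])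
      (use K L in auto)
  moreover have "K * L > 0" using K L by simp
  ultimately show ?thesis unfolding bounded_op_def
    using bounded_opD[OF S] bounded_opD[OF T] by auto
qed

lemma bounded_op_smooth: "smooth B \<Longrightarrow> bounded_op \<alpha> (\<lambda>F. B * F)"
  using smooth_multiplier[of B \<alpha>] by (auto simp: bounded_op_def algebra_simps)

lemma bounded_op_id: "bounded_op \<alpha> (\<lambda>F. F)"
  using bounded_op_smooth[of 1 \<alpha>] by simp

lemma wl2_cutoff [simp]: "fps_cutoff n F \<in> wl2 \<alpha>"
  by (rule wl2_finite_support[of n]) simp

lemma wl2_X_power [simp]: "fps_X ^ k \<in> wl2 \<alpha>"
  by (intro smoothD smooth_power) simp

lemma sqnorm_tail:
  assumes F: "F \<in> wl2 \<alpha>"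
  obtains \<rho> where "\<rho> \<longlonglongrightarrow> 0" "\<And>n. sqnorm \<alpha> (F - fps_cutoff n F) = ennreal (\<rho> n)"
proof -
  define f where "f k = wt \<alpha> k * (norm (F $ k))\<^sup>2" for k
  have sf: "summable f" using F by (simp add: wl2_iff f_def[abs_def])
  define \<rho> where "\<rho> n = suminf f - (\<Sum>k<n. f k)" for n
  have "\<rho> \<longlonglongrightarrow> suminf f - suminf f"
    unfolding \<rho>_def by (intro tendsto_diff tendsto_const summable_LIMSEQ sf)
  then have 1: "\<rho> \<longlonglongrightarrow> 0" by simp
  have 2: "sqnorm \<alpha> (F - fps_cutoff n F) = ennreal (\<rho> n)" for n
  proof -
    have "sqnorm \<alpha> (F - fps_cutoff n F) = (\<Sum>k. ennreal (wt \<alpha> (k + n) * (norm ((F - fps_cutoff n F) $ (k + n)))\<^sup>2))"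
      unfolding weighted_sqnorm_def by (subst suminf_offset[of _ n]) (auto intro: summableI)
    also have "\<dots> = (\<Sum>k. ennreal (f (k + n)))" by (simp add: f_def)
    also have "\<dots> = ennreal (\<Sum>k. f (k + n))"
      by (rule suminf_ennreal2) (auto simp: f_def intro: summable_ignore_initial_segment sf[unfolded f_def[abs_def]])
    also have "(\<Sum>k. f (k + n)) = \<rho> n"
      unfolding \<rho>_def by (rule suminf_minus_initial_segment[OF sf])
    finally show ?thesis .
  qed
  from that[OF 1 2] show thesis .
qed

lemma sqnorm_eq_0: "sqnorm \<alpha> F = 0 \<Longrightarrow> F = 0"
proof (rule fps_ext)
  fix k assume "sqnorm \<alpha> F = 0"
  then have "ennreal (wt \<alpha> k * (norm (F $ k))\<^sup>2) \<le> 0" using sqnorm_coeff[of \<alpha> k F] by simp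
  then have "wt \<alpha> k * (norm (F $ k))\<^sup>2 \<le> 0" by (simp add: ennreal_eq_0_iff)
  then show "F $ k = 0 $ k" using wt_pos[of \<alpha> k] by (simp add: mult_le_0_iff not_le[symmetric])
qed

lemma fps_cutoff_Suc': "fps_cutoff (Suc n) F = fps_cutoff n F + fps_const (F $ n) * fps_X ^ n"
  by (rule fps_ext) (auto simp: fps_X_power_nth less_Suc_eq)

text \<open>
  The monomials span a dense subspace.
\<close>

lemma bounded_op_eqI:
  assumes S: "bounded_op \<alpha> S" and T: "bounded_op \<alpha> T"
    and eq: "\<And>k. S (fps_X ^ k) = T (fps_X ^ k)" and F: "F \<in> wl2 \<alpha>"
  shows "S F = T F"
proof -
  obtain K where K: "K > 0" "\<And>F. F \<in> wl2 \<alpha> \<Longrightarrow> sqnorm \<alpha> (S F) \<le> ennreal K * sqnorm \<alpha> F"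
    using bounded_opD(3)[OF S] by blast
  obtain L where L: "L > 0" "\<And>F. F \<in> wl2 \<alpha> \<Longrightarrow> sqnorm \<alpha> (T F) \<le> ennreal L * sqnorm \<alpha> F"
    using bounded_opD(3)[OF T] by blast
  obtain \<rho> where \<rho>: "\<rho> \<longlonglongrightarrow> 0" "\<And>n. sqnorm \<alpha> (F - fps_cutoff n F) = ennreal (\<rho> n)"
    using sqnorm_tail[OF F] by blast
  have cut: "S (fps_cutoff n F) = T (fps_cutoff n F)" for n
  proof (induction n)
    case 0
    have "S (fps_const 0 * 0) = fps_const 0 * S 0" "T (fps_const 0 * 0) = fps_const 0 * T 0"
      using bounded_opD(2)[OF S, of 0 0] bounded_opD(2)[OF T, of 0 0] wl2_cutoff[of 0 F \<alpha>] by simp_all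
    then show ?case by simp
  next
    case (Suc n)
    then show ?case
      by (simp add: fps_cutoff_Suc' bounded_opD[OF S] bounded_opD[OF T] wl2_cmult eq)
  qed
  have "sqnorm \<alpha> (S F - T F) \<le> ennreal ((2 * K + 2 * L) * \<rho> n)" for n
  proof -
    define R where "R = F - fps_cutoff n F"
    have R: "R \<in> wl2 \<alpha>" unfolding R_def using F by (intro wl2_diff) auto
    have FR: "F = fps_cutoff n F + R" by (simp add: R_def)
    have "S F = S (fps_cutoff n F) + S R" "T F = T (fps_cutoff n F) + T R"
      by (subst FR, rule bounded_opD(1)[OF S], use R in auto) (subst FR, rule bounded_opD(1)[OF T], use R in auto)
    then have "S F - T F = S R + - T R" by (simp add: cut)
    then have "sqnorm \<alpha> (S F - T F) \<le> 2 * sqnorm \<alpha> (S R) + 2 * sqnorm \<alpha> (T R)"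
      using weighted_sqnorm_add[of "wt \<alpha>" "S R" "- T R"] by simp
    also have "\<dots> \<le> 2 * (ennreal K * sqnorm \<alpha> R) + 2 * (ennreal L * sqnorm \<alpha> R)"
      by (intro add_mono mult_left_mono K L R) auto
    also have "\<dots> = (2 * ennreal K + 2 * ennreal L) * ennreal (\<rho> n)"
      unfolding R_def \<rho>(2) by (simp add: distrib_right mult.assoc)
    also have "2 * ennreal K + 2 * ennreal L = ennreal (2 * K + 2 * L)"
      using K(1) L(1) by (simp add: ennreal_mult)
    also have "\<dots> * ennreal (\<rho> n) = ennreal ((2 * K + 2 * L) * \<rho> n)"
      using K(1) L(1) by (intro ennreal_mult'[symmetric]) simp
    finally show ?thesis .
  qed
  moreover have "(\<lambda>n. ennreal ((2 * K + 2 * L) * \<rho> n)) \<longlonglongrightarrow> ennreal ((2 * K + 2 * L) * 0)"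
    by (intro tendsto_ennrealI tendsto_mult tendsto_const \<rho>)
  ultimately have "sqnorm \<alpha> (S F - T F) \<le> ennreal ((2 * K + 2 * L) * 0)"
    by (intro LIMSEQ_le_const) auto
  then have "sqnorm \<alpha> (S F - T F) = 0" by simp
  then have "S F - T F = 0" by (rule sqnorm_eq_0)
  then show ?thesis by simp
qed

section \<open>Extension by continuity and adjoints\<close>

lemma coeff_Poly_upt: "coeff (Poly (map y [0..<n])) k = (if k < n then y k else 0)"
  by (simp add: nth_default_def)

lemma weighted_sqnorm_finite_support:
  assumes "\<And>k. w k \<ge> 0" "\<And>k. k \<ge> n \<Longrightarrow> F $ k = 0"
  shows "weighted_sqnorm w F = ennreal (\<Sum>k<n. w k * (norm (F $ k))\<^sup>2)"
proof -
  have "weighted_sqnorm w F = (\<Sum>k<n. ennreal (w k * (norm (F $ k))\<^sup>2))"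
    unfolding weighted_sqnorm_def by (rule suminf_finite) (use assms in auto)
  then show ?thesis using assms by (simp add: sum_ennreal)
qed

text \<open>
  Used to absorb half of a quantity into the left-hand side of its own estimate.
\<close>

lemma half_bound: "b \<le> c \<Longrightarrow> c \<le> (a + b) / 2 \<Longrightarrow> c \<le> (a::real)"
  by (simp add: field_simps)

text \<open>
  An operator that is defined on polynomials and bounded for every exponent extends to all weighted
  spaces, and so does its \<open>H\<^sup>2\<close>-adjoint: the adjoint is bounded for \<open>\<alpha>\<close> because the operator itself is
  bounded for \<open>- \<alpha>\<close>. Both are given by the matrix whose \<open>k\<close>-th column is the image of \<open>z\<^sup>k\<close>, one
  paired with the rows and the other with the columns of it.
\<close>

locale poly_operator =
  fixes T :: "complex poly \<Rightarrow> complex fps"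
  assumes T_add: "T (p + q) = T p + T q"
    and T_smult: "T (smult c p) = fps_const c * T p"
    and T_bounded: "\<exists>K>0. \<forall>p. sqnorm \<alpha> (T p) \<le> ennreal K * sqnorm \<alpha> (fps_of_poly p)"
begin

definition col :: "nat \<Rightarrow> complex fps" where
  "col k = T (monom 1 k)"

text \<open>
  Rows are conjugated so that the matrix--vector product becomes a pairing.
\<close>

definition row :: "nat \<Rightarrow> complex fps" where
  "row i = Abs_fps (\<lambda>k. cnj (col k $ i))"

definition ext_op :: "complex fps \<Rightarrow> complex fps" where
  "ext_op F = Abs_fps (\<lambda>i. pairing F (row i))"

definition adj_op :: "complex fps \<Rightarrow> complex fps" where
  "adj_op F = Abs_fps (\<lambda>j. pairing F (col j))"

lemma T_0: "T 0 = 0"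
  using T_smult[of 0 0] by simp

lemma T_sum: "T (sum f A) = (\<Sum>i\<in>A. T (f i))"
  by (induction A rule: infinite_finite_induct) (simp_all add: T_0 T_add)

lemma T_eq_sum:
  assumes "degree p < n"
  shows "T p = (\<Sum>k<n. fps_const (coeff p k) * col k)"
proof -
  have "p = (\<Sum>k<n. smult (coeff p k) (monom 1 k))"
  proof (rule poly_eqI)
    fix k
    have "coeff (\<Sum>k<n. smult (coeff p k) (monom 1 k)) k = (\<Sum>i<n. if i = k then coeff p i else 0)"
      by (simp add: coeff_sum if_distrib cong: if_cong)
    also have "\<dots> = coeff p k" using assms by (simp add: coeff_eq_0)
    finally show "coeff p k = coeff (\<Sum>k<n. smult (coeff p k) (monom 1 k)) k" by simp
  qed
  then have "T p = T (\<Sum>k<n. smult (coeff p k) (monom 1 k))" by (rule arg_cong)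
  also have "\<dots> = (\<Sum>k<n. fps_const (coeff p k) * col k)" by (simp add: T_sum T_smult col_def)
  finally show ?thesis .
qed

lemma T_Poly: "T (Poly (map y [0..<n])) = (\<Sum>k<n. fps_const (y k) * col k)"
proof -
  define m where "m = max n (Suc (degree (Poly (map y [0..<n]))))"
  have "T (Poly (map y [0..<n])) = (\<Sum>k<m. fps_const (if k < n then y k else 0) * col k)"
    by (subst T_eq_sum[of _ m]) (simp_all add: m_def coeff_Poly_upt del: coeff_Poly_eq)
  also have "\<dots> = (\<Sum>k<n. fps_const (y k) * col k)"
    by (rule sum.mono_neutral_cong_right) (auto simp: m_def)
  finally show ?thesis .
qed

lemma T_nth: "T p $ i = (\<Sum>k<Suc (degree p). coeff p k * col k $ i)"
  by (subst T_eq_sum[of p "Suc (degree p)"]) (simp_all add: fps_sum_nth del: sum.lessThan_Suc)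

lemma smooth_col: "smooth (col k)"
  unfolding smooth_def col_def
proof
  fix \<alpha>
  obtain K where "\<And>p. sqnorm \<alpha> (T p) \<le> ennreal K * sqnorm \<alpha> (fps_of_poly p)" using T_bounded by blast
  then show "T (monom 1 k) \<in> wl2 \<alpha>" using wl2_bounded smoothD[OF smooth_of_poly] by blast
qed

text \<open>
  Apply the operator to the polynomial \<open>y\<close> whose coefficients are those of the row, multiplied by the
  weights. The \<open>i\<close>-th coefficient of the image is then the partial sum \<open>S\<close> of the squared norm of the
  row, while the norm of \<open>y\<close> for the opposite exponent is \<open>S\<close> as well. Hence \<open>S\<^sup>2 \<le> C S\<close>, which bounds
  \<open>S\<close> independently of the truncation.
\<close>

lemma smooth_row: "smooth (row i)"
  unfolding smooth_def
proof
  fix \<beta>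
  obtain K where K: "K > 0" "\<And>p. sqnorm (- \<beta>) (T p) \<le> ennreal K * sqnorm (- \<beta>) (fps_of_poly p)"
    using T_bounded by blast
  have "sqnorm \<beta> (row i) \<le> ennreal (K * wt \<beta> i)"
  proof (rule weighted_sqnorm_leI)
    fix n
    define y where "y k = of_real (wt \<beta> k) * cnj (col k $ i)" for k
    define p where "p = Poly (map y [0..<n])"
    define S where "S = (\<Sum>k<n. wt \<beta> k * (norm (row i $ k))\<^sup>2)"
    have S0: "S \<ge> 0" unfolding S_def by (intro sum_nonneg) auto
    have "T p $ i = (\<Sum>k<n. y k * col k $ i)" unfolding p_def T_Poly by (simp add: fps_sum_nth)
    also have "\<dots> = of_real S"
      unfolding S_def of_real_sum
      by (intro sum.cong refl) (simp add: y_def row_def complex_norm_square mult_ac del: of_real_power)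
    finally have Tp: "T p $ i = of_real S" .
    have "sqnorm (- \<beta>) (fps_of_poly p) = ennreal (\<Sum>k<n. wt (- \<beta>) k * (norm (fps_of_poly p $ k))\<^sup>2)"
      by (rule weighted_sqnorm_finite_support) (auto simp: p_def coeff_Poly_upt simp del: coeff_Poly_eq)
    also have "(\<Sum>k<n. wt (- \<beta>) k * (norm (fps_of_poly p $ k))\<^sup>2) = S"
      unfolding S_def
    proof (intro sum.cong refl)
      fix k assume "k \<in> {..<n}"
      then have "wt (- \<beta>) k * (norm (fps_of_poly p $ k))\<^sup>2 = (wt \<beta> k * wt (- \<beta>) k) * (wt \<beta> k * (norm (col k $ i))\<^sup>2)"
        by (simp add: p_def coeff_Poly_upt y_def norm_mult power2_eq_square del: coeff_Poly_eq wt_mult_uminus)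
      then show "wt (- \<beta>) k * (norm (fps_of_poly p $ k))\<^sup>2 = wt \<beta> k * (norm (row i $ k))\<^sup>2"
        unfolding wt_mult_uminus by (simp add: row_def)
    qed
    finally have "sqnorm (- \<beta>) (T p) \<le> ennreal (K * S)" using K(2)[of p] K(1) S0 by (simp add: ennreal_mult)
    then have "ennreal (wt (- \<beta>) i * S\<^sup>2) \<le> ennreal (K * S)"
      using sqnorm_coeff[of "- \<beta>" i "T p"] Tp S0 by (simp add: order_trans)
    then have "wt (- \<beta>) i * S\<^sup>2 \<le> K * S" using K(1) S0 by simp
    then have "wt \<beta> i * (wt (- \<beta>) i * S\<^sup>2) \<le> wt \<beta> i * (K * S)" by (rule mult_left_mono) simp
    then have "(wt \<beta> i * wt (- \<beta>) i) * S * S \<le> (K * wt \<beta> i) * S"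
      by (simp add: power2_eq_square mult_ac del: wt_mult_uminus)
    then have "S * S \<le> (K * wt \<beta> i) * S" unfolding wt_mult_uminus by simp
    then have "S \<le> K * wt \<beta> i" using S0 K(1) by (cases "S = 0") auto
    then show "ennreal (\<Sum>k<n. wt \<beta> k * (norm (row i $ k))\<^sup>2) \<le> ennreal (K * wt \<beta> i)"
      unfolding S_def by (rule ennreal_leI)
  qed simp
  then show "row i \<in> wl2 \<beta>" by (simp add: wl2_def le_less_trans)
qed

lemma ext_op_poly: "ext_op (fps_of_poly p) = T p"
proof (rule fps_ext)
  fix i
  have "pairing (fps_of_poly p) (row i) = (\<Sum>k<Suc (degree p). coeff p k * col k $ i)"
    unfolding pairing_def
    by (subst suminf_finite[of "{..<Suc (degree p)}"]) (auto simp: coeff_eq_0 row_def)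
  then show "ext_op (fps_of_poly p) $ i = T p $ i" by (simp add: ext_op_def T_nth)
qed

lemma ext_op_X_power: "ext_op (fps_X ^ k) = col k"
  using ext_op_poly[of "monom 1 k"] by (simp add: col_def fps_of_poly_monom')

text \<open>
  Truncations of \<open>F\<close> are polynomials, whose images converge coefficientwise to the image of \<open>F\<close>;
  the bound passes to the limit on every finite set of coefficients.
\<close>

lemma bounded_op_ext_op: "bounded_op \<alpha> ext_op"
proof -
  obtain K where K: "K > 0" "\<And>p. sqnorm \<alpha> (T p) \<le> ennreal K * sqnorm \<alpha> (fps_of_poly p)" using T_bounded by blast
  have row: "row i \<in> wl2 (- \<alpha>)" for i by (rule smoothD[OF smooth_row])
  have "sqnorm \<alpha> (ext_op F) \<le> ennreal K * sqnorm \<alpha> F" if F: "F \<in> wl2 \<alpha>" for F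
  proof -
    define x where "x = (\<Sum>k. wt \<alpha> k * (norm (F $ k))\<^sup>2)"
    have x: "sqnorm \<alpha> F = ennreal x" using F by (simp add: x_def sqnorm_eq_suminf wl2_def)
    have x0: "x \<ge> 0" unfolding x_def using F by (intro suminf_nonneg) (auto simp: wl2_iff)
    have "sqnorm \<alpha> (ext_op F) \<le> ennreal (K * x)"
    proof (rule weighted_sqnorm_leI)
      fix n
      define q where "q m = Poly (map (\<lambda>k. F $ k) [0..<m])" for m
      have qn: "T (q m) $ i = (\<Sum>k<m. F $ k * cnj (row i $ k))" for m i
        unfolding q_def T_Poly by (simp add: fps_sum_nth row_def)
      have "(\<lambda>m. T (q m) $ i) \<longlonglongrightarrow> ext_op F $ i" for i
        unfolding qn ext_op_def pairing_def using summable_LIMSEQ[OF pairing_summable'[OF F row]] by simp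
      then have "(\<lambda>m. \<Sum>i<n. wt \<alpha> i * (norm (T (q m) $ i))\<^sup>2) \<longlonglongrightarrow> (\<Sum>i<n. wt \<alpha> i * (norm (ext_op F $ i))\<^sup>2)"
        by (intro tendsto_intros)
      moreover have "(\<Sum>i<n. wt \<alpha> i * (norm (T (q m) $ i))\<^sup>2) \<le> K * x" for m
      proof -
        have "ennreal (\<Sum>i<n. wt \<alpha> i * (norm (T (q m) $ i))\<^sup>2) \<le> sqnorm \<alpha> (T (q m))"
          by (rule weighted_sqnorm_partial) auto
        also have "\<dots> \<le> ennreal K * sqnorm \<alpha> (fps_of_poly (q m))" by (rule K)
        also have "\<dots> \<le> ennreal K * sqnorm \<alpha> F"
          by (intro mult_left_mono weighted_sqnorm_mono) (auto simp: q_def coeff_Poly_upt simp del: coeff_Poly_eq)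
        finally show ?thesis using K(1) x0 by (simp add: x flip: ennreal_mult)
      qed
      ultimately have "(\<Sum>i<n. wt \<alpha> i * (norm (ext_op F $ i))\<^sup>2) \<le> K * x"
        by (intro LIMSEQ_le_const2) auto
      then show "ennreal (\<Sum>i<n. wt \<alpha> i * (norm (ext_op F $ i))\<^sup>2) \<le> ennreal (K * x)" by (rule ennreal_leI)
    qed simp
    then show ?thesis using K(1) x0 by (simp add: x ennreal_mult)
  qed
  then show ?thesis unfolding bounded_op_def using K(1) row
    by (auto intro!: fps_ext exI[of _ K] simp: ext_op_def pairing_add_left pairing_cmult_left)
qed

text \<open>
  Test \<open>F\<close> against the image of the polynomial \<open>y\<close> with coefficients \<open>(k + 1)\<^sup>\<alpha> (adj F)\<^sub>k\<close>. The pairing and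
  the norm of \<open>y\<close> for the exponent \<open>- \<alpha>\<close> both equal the partial sum \<open>S\<close> to be estimated, so duality
  with \<open>t = K\<close> gives \<open>S \<le> (K \<parallel>F\<parallel>\<^sup>2 + S) / 2\<close>.
\<close>

lemma bounded_op_adj_op: "bounded_op \<alpha> adj_op"
proof -
  obtain K where K: "K > 0" "\<And>p. sqnorm (- \<alpha>) (T p) \<le> ennreal K * sqnorm (- \<alpha>) (fps_of_poly p)" using T_bounded by blast
  have col: "col i \<in> wl2 (- \<alpha>)" for i by (rule smoothD[OF smooth_col])
  have "sqnorm \<alpha> (adj_op F) \<le> ennreal K * sqnorm \<alpha> F" if F: "F \<in> wl2 \<alpha>" for F
  proof -
    define x where "x = (\<Sum>k. wt \<alpha> k * (norm (F $ k))\<^sup>2)"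
    have x: "sqnorm \<alpha> F = ennreal x" using F by (simp add: x_def sqnorm_eq_suminf wl2_def)
    have x0: "x \<ge> 0" unfolding x_def using F by (intro suminf_nonneg) (auto simp: wl2_iff)
    have "sqnorm \<alpha> (adj_op F) \<le> ennreal (K * x)"
    proof (rule weighted_sqnorm_leI)
      fix n
      define y where "y j = of_real (wt \<alpha> j) * adj_op F $ j" for j
      define p where "p = Poly (map y [0..<n])"
      define S where "S = (\<Sum>j<n. wt \<alpha> j * (norm (adj_op F $ j))\<^sup>2)"
      have S0: "S \<ge> 0" unfolding S_def by (intro sum_nonneg) auto
      have sumW: "(\<Sum>j<m. fps_const (y j) * col j) \<in> wl2 (- \<alpha>)" for m
        by (induction m) (auto intro: wl2_add wl2_cmult col smoothD)
      have "pairing F (\<Sum>j<m. fps_const (y j) * col j) = (\<Sum>j<m. cnj (y j) * adj_op F $ j)" for m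
      proof (induction m)
        case 0
        then show ?case by (simp add: pairing_def)
      next
        case (Suc m)
        then show ?case by (simp add: pairing_add_right[OF F sumW wl2_cmult[OF col]] pairing_cmult_right[OF F col] adj_op_def)
      qed
      from this[of n] have "pairing F (T p) = (\<Sum>j<n. cnj (y j) * adj_op F $ j)" by (simp add: p_def T_Poly)
      also have "\<dots> = of_real S"
        unfolding S_def of_real_sum by (intro sum.cong refl) (simp add: y_def complex_norm_square mult_ac del: of_real_power)
      finally have prS: "pairing F (T p) = of_real S" .
      have "sqnorm (- \<alpha>) (fps_of_poly p) = ennreal (\<Sum>k<n. wt (- \<alpha>) k * (norm (fps_of_poly p $ k))\<^sup>2)"
        by (rule weighted_sqnorm_finite_support) (auto simp: p_def coeff_Poly_upt simp del: coeff_Poly_eq)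
      also have "(\<Sum>k<n. wt (- \<alpha>) k * (norm (fps_of_poly p $ k))\<^sup>2) = S"
        unfolding S_def
      proof (intro sum.cong refl)
        fix k assume "k \<in> {..<n}"
        then have "wt (- \<alpha>) k * (norm (fps_of_poly p $ k))\<^sup>2 = (wt \<alpha> k * wt (- \<alpha>) k) * (wt \<alpha> k * (norm (adj_op F $ k))\<^sup>2)"
          by (simp add: p_def coeff_Poly_upt y_def norm_mult power2_eq_square del: coeff_Poly_eq wt_mult_uminus)
        then show "wt (- \<alpha>) k * (norm (fps_of_poly p $ k))\<^sup>2 = wt \<alpha> k * (norm (adj_op F $ k))\<^sup>2"
          unfolding wt_mult_uminus by simp
      qed
      finally have NTp: "sqnorm (- \<alpha>) (T p) \<le> ennreal (K * S)" using K(2)[of p] K(1) S0 by (simp add: ennreal_mult)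
      have Tp: "T p \<in> wl2 (- \<alpha>)" using wl2_bounded[OF K(2) smoothD[OF smooth_of_poly]] .
      define \<tau> where "\<tau> = (\<Sum>k. wt (- \<alpha>) k * (norm (T p $ k))\<^sup>2)"
      have "\<tau> \<le> K * S"
        using Tp NTp K(1) S0 by (simp add: sqnorm_eq_suminf wl2_def \<tau>_def)
      then have "\<tau> / K \<le> S" using K(1) by (simp add: field_simps)
      moreover have "S \<le> (K * x + \<tau> / K) / 2"
        using pairing_bound[OF F Tp K(1)] S0 by (simp add: prS x_def \<tau>_def)
      ultimately have "S \<le> K * x" by (rule half_bound)
      then show "ennreal (\<Sum>j<n. wt \<alpha> j * (norm (adj_op F $ j))\<^sup>2) \<le> ennreal (K * x)"
        unfolding S_def by (rule ennreal_leI)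
    qed simp
    then show ?thesis using K(1) x0 by (simp add: x ennreal_mult)
  qed
  then show ?thesis unfolding bounded_op_def using K(1) col
    by (auto intro!: fps_ext exI[of _ K] simp: adj_op_def pairing_add_left pairing_cmult_left)
qed

end

text \<open>
  With \<open>b = B(0)\<close> and \<open>h = 1 - b\<^sup>* B\<close>, the map
  \<open>U f = h (f \<circ> B) / \<surd>(1 - \<bar>b\<bar>\<^sup>2)\<close> sends the monomials to an orthonormal system of \<open>H\<^sup>2\<close>, and \<open>V\<close> is its
  \<open>H\<^sup>2\<close>-adjoint. The three identities hold on monomials by orthonormality, by isometry of
  multiplication with \<open>B\<close>, and by \<open>h\<close> being orthogonal to \<open>B H\<^sup>2\<close>. They extend to each weighted space
  by density, and one pair \<open>U\<close>, \<open>V\<close> serves for all exponents.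
\<close>

theorem intertwining_pair:
  assumes B: "isometric B" and b1: "norm (B $ 0) < 1"
  obtains U V where "\<And>\<alpha>. bounded_op \<alpha> U" "\<And>\<alpha>. bounded_op \<alpha> V"
    "\<And>\<alpha> F. F \<in> wl2 \<alpha> \<Longrightarrow> V (U F) = F"
    "\<And>\<alpha> F. F \<in> wl2 \<alpha> \<Longrightarrow> U (fps_X * F) = B * U F"
    "\<And>\<alpha> F. F \<in> wl2 \<alpha> \<Longrightarrow> V (B * F) = fps_X * V F"
proof -
  define b where "b = B $ 0"
  define h where "h = 1 - fps_const (cnj b) * B"
  define s where "s = 1 - (norm b)\<^sup>2"
  have s: "s > 0" using b1 by (simp add: s_def b_def abs_square_less_1)
  define g where "g = fps_const (of_real (1 / sqrt s)) * h"
  define T where "T p = g * psubst p B" for p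
  note sB = isometricD(1)[OF B]
  have h: "smooth h" unfolding h_def using sB by (intro smooth_diff smooth_mult) auto
  have g: "smooth g" unfolding g_def using h by (intro smooth_mult) auto
  interpret poly_operator T
  proof
    show "T (p + q) = T p + T q" for p q by (simp add: T_def psubst_add distrib_left)
    show "T (smult c p) = fps_const c * T p" for c p by (simp add: T_def psubst_smult mult_ac)
    fix \<alpha>
    obtain K where K: "K > 0" "\<And>p. sqnorm \<alpha> (psubst p B) \<le> ennreal K * sqnorm \<alpha> (fps_of_poly p)"
      using isometric_comp_bounded[OF B b1, of \<alpha>] by (auto simp: comp_bounded_def)
    obtain M where M: "M > 0" "\<And>F. sqnorm \<alpha> (g * F) \<le> ennreal M * sqnorm \<alpha> F"
      using smooth_multiplier[OF g, of \<alpha>] by blast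
    have "sqnorm \<alpha> (T p) \<le> ennreal (M * K) * sqnorm \<alpha> (fps_of_poly p)" for p
      unfolding T_def by (rule ennreal_bound_trans[OF M(2) K(2)]) (use K M in auto)
    moreover have "M * K > 0" using K M by simp
    ultimately show "\<exists>K>0. \<forall>p. sqnorm \<alpha> (T p) \<le> ennreal K * sqnorm \<alpha> (fps_of_poly p)" by blast
  qed
  have col_Suc: "col (Suc k) = B * col k" for k
    by (simp add: col_def T_def monom_Suc)
  have col_0: "col 0 = g" by (simp add: col_def T_def monom_0)
  have colW [simp]: "col k \<in> wl2 \<alpha>" for k \<alpha> by (rule smoothD[OF smooth_col])
  have hW [simp]: "h \<in> wl2 \<alpha>" for \<alpha> by (rule smoothD[OF h])
  have orth: "pairing (B * G) g = 0" if "G \<in> wl2 0" for G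
    unfolding g_def using orthonormal_system(1)[OF B b_def that] wl2_0_mult[OF sB that]
    by (simp add: pairing_cmult_right[of _ 0] flip: h_def)
  have ONB: "pairing (col k) (col j) = (if j = k then 1 else 0)" for k j
  proof -
    have c: "col k = fps_const (of_real (1 / sqrt s)) * (h * psubst (monom 1 k) B)" for k
      by (simp add: col_def T_def g_def mult_ac)
    have hW: "h * psubst (monom 1 k) B \<in> wl2 0" for k
      using h sB by (intro smoothD smooth_mult smooth_psubst)
    have "pairing (col k) (col j) = of_real (1 / s) * pairing (h * psubst (monom 1 k) B) (h * psubst (monom 1 j) B)"
      unfolding c using hW s
      by (simp add: pairing_cmult_right[of _ 0] pairing_cmult_left[of _ 0] wl2_cmult flip: of_real_mult)
    also have "\<dots> = pairing (fps_of_poly (monom 1 k)) (fps_of_poly (monom 1 j))"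
      unfolding h_def orthonormal_system(2)[OF B b_def] s_def [symmetric] using s by simp
    also have "\<dots> = (\<Sum>i\<in>{k}. (if k = i then 1 else 0) * cnj (if j = i then 1 else 0))"
      unfolding pairing_def by (subst suminf_finite[of "{k}"]) auto
    finally show ?thesis by simp
  qed
  show thesis
  proof (rule that[of ext_op adj_op])
    show "bounded_op \<alpha> ext_op" "bounded_op \<alpha> adj_op" for \<alpha> by (rule bounded_op_ext_op bounded_op_adj_op)+
    fix \<alpha> F assume F: "F \<in> wl2 \<alpha>"
    show "adj_op (ext_op F) = F"
    proof (rule bounded_op_eqI[OF bounded_op_comp[OF bounded_op_adj_op bounded_op_ext_op] bounded_op_id _ F])
      show "adj_op (ext_op (fps_X ^ k)) = fps_X ^ k" for k
        by (rule fps_ext) (simp add: ext_op_X_power adj_op_def ONB fps_X_power_nth)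
    qed
    show "ext_op (fps_X * F) = B * ext_op F"
    proof (rule bounded_op_eqI[OF bounded_op_comp[OF bounded_op_ext_op bounded_op_smooth]
          bounded_op_comp[OF bounded_op_smooth bounded_op_ext_op] _ F])
      show "ext_op (fps_X * fps_X ^ k) = B * ext_op (fps_X ^ k)" for k
        using ext_op_X_power[of "Suc k"] by (simp add: ext_op_X_power col_Suc)
    qed (use sB in auto)
    show "adj_op (B * F) = fps_X * adj_op F"
    proof (rule bounded_op_eqI[OF bounded_op_comp[OF bounded_op_adj_op bounded_op_smooth]
          bounded_op_comp[OF bounded_op_smooth bounded_op_adj_op] _ F])
      show "adj_op (B * fps_X ^ k) = fps_X * adj_op (fps_X ^ k)" for k
      proof (rule fps_ext)
        show "adj_op (B * fps_X ^ k) $ j = (fps_X * adj_op (fps_X ^ k)) $ j" for j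
          by (cases j) (simp_all add: adj_op_def col_0 col_Suc orth isometricD(2)[OF B])
      qed
    qed (use sB in auto)
  qed
qed

section \<open>Reducing subspaces and renorming\<close>

definition linear_on :: "cfun set \<Rightarrow> (cfun \<Rightarrow> cfun) \<Rightarrow> bool" where
  "linear_on H U \<longleftrightarrow> U ` H \<subseteq> H \<and> (\<forall>f\<in>H. \<forall>g\<in>H. U (f + g) = U f + U g) \<and>
     (\<forall>c. \<forall>f\<in>H. U (cscale c f) = cscale c (U f))"

lemma linear_onD:
  assumes "linear_on H U"
  shows "f \<in> H \<Longrightarrow> U f \<in> H" and "f \<in> H \<Longrightarrow> g \<in> H \<Longrightarrow> U (f + g) = U f + U g"
    and "f \<in> H \<Longrightarrow> U (cscale c f) = cscale c (U f)"
  using assms by (auto simp: linear_on_def)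

lemma cscale_minus_one: "cscale (- 1) f = - f"
  by (simp add: cscale_def fun_eq_iff)

lemma cscale_zero: "cscale 0 f = 0"
  by (simp add: cscale_def fun_eq_iff)

lemma linear_on_diff:
  assumes U: "linear_on H U" and H: "cfun.subspace H" and fg: "f \<in> H" "g \<in> H"
  shows "U (f - g) = U f - U g"
proof -
  have g: "- g \<in> H" using cfun.subspace_scale[OF H fg(2), of "- 1"] by (simp add: cscale_minus_one)
  have "U (f + - g) = U f + U (- g)" using fg(1) g by (rule linear_onD(2)[OF U])
  also have "U (- g) = - U g" using linear_onD(3)[OF U fg(2), of "- 1"] by (simp add: cscale_minus_one)
  finally show ?thesis by (simp only: diff_conv_add_uminus)
qed

lemma linear_on_0:
  assumes U: "linear_on H U" and H: "cfun.subspace H"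
  shows "U 0 = 0"
  using linear_onD(3)[OF U cfun.subspace_0[OF H], of 0] by (simp add: cscale_zero)

context
  fixes H ip
  assumes ip: "inner_product_on H ip"
begin

lemma ip_add_left: "f \<in> H \<Longrightarrow> g \<in> H \<Longrightarrow> h \<in> H \<Longrightarrow> ip (f + g) h = ip f h + ip g h"
  by (rule inner_product_onD(2)[OF ip])

lemma ip_scale_left: "f \<in> H \<Longrightarrow> g \<in> H \<Longrightarrow> ip (cscale c f) g = c * ip f g"
  by (rule inner_product_onD(3)[OF ip])

lemma ip_cnj: "f \<in> H \<Longrightarrow> g \<in> H \<Longrightarrow> ip g f = cnj (ip f g)"
  by (rule inner_product_onD(4)[OF ip])

lemma ip_subspace: "cfun.subspace H"
  by (rule inner_product_onD(1)[OF ip])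

lemma ip_diff_left:
  assumes "f \<in> H" "g \<in> H" "h \<in> H"
  shows "ip (f - g) h = ip f h - ip g h"
  using ip_add_left[OF cfun.subspace_diff[OF ip_subspace assms(1,2)] assms(2,3)] by simp

lemma ip_self: "f \<in> H \<Longrightarrow> ip f f = of_real ((ip_norm ip f)\<^sup>2)"
proof -
  assume f: "f \<in> H"
  have "Re (ip f f) \<ge> 0"
    using inner_product_onD(5)[OF ip f] inner_product_on_0(1)[OF ip f] by (cases "f = 0") auto
  moreover have "Im (ip f f) = 0" using arg_cong[OF ip_cnj[OF f f], of Im] by simp
  ultimately show ?thesis by (simp add: ip_norm_def complex_eq_iff)
qed

lemma ip_norm_nonneg: "f \<in> H \<Longrightarrow> ip_norm ip f \<ge> 0"
  using inner_product_onD(5)[OF ip, of f] inner_product_on_0(1)[OF ip, of f] by (cases "f = 0") (auto simp: ip_norm_def)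

lemma ip_norm_eq_0: "f \<in> H \<Longrightarrow> ip_norm ip f = 0 \<longleftrightarrow> f = 0"
  using inner_product_onD(5)[OF ip, of f] inner_product_on_0(1)[OF ip, of f] by (cases "f = 0") (auto simp: ip_norm_def)

lemma ip_cauchy_schwarz:
  assumes f: "f \<in> H" and g: "g \<in> H"
  shows "norm (ip f g) \<le> ip_norm ip f * ip_norm ip g"
proof (cases "g = 0")
  case True
  then show ?thesis using inner_product_on_0(2)[OF ip f] ip_norm_nonneg[OF f] ip_norm_nonneg[OF g] by simp
next
  case False
  define G where "G = (ip_norm ip g)\<^sup>2"
  have G: "G > 0" using ip_norm_eq_0[OF g] False by (simp add: G_def)
  define c where "c = ip f g"
  define l where "l = c / of_real G"
  define k where "k = f - cscale l g"
  have lg: "cscale l g \<in> H" by (rule cfun.subspace_scale[OF ip_subspace g])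
  have k: "k \<in> H" unfolding k_def by (rule cfun.subspace_diff[OF ip_subspace f lg])
  have kg: "ip k g = 0"
  proof -
    have "ip k g = c - l * ip g g"
      unfolding k_def c_def by (simp add: ip_diff_left[OF f lg g] ip_scale_left[OF g g])
    also have "ip g g = of_real G" unfolding G_def by (rule ip_self[OF g])
    finally show ?thesis using G by (simp add: l_def)
  qed
  have "ip k k = cnj (ip f k - l * ip g k)"
    using ip_cnj[OF k k] ip_diff_left[OF f lg k] ip_scale_left[OF g k, of l] by (simp add: k_def)
  also have "ip g k = 0" using ip_cnj[OF k g] kg by simp
  also have "ip f k = cnj (ip k f)" by (rule ip_cnj[OF k f])
  also have "ip k f = ip f f - l * cnj c"
    unfolding k_def using ip_diff_left[OF f lg f] ip_scale_left[OF g f] ip_cnj[OF f g] by (simp add: c_def)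
  finally have "ip k k = of_real ((ip_norm ip f)\<^sup>2 - (norm c)\<^sup>2 / G)"
    by (simp add: ip_self[OF f] l_def complex_norm_square [symmetric] flip: of_real_power)
  then have "of_real ((ip_norm ip k)\<^sup>2) = (of_real ((ip_norm ip f)\<^sup>2 - (norm c)\<^sup>2 / G) :: complex)"
    using ip_self[OF k] by simp
  then have "(ip_norm ip k)\<^sup>2 = (ip_norm ip f)\<^sup>2 - (norm c)\<^sup>2 / G" by (simp only: of_real_eq_iff)
  then have "(norm c)\<^sup>2 / G \<le> (ip_norm ip f)\<^sup>2" by (metis diff_ge_0_iff_ge zero_le_power2)
  then have "(norm c)\<^sup>2 \<le> (ip_norm ip f * ip_norm ip g)\<^sup>2"
    using G by (simp add: field_simps G_def power_mult_distrib)
  then show ?thesis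
    unfolding c_def by (rule power2_le_imp_le) (simp add: ip_norm_nonneg f g)
qed

text \<open>
  A limit of vectors orthogonal to \<open>g\<close> is orthogonal to \<open>g\<close> by the Cauchy--Schwarz inequality.
\<close>

lemma closed_subspace_orth_compl:
  assumes X: "X \<subseteq> H"
  shows "closed_subspace H ip (orth_compl H ip X)"
proof -
  interpret Metric_space H "ip_dist H ip" by (rule Metric_space_ip_dist[OF ip])
  let ?O = "orth_compl H ip X"
  have sub: "cfun.subspace ?O"
  proof (rule cfun.subspaceI)
    show "0 \<in> ?O" using X cfun.subspace_0[OF ip_subspace] inner_product_on_0[OF ip] by (auto simp: orth_compl_def)
    show "f + g \<in> ?O" if "f \<in> ?O" "g \<in> ?O" for f g
      using that X ip_add_left cfun.subspace_add[OF ip_subspace] by (fastforce simp: orth_compl_def)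
    show "cscale c f \<in> ?O" if "f \<in> ?O" for c f
      using that X ip_scale_left cfun.subspace_scale[OF ip_subspace] by (fastforce simp: orth_compl_def)
  qed
  have "closedin mtopology ?O"
    unfolding metric_closedin_iff_sequentially_closed
  proof (intro conjI allI impI)
    show "?O \<subseteq> H" by (auto simp: orth_compl_def)
    fix \<sigma> l assume *: "range \<sigma> \<subseteq> ?O \<and> limitin mtopology \<sigma> l sequentially"
    then have l: "l \<in> H" and \<sigma>: "\<And>n. \<sigma> n \<in> H" "\<And>n g. g \<in> X \<Longrightarrow> ip (\<sigma> n) g = 0"
      and lim: "\<And>e. e > 0 \<Longrightarrow> \<exists>N. \<forall>n\<ge>N. ip_dist H ip (\<sigma> n) l < e"
      by (auto simp: limit_metric_sequentially orth_compl_def image_subset_iff)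
    have "ip l g = 0" if g: "g \<in> X" for g
    proof (rule ccontr)
      assume nz: "ip l g \<noteq> 0"
      have gH: "g \<in> H" using g X by auto
      define e where "e = norm (ip l g) / (ip_norm ip g + 1)"
      have g0: "ip_norm ip g \<ge> 0" by (rule ip_norm_nonneg[OF gH])
      then have e: "e > 0" using nz by (simp add: e_def add_nonneg_pos)
      then obtain n where n: "ip_norm ip (\<sigma> n - l) < e"
        using lim l \<sigma>(1) by (force simp: ip_dist_def)
      have d: "\<sigma> n - l \<in> H" by (rule cfun.subspace_diff[OF ip_subspace \<sigma>(1) l])
      have "ip (\<sigma> n - l) g = - ip l g" using ip_diff_left[OF \<sigma>(1) l gH] \<sigma>(2)[OF g] by simp
      then have "norm (ip l g) \<le> ip_norm ip (\<sigma> n - l) * ip_norm ip g"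
        using ip_cauchy_schwarz[OF d gH] by simp
      also have "\<dots> \<le> e * ip_norm ip g" using n g0 by (intro mult_right_mono) auto
      also have "\<dots> < e * (ip_norm ip g + 1)" using e by simp
      also have "\<dots> = norm (ip l g)" using g0 by (simp add: e_def)
      finally show False by simp
    qed
    then show "l \<in> ?O" using l by (simp add: orth_compl_def)
  qed
  then show ?thesis using sub by (auto simp: closed_subspace_def orth_compl_def)
qed

end

text \<open>
  If \<open>V\<close> is the adjoint of \<open>U\<close> and \<open>V U = 1\<close>, then \<open>U\<close> is isometric, and its range and the kernel of \<open>V\<close>
  are orthogonal complements of each other. The relation \<open>U S = T U\<close> makes the range invariant under
  \<open>T\<close>, and \<open>V T = S V\<close> makes the kernel invariant.
\<close>

lemma reducing_range:
  assumes ip: "inner_product_on H ip" and ip0: "inner_product_on H ip0"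
    and U: "linear_on H U" and V: "linear_on H V" and S: "linear_on H S" and T: "linear_on H T"
    and VU: "\<And>f. f \<in> H \<Longrightarrow> V (U f) = f"
    and adj: "\<And>f g. f \<in> H \<Longrightarrow> g \<in> H \<Longrightarrow> ip (U f) g = ip0 f (V g)"
    and US: "\<And>f. f \<in> H \<Longrightarrow> U (S f) = T (U f)"
    and VT: "\<And>f. f \<in> H \<Longrightarrow> V (T f) = S (V f)"
  shows "reducing_subspace H ip T (U ` H)"
    and "unitarily_equivalent_on H (ip_norm ip0) S (U ` H) (ip_norm ip) T"
proof -
  note sub = inner_product_onD(1)[OF ip]
  define K where "K = {g \<in> H. V g = 0}"
  have UV: "f - U (V f) \<in> K" if f: "f \<in> H" for f
  proof -
    have UVf: "U (V f) \<in> H" using f by (intro linear_onD(1)[OF U] linear_onD(1)[OF V])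
    then have "V (f - U (V f)) = V f - V (U (V f))" by (rule linear_on_diff[OF V sub f])
    then show ?thesis
      using VU[OF linear_onD(1)[OF V f]] cfun.subspace_diff[OF sub f UVf] by (simp add: K_def)
  qed
  have range: "U ` H = orth_compl H ip K"
  proof
    show "U ` H \<subseteq> orth_compl H ip K"
      using adj inner_product_on_0(2)[OF ip0] linear_onD(1)[OF U] by (auto simp: orth_compl_def K_def)
    show "orth_compl H ip K \<subseteq> U ` H"
    proof
      fix f assume "f \<in> orth_compl H ip K"
      then have f: "f \<in> H" and orth: "\<And>g. g \<in> K \<Longrightarrow> ip f g = 0" by (auto simp: orth_compl_def)
      define g where "g = f - U (V f)"
      have gK: "g \<in> K" unfolding g_def by (rule UV[OF f])
      then have g: "g \<in> H" and Vg: "V g = 0" by (auto simp: K_def)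
      have Vf: "V f \<in> H" by (rule linear_onD(1)[OF V f])
      have UVf: "U (V f) \<in> H" by (rule linear_onD(1)[OF U Vf])
      have "ip g g = ip f g - ip (U (V f)) g"
        using ip_diff_left[OF ip f UVf g] by (simp add: g_def)
      also have "\<dots> = 0" using orth[OF gK] adj[OF Vf g] inner_product_on_0(2)[OF ip0 Vf] Vg by simp
      finally have "g = 0" using inner_product_onD(5)[OF ip g] by auto
      then have "f = U (V f)" by (simp add: g_def)
      then show "f \<in> U ` H" using Vf by blast
    qed
  qed
  have compl: "orth_compl H ip (U ` H) = K"
  proof
    show "orth_compl H ip (U ` H) \<subseteq> K"
    proof
      fix g assume "g \<in> orth_compl H ip (U ` H)"
      then have g: "g \<in> H" and orth: "\<And>f. f \<in> H \<Longrightarrow> ip g (U f) = 0" by (auto simp: orth_compl_def)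
      have Vg: "V g \<in> H" by (rule linear_onD(1)[OF V g])
      have "ip0 (V g) (V g) = ip (U (V g)) g" by (rule adj[OF Vg g, symmetric])
      also have "\<dots> = cnj (ip g (U (V g)))" by (rule inner_product_onD(4)[OF ip g linear_onD(1)[OF U Vg]])
      also have "\<dots> = 0" using orth[OF Vg] by simp
      finally have "V g = 0" using inner_product_onD(5)[OF ip0 Vg] by auto
      then show "g \<in> K" using g by (simp add: K_def)
    qed
    show "K \<subseteq> orth_compl H ip (U ` H)"
    proof
      fix g assume "g \<in> K"
      then have g: "g \<in> H" "V g = 0" by (auto simp: K_def)
      have "ip g (U f) = 0" if f: "f \<in> H" for f
      proof -
        have "ip g (U f) = cnj (ip (U f) g)" by (rule inner_product_onD(4)[OF ip linear_onD(1)[OF U f] g(1)])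
        also have "ip (U f) g = 0" using adj[OF f g(1)] inner_product_on_0(2)[OF ip0 f] g(2) by simp
        finally show ?thesis by simp
      qed
      then show "g \<in> orth_compl H ip (U ` H)" using g by (auto simp: orth_compl_def)
    qed
  qed
  show "reducing_subspace H ip T (U ` H)"
    unfolding reducing_subspace_def
  proof (intro conjI)
    show "closed_subspace H ip (U ` H)"
      unfolding range by (rule closed_subspace_orth_compl[OF ip]) (auto simp: K_def)
    show "T ` U ` H \<subseteq> U ` H"
    proof (clarify)
      fix f assume f: "f \<in> H"
      show "T (U f) \<in> U ` H"
        unfolding US[OF f, symmetric] by (rule imageI) (rule linear_onD(1)[OF S f])
    qed
    show "T ` orth_compl H ip (U ` H) \<subseteq> orth_compl H ip (U ` H)"
      unfolding compl using linear_onD(1)[OF T] VT linear_on_0[OF S sub] by (auto simp: K_def)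
  qed
  show "unitarily_equivalent_on H (ip_norm ip0) S (U ` H) (ip_norm ip) T"
    unfolding unitarily_equivalent_on_def
  proof (intro exI[of _ U] conjI ballI allI refl)
    show "U (f + g) = U f + U g" if "f \<in> H" "g \<in> H" for f g using that by (rule linear_onD(2)[OF U])
    show "U (cscale c f) = cscale c (U f)" if "f \<in> H" for c f using that by (rule linear_onD(3)[OF U])
    show "ip_norm ip (U f) = ip_norm ip0 f" if "f \<in> H" for f
      using adj[OF that linear_onD(1)[OF U that]] VU[OF that] by (simp add: ip_norm_def)
    show "U (S f) = T (U f)" if "f \<in> H" for f using that by (rule US)
  qed
qed

lemma mcomplete_equivalent:
  assumes d0: "Metric_space H d0" and d: "Metric_space H d" and c: "c > 0" "C > 0"
    and le: "\<And>f g. f \<in> H \<Longrightarrow> g \<in> H \<Longrightarrow> d0 f g \<le> c * d f g"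
      "\<And>f g. f \<in> H \<Longrightarrow> g \<in> H \<Longrightarrow> d f g \<le> C * d0 f g"
    and compl: "Metric_space.mcomplete H d0"
  shows "Metric_space.mcomplete H d"
  unfolding Metric_space.mcomplete_def[OF d]
proof (intro allI impI)
  fix \<sigma> assume "Metric_space.MCauchy H d \<sigma>"
  then have \<sigma>: "\<And>n. \<sigma> n \<in> H" and cau: "\<And>e. e > 0 \<Longrightarrow> \<exists>N. \<forall>n n'. N \<le> n \<longrightarrow> N \<le> n' \<longrightarrow> d (\<sigma> n) (\<sigma> n') < e"
    unfolding Metric_space.MCauchy_def[OF d] by blast+
  have "Metric_space.MCauchy H d0 \<sigma>"
    unfolding Metric_space.MCauchy_def[OF d0]
  proof (intro conjI allI impI)
    show "range \<sigma> \<subseteq> H" using \<sigma> by auto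
    fix e :: real assume "e > 0"
    then have "e / c > 0" using c by simp
    then obtain N where N: "\<And>n n'. N \<le> n \<Longrightarrow> N \<le> n' \<Longrightarrow> d (\<sigma> n) (\<sigma> n') < e / c" using cau by blast
    have "d0 (\<sigma> n) (\<sigma> n') < e" if "N \<le> n" "N \<le> n'" for n n'
      using le(1)[OF \<sigma> \<sigma>, of n n'] N[OF that] c by (simp add: field_simps)
    then show "\<exists>N. \<forall>n n'. N \<le> n \<longrightarrow> N \<le> n' \<longrightarrow> d0 (\<sigma> n) (\<sigma> n') < e" by blast
  qed
  then obtain l where "limitin (Metric_space.mtopology H d0) \<sigma> l sequentially"
    using compl unfolding Metric_space.mcomplete_def[OF d0] by blast
  then have l: "l \<in> H" and lim: "\<And>e. e > 0 \<Longrightarrow> \<exists>N. \<forall>n\<ge>N. d0 (\<sigma> n) l < e"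
    unfolding Metric_space.limit_metric_sequentially[OF d0] by blast+
  have "limitin (Metric_space.mtopology H d) \<sigma> l sequentially"
    unfolding Metric_space.limit_metric_sequentially[OF d]
  proof (intro conjI allI impI l)
    fix e :: real assume "e > 0"
    then have "e / C > 0" using c by simp
    then obtain N where N: "\<And>n. N \<le> n \<Longrightarrow> d0 (\<sigma> n) l < e / C" using lim by blast
    have "d (\<sigma> n) l < e" if "N \<le> n" for n
      using le(2)[OF \<sigma> l, of n] N[OF that] c by (simp add: field_simps)
    then show "\<exists>N. \<forall>n\<ge>N. \<sigma> n \<in> H \<and> d (\<sigma> n) l < e" using \<sigma> by blast
  qed
  then show "\<exists>x. limitin (Metric_space.mtopology H d) \<sigma> x sequentially" by blast
qed

text \<open>
  The inner product for which the two summands of \<open>f = U V f + (f - U V f)\<close> are orthogonal, the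
  first being measured by its preimage under \<open>U\<close>.
\<close>

definition renorm :: "(cfun \<Rightarrow> cfun \<Rightarrow> complex) \<Rightarrow> (cfun \<Rightarrow> cfun) \<Rightarrow> (cfun \<Rightarrow> cfun) \<Rightarrow> cfun \<Rightarrow> cfun \<Rightarrow> complex" where
  "renorm ip U V f g = ip (V f) (V g) + ip (f - U (V f)) (g - U (V g))"

text \<open>
  Boundedness of \<open>U\<close> and \<open>V\<close> makes the new norm equivalent to the old one, and the new inner product
  turns \<open>V\<close> into the adjoint of \<open>U\<close>, since \<open>f - U V f\<close> vanishes on the range of \<open>U\<close>.
\<close>

lemma renorming:
  assumes hilb: "hilbert_space_on H ip"
    and U: "linear_on H U" and V: "linear_on H V"
    and bU: "\<And>f. f \<in> H \<Longrightarrow> ip_norm ip (U f) \<le> K * ip_norm ip f"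
    and bV: "\<And>f. f \<in> H \<Longrightarrow> ip_norm ip (V f) \<le> L * ip_norm ip f"
    and VU: "\<And>f. f \<in> H \<Longrightarrow> V (U f) = f"
  shows "hilbert_space_on H (renorm ip U V)"
    and "equivalent_norms_on H (ip_norm (renorm ip U V)) (ip_norm ip)"
    and "\<And>f g. f \<in> H \<Longrightarrow> g \<in> H \<Longrightarrow> renorm ip U V (U f) g = ip f (V g)"
proof -
  have ip: "inner_product_on H ip" and compl: "Metric_space.mcomplete H (ip_dist H ip)"
    using hilb by (auto simp: hilbert_space_on_def)
  note sub = ip_subspace[OF ip]
  let ?r = "renorm ip U V"
  define Q where "Q f = f - U (V f)" for f
  have r: "?r f g = ip (V f) (V g) + ip (Q f) (Q g)" for f g by (simp add: renorm_def Q_def)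
  note UH = linear_onD(1)[OF U] and VH = linear_onD(1)[OF V]
  have QH: "Q f \<in> H" if "f \<in> H" for f
    unfolding Q_def using that UH VH by (intro cfun.subspace_diff[OF sub]) auto
  have Q: "linear_on H Q"
    unfolding linear_on_def
  proof (intro conjI ballI allI)
    show "Q ` H \<subseteq> H" using QH by auto
    show "Q (f + g) = Q f + Q g" if "f \<in> H" "g \<in> H" for f g
      using that UH VH by (simp add: Q_def linear_onD(2)[OF U] linear_onD(2)[OF V])
    show "Q (cscale c f) = cscale c (Q f)" if "f \<in> H" for f c
      using that UH VH by (simp add: Q_def linear_onD(3)[OF U] linear_onD(3)[OF V])
        (simp add: cscale_def fun_eq_iff algebra_simps)
  qed
  have decomp: "f = U (V f) + Q f" for f by (simp add: Q_def)
  have ip_r: "inner_product_on H ?r"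
    unfolding inner_product_on_def
  proof (intro conjI ballI allI impI)
    show "cfun.subspace H" by (rule sub)
    show "?r (f + g) h = ?r f h + ?r g h" if "f \<in> H" "g \<in> H" "h \<in> H" for f g h
      using that by (simp add: r linear_onD(2)[OF V] linear_onD(2)[OF Q] ip_add_left[OF ip] VH QH)
    show "?r (cscale c f) g = c * ?r f g" if "f \<in> H" "g \<in> H" for c f g
      using that by (simp add: r linear_onD(3)[OF V] linear_onD(3)[OF Q] ip_scale_left[OF ip] VH QH distrib_left)
    show "?r g f = cnj (?r f g)" if "f \<in> H" "g \<in> H" for f g
      unfolding r complex_cnj_add using that by (simp add: ip_cnj[OF ip, of "V f" "V g"] ip_cnj[OF ip, of "Q f" "Q g"] VH QH)
    show "Re (?r f f) > 0" if f: "f \<in> H" and nz: "f \<noteq> 0" for f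
    proof -
      have "V f \<noteq> 0 \<or> Q f \<noteq> 0"
      proof (rule ccontr)
        assume "\<not> (V f \<noteq> 0 \<or> Q f \<noteq> 0)"
        then have "f = 0" using decomp[of f] linear_on_0[OF U sub] by simp
        with nz show False by simp
      qed
      then show ?thesis
        using ip_norm_eq_0[OF ip VH[OF f]] ip_norm_eq_0[OF ip QH[OF f]]
        by (auto simp: r ip_self[OF ip VH[OF f]] ip_self[OF ip QH[OF f]] add_pos_nonneg add_nonneg_pos simp del: of_real_power)
    qed
  qed
  define n where "n = ip_norm ip"
  have n0: "n f \<ge> 0" if "f \<in> H" for f unfolding n_def by (rule ip_norm_nonneg[OF ip that])
  have nr: "ip_norm ?r f = sqrt ((n (V f))\<^sup>2 + (n (Q f))\<^sup>2)" if f: "f \<in> H" for f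
    unfolding ip_norm_def[of ?r] r ip_self[OF ip VH[OF f]] ip_self[OF ip QH[OF f]] n_def by simp
  define K' where "K' = max K 1"
  define L' where "L' = max L 1"
  have K': "K' \<ge> 1" and L': "L' \<ge> 1" by (auto simp: K'_def L'_def)
  have nU: "n (U f) \<le> K' * n f" if "f \<in> H" for f
    using order_trans[OF bU[OF that] mult_right_mono[of K K']] n0[OF that] by (auto simp: K'_def n_def)
  have nV: "n (V f) \<le> L' * n f" if "f \<in> H" for f
    using order_trans[OF bV[OF that] mult_right_mono[of L L']] n0[OF that] by (auto simp: L'_def n_def)
  have tri: "n (f + g) \<le> n f + n g" if "f \<in> H" "g \<in> H" for f g
    unfolding n_def using that by (rule ip_norm_triangle[OF ip])
  have nQ: "n (Q f) \<le> (1 + K' * L') * n f" if f: "f \<in> H" for f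
  proof -
    define g where "g = cscale (- 1) (U (V f))"
    have UV: "U (V f) \<in> H" by (intro UH VH f)
    then have g: "g \<in> H" unfolding g_def by (rule cfun.subspace_scale[OF sub])
    have "ip g g = ip (U (V f)) (U (V f))"
      using ip_scale_left[OF ip UV g, of "- 1"] ip_cnj[OF ip g UV] ip_scale_left[OF ip UV UV, of "- 1"] ip_cnj[OF ip UV UV]
      by (simp add: g_def)
    then have "n g = n (U (V f))" by (simp add: n_def ip_norm_def)
    also have "\<dots> \<le> K' * (L' * n f)"
      using nU[OF VH[OF f]] nV[OF f] K' by (meson mult_left_mono order_trans zero_le_one)
    finally have "n g \<le> K' * (L' * n f)" .
    moreover have "Q f = f + g" by (simp add: Q_def g_def cscale_minus_one)
    ultimately show ?thesis using tri[OF f g] by (simp add: algebra_simps)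
  qed
  define C where "C = L' + (1 + K' * L')"
  define c where "c = K' + 1"
  have C: "C > 0" and c: "c > 0" using K' L' by (auto simp: C_def c_def intro!: add_pos_pos)
  have upper: "ip_norm ?r f \<le> C * n f" if f: "f \<in> H" for f
  proof -
    have "ip_norm ?r f \<le> n (V f) + n (Q f)"
      unfolding nr[OF f] by (rule sqrt_sum_squares_le_sum) (auto intro: n0 VH QH f)
    also have "\<dots> \<le> C * n f" using nV[OF f] nQ[OF f] by (simp add: C_def distrib_right)
    finally show ?thesis .
  qed
  have lower: "n f \<le> c * ip_norm ?r f" if f: "f \<in> H" for f
  proof -
    have V_le: "n (V f) \<le> ip_norm ?r f" and Q_le: "n (Q f) \<le> ip_norm ?r f"
      unfolding nr[OF f] by (auto intro: real_le_rsqrt)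
    have "n f \<le> n (U (V f)) + n (Q f)"
      using tri[of "U (V f)" "Q f"] decomp[of f] UH[OF VH[OF f]] QH[OF f] by simp
    also have "\<dots> \<le> K' * n (V f) + n (Q f)" using nU[OF VH[OF f]] by simp
    also have "\<dots> \<le> K' * ip_norm ?r f + ip_norm ?r f"
      using V_le Q_le K' by (intro add_mono mult_left_mono) auto
    finally show ?thesis by (simp add: c_def distrib_right)
  qed
  show "equivalent_norms_on H (ip_norm ?r) (ip_norm ip)"
    unfolding equivalent_norms_on_def
  proof (rule exI[of _ "1 / c"], rule conjI[OF _ exI[of _ C]], goal_cases)
    case 2
    have "1 / c * ip_norm ip f \<le> ip_norm ?r f" if "f \<in> H" for f
      using lower[OF that] c by (simp add: n_def field_simps)
    then show ?case using upper C by (simp add: n_def)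
  qed (use c in simp)
  have "Metric_space.mcomplete H (ip_dist H ?r)"
  proof (rule mcomplete_equivalent[OF Metric_space_ip_dist[OF ip] Metric_space_ip_dist[OF ip_r] c C _ _ compl])
    fix f g assume fg: "f \<in> H" "g \<in> H"
    then have d: "f - g \<in> H" by (rule cfun.subspace_diff[OF sub])
    show "ip_dist H ip f g \<le> c * ip_dist H ?r f g" "ip_dist H ?r f g \<le> C * ip_dist H ip f g"
      using fg lower[OF d] upper[OF d] by (simp_all add: ip_dist_def n_def)
  qed
  with ip_r show "hilbert_space_on H ?r" by (simp add: hilbert_space_on_def)
  show "?r (U f) g = ip f (V g)" if fg: "f \<in> H" "g \<in> H" for f g
  proof -
    have "Q (U f) = 0" by (simp add: Q_def VU fg)
    then show ?thesis unfolding r using fg inner_product_on_0(1)[OF ip QH] by (simp add: VU)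
  qed
qed

section \<open>Functions on the disc and their Taylor series\<close>

definition taylor_fps :: "cfun \<Rightarrow> complex fps" where
  "taylor_fps f = fps_expansion f 0"

definition disc_fun :: "complex fps \<Rightarrow> cfun" where
  "disc_fun F = (\<lambda>z. if z \<in> ball 0 1 then eval_fps F z else 0)"

lemma taylor_fps_nth: "taylor_fps f $ k = taylor_coeff f k"
  by (simp add: taylor_fps_def fps_expansion_def taylor_coeff_def)

lemma taylor_fps_eqI: "f has_fps_expansion F \<Longrightarrow> taylor_fps f = F"
  by (rule fps_ext) (simp add: taylor_fps_nth taylor_coeff_def fps_nth_fps_expansion)

lemma has_fps_expansion_taylor_fps: "f holomorphic_on ball 0 1 \<Longrightarrow> f has_fps_expansion taylor_fps f"
  unfolding taylor_fps_def by (rule has_fps_expansion_fps_expansion[of "ball 0 1"]) auto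

lemma A_space_iff:
  "f \<in> A_space \<alpha> \<longleftrightarrow> f holomorphic_on ball 0 1 \<and> (\<forall>z. z \<notin> ball 0 1 \<longrightarrow> f z = 0) \<and> taylor_fps f \<in> wl2 \<alpha>"
  by (simp add: A_space_def wl2_iff taylor_fps_nth wt_def mult.commute)

lemma A_spaceD:
  assumes "f \<in> A_space \<alpha>"
  shows "f holomorphic_on ball 0 1" "taylor_fps f \<in> wl2 \<alpha>" "f has_fps_expansion taylor_fps f"
  using assms has_fps_expansion_taylor_fps by (auto simp: A_space_iff)

text \<open>
  Pair \<open>F\<close> with a geometric series, which lies in every weighted space.
\<close>

lemma wl2_conv_radius:
  assumes F: "F \<in> wl2 \<alpha>"
  shows "fps_conv_radius F \<ge> 1"
  unfolding fps_conv_radius_def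
proof (rule conv_radius_geI_ex')
  fix r :: real assume r: "0 < r" "ereal r < 1"
  have "smooth (inverse (1 - fps_const (of_real r) * fps_X))" using r by (intro smooth_geometric) auto
  then have "Abs_fps (\<lambda>k. of_real r ^ k) \<in> wl2 (- \<alpha>)" unfolding inverse_one_minus_cX by (rule smoothD)
  from pairing_summable'[OF F this] show "summable (\<lambda>n. F $ n * of_real r ^ n)" by simp
qed

lemma disc_fun_in_A_space:
  assumes F: "F \<in> wl2 \<alpha>"
  shows "taylor_fps (disc_fun F) = F" and "disc_fun F \<in> A_space \<alpha>"
proof -
  have conv: "fps_conv_radius F \<ge> 1" by (rule wl2_conv_radius[OF F])
  have pos: "fps_conv_radius F > 0" by (rule less_le_trans[OF _ conv]) simp
  have ev: "eventually (\<lambda>z. disc_fun F z = eval_fps F z) (nhds 0)"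
    using eventually_nhds_in_open[of "ball 0 1" "0::complex"]
    by (auto elim!: eventually_mono simp: disc_fun_def)
  have "disc_fun F has_fps_expansion F"
    using has_fps_expansion_cong[OF ev refl] eval_fps_has_fps_expansion[OF pos] by simp
  then show *: "taylor_fps (disc_fun F) = F" by (rule taylor_fps_eqI)
  have "ball 0 1 \<subseteq> eball (0::complex) (fps_conv_radius F)"
  proof
    fix z :: complex assume "z \<in> ball 0 1"
    then have "ereal (norm z) < 1" by (simp add: one_ereal_def)
    then have "ereal (norm z) < fps_conv_radius F" using conv by (rule less_le_trans)
    then show "z \<in> eball 0 (fps_conv_radius F)" by (simp add: in_eball_iff)
  qed
  then have "eval_fps F holomorphic_on ball 0 1" by (rule holomorphic_on_eval_fps)
  then have "disc_fun F holomorphic_on ball 0 1"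
    by (rule holomorphic_transform) (simp add: disc_fun_def)
  then show "disc_fun F \<in> A_space \<alpha>" using F * by (simp add: A_space_iff) (simp add: disc_fun_def)
qed

lemma disc_fun_taylor_fps:
  assumes "f \<in> A_space \<alpha>"
  shows "disc_fun (taylor_fps f) = f"
proof
  fix z
  show "disc_fun (taylor_fps f) z = f z"
  proof (cases "z \<in> ball 0 1")
    case True
    from holomorphic_power_series[OF A_spaceD(1)[OF assms] True] True show ?thesis
      by (simp add: disc_fun_def eval_fps_def taylor_fps_nth taylor_coeff_def sums_iff)
  next
    case False
    then show ?thesis using assms by (auto simp: disc_fun_def A_space_iff)
  qed
qed

lemma A_space_eqI: "f \<in> A_space \<alpha> \<Longrightarrow> g \<in> A_space \<alpha> \<Longrightarrow> taylor_fps f = taylor_fps g \<Longrightarrow> f = g"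
  using disc_fun_taylor_fps by metis

lemma A_space_subspace: "cfun.subspace (A_space \<alpha>)"
  by (rule inner_product_onD(1)[OF inner_product_on_A_inner])

lemma taylor_fps_add: "f \<in> A_space \<alpha> \<Longrightarrow> g \<in> A_space \<alpha> \<Longrightarrow> taylor_fps (f + g) = taylor_fps f + taylor_fps g"
  unfolding plus_fun_def by (intro taylor_fps_eqI has_fps_expansion_add A_spaceD(3))

lemma taylor_fps_cscale: "f \<in> A_space \<alpha> \<Longrightarrow> taylor_fps (cscale c f) = fps_const c * taylor_fps f"
  unfolding cscale_def by (intro taylor_fps_eqI has_fps_expansion_cmult_left A_spaceD(3))

lemma taylor_fps_diff: "f \<in> A_space \<alpha> \<Longrightarrow> g \<in> A_space \<alpha> \<Longrightarrow> taylor_fps (f - g) = taylor_fps f - taylor_fps g"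
  using taylor_fps_add[of "f - g" \<alpha> g] cfun.subspace_diff[OF A_space_subspace] by simp

lemma A_norm_sq: "f \<in> A_space \<alpha> \<Longrightarrow> sqnorm \<alpha> (taylor_fps f) = ennreal ((A_norm \<alpha> f)\<^sup>2)"
proof -
  assume f: "f \<in> A_space \<alpha>"
  then have "summable (\<lambda>k. wt \<alpha> k * (norm (taylor_fps f $ k))\<^sup>2)" by (simp add: A_space_iff wl2_iff)
  then have "(\<Sum>k. wt \<alpha> k * (norm (taylor_fps f $ k))\<^sup>2) \<ge> 0" by (rule suminf_nonneg) simp
  then show ?thesis
    using f by (simp add: sqnorm_eq_suminf A_space_iff wl2_def A_norm_def taylor_fps_nth wt_def mult.commute)
qed

lemma A_norm_nonneg: "f \<in> A_space \<alpha> \<Longrightarrow> A_norm \<alpha> f \<ge> 0"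
  using ip_norm_nonneg[OF inner_product_on_A_inner] ip_norm_A_inner by metis

lemma mult_op_in_A_space:
  assumes f: "f \<in> A_space \<alpha>" and B: "B holomorphic_on ball 0 1" "B has_fps_expansion G" and G: "smooth G"
  shows "mult_op B f \<in> A_space \<alpha>" and "taylor_fps (mult_op B f) = G * taylor_fps f"
proof -
  show *: "taylor_fps (mult_op B f) = G * taylor_fps f"
    unfolding mult_op_def by (intro taylor_fps_eqI has_fps_expansion_mult B A_spaceD(3)[OF f])
  have "mult_op B f holomorphic_on ball 0 1"
    unfolding mult_op_def by (intro holomorphic_intros B A_spaceD(1)[OF f])
  then show "mult_op B f \<in> A_space \<alpha>"
    using f G * by (auto simp: A_space_iff wl2_smooth_mult) (auto simp: mult_op_def)
qed

lemma linear_on_mult_op: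
  assumes B: "B holomorphic_on ball 0 1" "B has_fps_expansion G" and G: "smooth G"
  shows "linear_on (A_space \<alpha>) (mult_op B)"
  using mult_op_in_A_space(1)[OF _ B G]
  by (auto simp: linear_on_def mult_op_def cscale_def fun_eq_iff algebra_simps)

definition lift_op :: "(complex fps \<Rightarrow> complex fps) \<Rightarrow> cfun \<Rightarrow> cfun" where
  "lift_op S f = disc_fun (S (taylor_fps f))"

lemma taylor_fps_lift:
  assumes "bounded_op \<alpha> S" "f \<in> A_space \<alpha>"
  shows "lift_op S f \<in> A_space \<alpha>" "taylor_fps (lift_op S f) = S (taylor_fps f)"
proof -
  have "S (taylor_fps f) \<in> wl2 \<alpha>" by (rule bounded_opD(4)[OF assms(1) A_spaceD(2)[OF assms(2)]])
  from disc_fun_in_A_space[OF this]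
  show "lift_op S f \<in> A_space \<alpha>" "taylor_fps (lift_op S f) = S (taylor_fps f)"
    by (simp_all add: lift_op_def)
qed

lemma linear_on_lift:
  assumes S: "bounded_op \<alpha> S"
  shows "linear_on (A_space \<alpha>) (lift_op S)"
  unfolding linear_on_def
proof (intro conjI ballI allI)
  note L = taylor_fps_lift[OF S]
  show "lift_op S ` A_space \<alpha> \<subseteq> A_space \<alpha>" using L by auto
  show "lift_op S (f + g) = lift_op S f + lift_op S g" if "f \<in> A_space \<alpha>" "g \<in> A_space \<alpha>" for f g
    using that by (intro A_space_eqI[where \<alpha> = \<alpha>] L cfun.subspace_add[OF A_space_subspace])
      (simp_all add: L taylor_fps_add[of _ \<alpha>] cfun.subspace_add[OF A_space_subspace] bounded_opD(1)[OF S] A_spaceD)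
  show "lift_op S (cscale c f) = cscale c (lift_op S f)" if "f \<in> A_space \<alpha>" for c f
    using that by (intro A_space_eqI[where \<alpha> = \<alpha>] L cfun.subspace_scale[OF A_space_subspace])
      (simp_all add: L taylor_fps_cscale[of _ \<alpha>] cfun.subspace_scale[OF A_space_subspace] bounded_opD(2)[OF S] A_spaceD)
qed

lemma lift_bounded:
  assumes S: "bounded_op \<alpha> S"
  shows "\<exists>K. \<forall>f\<in>A_space \<alpha>. ip_norm (A_inner \<alpha>) (lift_op S f) \<le> K * ip_norm (A_inner \<alpha>) f"
proof -
  obtain K where K: "K > 0" "\<And>F. F \<in> wl2 \<alpha> \<Longrightarrow> sqnorm \<alpha> (S F) \<le> ennreal K * sqnorm \<alpha> F"
    using bounded_opD(3)[OF S] by blast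
  have "A_norm \<alpha> (lift_op S f) \<le> sqrt K * A_norm \<alpha> f" if f: "f \<in> A_space \<alpha>" for f
  proof (rule power2_le_imp_le)
    have "sqnorm \<alpha> (taylor_fps (lift_op S f)) \<le> ennreal K * sqnorm \<alpha> (taylor_fps f)"
      using K(2)[OF A_spaceD(2)[OF f]] taylor_fps_lift(2)[OF S f] by simp
    then have "ennreal ((A_norm \<alpha> (lift_op S f))\<^sup>2) \<le> ennreal (K * (A_norm \<alpha> f)\<^sup>2)"
      unfolding A_norm_sq[OF taylor_fps_lift(1)[OF S f]] A_norm_sq[OF f]
      using K(1) by (simp add: ennreal_mult)
    then show "(A_norm \<alpha> (lift_op S f))\<^sup>2 \<le> (sqrt K * A_norm \<alpha> f)\<^sup>2"
      using K(1) by (simp add: power_mult_distrib)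
  qed (use K(1) A_norm_nonneg[OF f] in simp)
  then show ?thesis using taylor_fps_lift(1)[OF S] by (auto simp: ip_norm_A_inner)
qed

text \<open>
  The usual completeness proof for \<open>\<ell>\<^sup>2\<close>: the coefficients of a Cauchy sequence converge, and the
  Cauchy estimate on finitely many coefficients survives the limit.
\<close>

lemma hilbert_A_space: "hilbert_space_on (A_space \<alpha>) (A_inner \<alpha>)"
proof -
  note ip = inner_product_on_A_inner[of \<alpha>]
  interpret Metric_space "A_space \<alpha>" "ip_dist (A_space \<alpha>) (A_inner \<alpha>)"
    by (rule Metric_space_ip_dist[OF ip])
  have dist: "ip_dist (A_space \<alpha>) (A_inner \<alpha>) f g < e \<longleftrightarrow> sqnorm \<alpha> (taylor_fps f - taylor_fps g) < ennreal (e\<^sup>2)"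
    if fg: "f \<in> A_space \<alpha>" "g \<in> A_space \<alpha>" and e: "e > 0" for f g e
  proof -
    have d: "f - g \<in> A_space \<alpha>" using fg by (rule cfun.subspace_diff[OF A_space_subspace])
    have "ip_dist (A_space \<alpha>) (A_inner \<alpha>) f g = A_norm \<alpha> (f - g)"
      using fg d by (simp add: ip_dist_def ip_norm_A_inner)
    moreover have "sqnorm \<alpha> (taylor_fps f - taylor_fps g) = ennreal ((A_norm \<alpha> (f - g))\<^sup>2)"
      using A_norm_sq[OF d] taylor_fps_diff[OF fg] by simp
    moreover have "A_norm \<alpha> (f - g) < e \<longleftrightarrow> (A_norm \<alpha> (f - g))\<^sup>2 < e\<^sup>2"
      using power_strict_mono[of "A_norm \<alpha> (f - g)" e 2] power_less_imp_less_base[of "A_norm \<alpha> (f - g)" 2 e]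
        A_norm_nonneg[OF d] e by auto
    ultimately show ?thesis by (simp add: ennreal_less_iff)
  qed
  have mcomplete
    unfolding mcomplete_def
  proof (intro allI impI)
    fix \<sigma> assume "MCauchy \<sigma>"
    then have \<sigma>: "\<And>n. \<sigma> n \<in> A_space \<alpha>"
      and cau: "\<And>e. e > 0 \<Longrightarrow> \<exists>M. \<forall>n m. M \<le> n \<longrightarrow> M \<le> m \<longrightarrow> ip_dist (A_space \<alpha>) (A_inner \<alpha>) (\<sigma> n) (\<sigma> m) < e"
      unfolding MCauchy_def by blast+
    define F where "F n = taylor_fps (\<sigma> n)" for n
    have cauN: "\<exists>M. \<forall>n\<ge>M. \<forall>m\<ge>M. sqnorm \<alpha> (F n - F m) < ennreal (e\<^sup>2)" if e: "e > 0" for e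
      using cau[OF e] unfolding F_def by (metis dist[OF \<sigma> \<sigma> e])
    have "Cauchy (\<lambda>n. F n $ k)" for k
    proof (rule CauchyI)
      fix e :: real assume e: "e > 0"
      define d where "d = e * sqrt (wt \<alpha> k)"
      have "d > 0" using e by (simp add: d_def)
      then obtain M where M: "\<And>n m. M \<le> n \<Longrightarrow> M \<le> m \<Longrightarrow> sqnorm \<alpha> (F n - F m) < ennreal (d\<^sup>2)"
        using cauN by blast
      have "norm (F n $ k - F m $ k) < e" if "M \<le> n" "M \<le> m" for n m
      proof -
        have "ennreal (wt \<alpha> k * (norm ((F n - F m) $ k))\<^sup>2) < ennreal (d\<^sup>2)"
          by (rule le_less_trans[OF sqnorm_coeff M[OF that]])
        then have "wt \<alpha> k * (norm (F n $ k - F m $ k))\<^sup>2 < wt \<alpha> k * e\<^sup>2"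
          by (simp add: ennreal_less_iff d_def power_mult_distrib mult.commute)
        then have "(norm (F n $ k - F m $ k))\<^sup>2 < e\<^sup>2" using wt_pos[of \<alpha> k] by (simp only: mult_less_cancel_left_pos)
        then show ?thesis using e by (simp add: power_less_imp_less_base)
      qed
      then show "\<exists>M. \<forall>m\<ge>M. \<forall>n\<ge>M. norm (F m $ k - F n $ k) < e" by blast
    qed
    then have "convergent (\<lambda>n. F n $ k)" for k by (simp add: Cauchy_convergent_iff)
    then have "\<forall>k. \<exists>L. (\<lambda>n. F n $ k) \<longlonglongrightarrow> L" by (simp add: convergent_def)
    then obtain L where L: "\<And>k. (\<lambda>n. F n $ k) \<longlonglongrightarrow> L k" by metis
    define G where "G = Abs_fps L"
    have lim: "\<exists>M. \<forall>n\<ge>M. sqnorm \<alpha> (F n - G) \<le> ennreal (e\<^sup>2)" if e: "e > 0" for e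
    proof -
      obtain M where M: "\<And>n m. M \<le> n \<Longrightarrow> M \<le> m \<Longrightarrow> sqnorm \<alpha> (F n - F m) < ennreal (e\<^sup>2)"
        using cauN[OF e] by blast
      have "sqnorm \<alpha> (F n - G) \<le> ennreal (e\<^sup>2)" if n: "M \<le> n" for n
      proof (rule weighted_sqnorm_leI)
        fix p
        have "(\<lambda>m. \<Sum>k<p. wt \<alpha> k * (norm ((F n - F m) $ k))\<^sup>2) \<longlonglongrightarrow> (\<Sum>k<p. wt \<alpha> k * (norm ((F n - G) $ k))\<^sup>2)"
          unfolding fps_sub_nth G_def fps_nth_Abs_fps by (intro tendsto_intros L)
        moreover have "(\<Sum>k<p. wt \<alpha> k * (norm ((F n - F m) $ k))\<^sup>2) \<le> e\<^sup>2" if m: "M \<le> m" for m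
        proof -
          have "ennreal (\<Sum>k<p. wt \<alpha> k * (norm ((F n - F m) $ k))\<^sup>2) < ennreal (e\<^sup>2)"
            by (rule le_less_trans[OF weighted_sqnorm_partial M[OF n m]]) auto
          then show ?thesis by (simp add: ennreal_less_iff sum_nonneg)
        qed
        ultimately have "(\<Sum>k<p. wt \<alpha> k * (norm ((F n - G) $ k))\<^sup>2) \<le> e\<^sup>2"
          by (intro LIMSEQ_le_const2) auto
        then show "ennreal (\<Sum>k<p. wt \<alpha> k * (norm ((F n - G) $ k))\<^sup>2) \<le> ennreal (e\<^sup>2)" by (rule ennreal_leI)
      qed simp
      then show ?thesis by blast
    qed
    have "G \<in> wl2 \<alpha>"
    proof -
      obtain n where "sqnorm \<alpha> (F n - G) \<le> ennreal (1\<^sup>2)" using lim[of 1] by auto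
      then have "F n - G \<in> wl2 \<alpha>" by (simp add: wl2_def le_less_trans)
      moreover have "F n \<in> wl2 \<alpha>" unfolding F_def by (rule A_spaceD(2)[OF \<sigma>])
      ultimately have "F n - (F n - G) \<in> wl2 \<alpha>" by (rule wl2_diff[rotated])
      then show ?thesis by simp
    qed
    define l where "l = disc_fun G"
    have l: "l \<in> A_space \<alpha>" and lG: "taylor_fps l = G"
      unfolding l_def using disc_fun_in_A_space[OF \<open>G \<in> wl2 \<alpha>\<close>] by auto
    have "limitin mtopology \<sigma> l sequentially"
      unfolding limit_metric_sequentially
    proof (intro conjI allI impI l)
      fix e :: real assume e: "e > 0"
      then have "e / 2 > 0" by simp
      then obtain M where M: "\<And>n. M \<le> n \<Longrightarrow> sqnorm \<alpha> (F n - G) \<le> ennreal ((e / 2)\<^sup>2)" using lim by blast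
      have "ip_dist (A_space \<alpha>) (A_inner \<alpha>) (\<sigma> n) l < e" if "M \<le> n" for n
      proof -
        have "ennreal ((e / 2)\<^sup>2) < ennreal (e\<^sup>2)"
          using e by (intro ennreal_lessI power_strict_mono) auto
        with M[OF that] have "sqnorm \<alpha> (F n - G) < ennreal (e\<^sup>2)" by (rule le_less_trans)
        then show ?thesis using dist[OF \<sigma> l e] by (simp add: lG F_def)
      qed
      then show "\<exists>M. \<forall>n\<ge>M. \<sigma> n \<in> A_space \<alpha> \<and> ip_dist (A_space \<alpha>) (A_inner \<alpha>) (\<sigma> n) l < e"
        using \<sigma> by blast
    qed
    then show "\<exists>l. limitin mtopology \<sigma> l sequentially" by blast
  qed
  with ip show ?thesis by (simp add: hilbert_space_on_def)
qed

lemma unitarily_equivalent_on_cong: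
  assumes "unitarily_equivalent_on H m S M m' T" "M \<subseteq> H'"
    "\<And>f. f \<in> H \<Longrightarrow> m f = m1 f" "\<And>f. f \<in> H' \<Longrightarrow> m' f = m1' f"
  shows "unitarily_equivalent_on H m1 S M m1' T"
proof -
  from assms(1) obtain U where U: "U ` H = M" "\<forall>f\<in>H. \<forall>g\<in>H. U (f + g) = U f + U g"
    "\<forall>c. \<forall>f\<in>H. U (cscale c f) = cscale c (U f)" "\<forall>f\<in>H. m' (U f) = m f" "\<forall>f\<in>H. U (S f) = T (U f)"
    unfolding unitarily_equivalent_on_def by blast
  have "m1' (U f) = m1 f" if "f \<in> H" for f
  proof -
    have "U f \<in> H'" using U(1) assms(2) that by blast
    then show ?thesis using assms(3,4) U(4) that by force
  qed
  then show ?thesis unfolding unitarily_equivalent_on_def using U by (intro exI[of _ U]) blast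
qed

section \<open>Finite Blaschke products\<close>

text \<open>
  Positive degree enters here: \<open>\<bar>B(0)\<bar>\<close> is the product of the moduli of the zeros, which is less than
  \<open>1\<close> only if there is a zero.
\<close>

lemma finite_blaschke_product_expansion:
  assumes B: "finite_blaschke_product n B" and n: "n \<ge> 1"
  obtains G where "B holomorphic_on ball 0 1" "B has_fps_expansion G" "isometric G" "norm (G $ 0) < 1"
proof -
  obtain \<theta> :: real and a where a: "\<forall>i<n. a i \<in> ball 0 1"
    and Bz: "\<forall>z\<in>ball 0 1. B z = exp (\<i> * of_real \<theta>) * (\<Prod>i<n. (z - a i) / (1 - cnj (a i) * z))"
    using B unfolding finite_blaschke_product_def by blast
  have a1: "norm (a i) < 1" if "i < n" for i using a that by simp
  define C where "C z = exp (\<i> * of_real \<theta>) * (\<Prod>i<n. (z - a i) * inverse (1 - cnj (a i) * z))" for z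
  have BC: "B z = C z" if "z \<in> ball 0 1" for z
    using Bz that by (simp add: C_def divide_inverse)
  define g where "g i = (fps_X - fps_const (a i)) * inverse (1 - fps_const (cnj (a i)) * fps_X)" for i
  define G where "G = fps_const (exp (\<i> * of_real \<theta>)) * (\<Prod>i<n. g i)"
  have "C has_fps_expansion G"
    unfolding C_def G_def g_def
    by (intro has_fps_expansion_mult has_fps_expansion_cmult_left has_fps_expansion_prod has_fps_expansion_inverse
        has_fps_expansion_diff has_fps_expansion_fps_X has_fps_expansion_const has_fps_expansion_1) auto
  moreover have ev: "eventually (\<lambda>z. B z = C z) (nhds 0)"
    using eventually_nhds_in_open[of "ball 0 1" "0::complex"] by (auto elim!: eventually_mono simp: BC)
  ultimately have exp: "B has_fps_expansion G"
    using has_fps_expansion_cong[OF ev refl] by simp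
  have "C holomorphic_on ball 0 1"
    unfolding C_def
  proof (intro holomorphic_intros)
    fix i z assume "i \<in> {..<n}" "z \<in> ball (0::complex) 1"
    then have "norm (cnj (a i) * z) < 1"
      using a1[of i] mult_strict_mono'[of "norm (a i)" 1 "norm z" 1] by (simp add: norm_mult)
    then show "1 - cnj (a i) * z \<noteq> 0" by auto
  qed
  then have hol: "B holomorphic_on ball 0 1" by (rule holomorphic_transform) (simp add: BC)
  have iso: "isometric G"
    unfolding G_def g_def
    by (intro isometric_mult isometric_const isometric_prod isometric_blaschke_factor) (auto simp: a1)
  have "G $ 0 = exp (\<i> * of_real \<theta>) * (\<Prod>i<n. - a i)"
  proof -
    have "(\<Prod>i\<in>I. g i) $ 0 = (\<Prod>i\<in>I. g i $ 0)" for I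
      by (induction I rule: infinite_finite_induct) auto
    then show ?thesis by (simp add: G_def g_def)
  qed
  then have "norm (G $ 0) = (\<Prod>i<n. norm (a i))" by (simp add: norm_mult flip: prod_norm)
  also have "\<dots> = norm (a 0) * (\<Prod>i\<in>{..<n} - {0}. norm (a i))"
    using n by (intro prod.remove) auto
  also have "\<dots> \<le> norm (a 0) * 1"
    using a1 by (intro mult_left_mono prod_le_1) (auto simp: less_imp_le)
  also have "\<dots> < 1" using a1[of 0] n by simp
  finally show thesis using that[OF hol exp iso] by simp
qed

lemma blaschke_renormed_shift:
  assumes B: "finite_blaschke_product n B" and n: "n \<ge> 1"
  shows "\<exists>ip. hilbert_space_on (A_space \<alpha>) ip \<and>
           equivalent_norms_on (A_space \<alpha>) (ip_norm ip) (A_norm \<alpha>) \<and>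
           (\<exists>M. reducing_subspace (A_space \<alpha>) ip (mult_op B) M \<and>
              unitarily_equivalent_on (A_space \<alpha>) (A_norm \<alpha>) (mult_op (\<lambda>z. z))
                M (ip_norm ip) (mult_op B))"
proof -
  obtain G where G: "B holomorphic_on ball 0 1" "B has_fps_expansion G" "isometric G" "norm (G $ 0) < 1"
    by (rule finite_blaschke_product_expansion[OF B n])
  obtain U V where UV: "\<And>\<alpha>. bounded_op \<alpha> U" "\<And>\<alpha>. bounded_op \<alpha> V"
    "\<And>\<alpha> F. F \<in> wl2 \<alpha> \<Longrightarrow> V (U F) = F"
    "\<And>\<alpha> F. F \<in> wl2 \<alpha> \<Longrightarrow> U (fps_X * F) = G * U F"
    "\<And>\<alpha> F. F \<in> wl2 \<alpha> \<Longrightarrow> V (G * F) = fps_X * V F"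
    using intertwining_pair[OF G(3,4)] by blast
  let ?H = "A_space \<alpha>"
  note sG = isometricD(1)[OF G(3)]
  note ip0 = inner_product_on_A_inner[of \<alpha>]
  note u = taylor_fps_lift[OF UV(1)[of \<alpha>]] and v = taylor_fps_lift[OF UV(2)[of \<alpha>]]
  have Z: "(\<lambda>z::complex. z) holomorphic_on ball 0 1" "(\<lambda>z::complex. z) has_fps_expansion fps_X"
    by (auto intro: has_fps_expansion_fps_X)
  note mB = mult_op_in_A_space[where \<alpha> = \<alpha>, OF _ G(1,2) sG] and mZ = mult_op_in_A_space[where \<alpha> = \<alpha>, OF _ Z smooth_X]
  define ip where "ip = renorm (A_inner \<alpha>) (lift_op U) (lift_op V)"
  obtain K where K: "\<And>f. f \<in> ?H \<Longrightarrow> ip_norm (A_inner \<alpha>) (lift_op U f) \<le> K * ip_norm (A_inner \<alpha>) f"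
    using lift_bounded[OF UV(1)] by blast
  obtain L where L: "\<And>f. f \<in> ?H \<Longrightarrow> ip_norm (A_inner \<alpha>) (lift_op V f) \<le> L * ip_norm (A_inner \<alpha>) f"
    using lift_bounded[OF UV(2)] by blast
  have VU: "lift_op V (lift_op U f) = f" if "f \<in> ?H" for f
    by (rule A_space_eqI[where \<alpha> = \<alpha>]) (use that u v UV(3)[OF A_spaceD(2)[OF that]] in simp_all)
  have US: "lift_op U (mult_op (\<lambda>z. z) f) = mult_op B (lift_op U f)" if "f \<in> ?H" for f
    by (rule A_space_eqI[where \<alpha> = \<alpha>]) (use that u mB mZ UV(4)[OF A_spaceD(2)[OF that]] in simp_all)
  have VT: "lift_op V (mult_op B f) = mult_op (\<lambda>z. z) (lift_op V f)" if "f \<in> ?H" for f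
    by (rule A_space_eqI[where \<alpha> = \<alpha>]) (use that v mB mZ UV(5)[OF A_spaceD(2)[OF that]] in simp_all)
  note linU = linear_on_lift[OF UV(1)[of \<alpha>]] and linV = linear_on_lift[OF UV(2)[of \<alpha>]]
  note ren = renorming[where H = ?H and ip = "A_inner \<alpha>" and U = "lift_op U" and V = "lift_op V" and K = K and L = L,
      OF hilbert_A_space linU linV K L VU, folded ip_def]
  have hilb: "hilbert_space_on ?H ip" by (rule ren(1))
  have eqv: "equivalent_norms_on ?H (ip_norm ip) (A_norm \<alpha>)"
    using ren(2) unfolding equivalent_norms_on_def by (simp add: ip_norm_A_inner cong: ball_cong)
  have ip: "inner_product_on ?H ip" using hilb by (simp add: hilbert_space_on_def)
  note red = reducing_range[where H = ?H and ip = ip and ip0 = "A_inner \<alpha>" and U = "lift_op U" and V = "lift_op V"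
      and S = "mult_op (\<lambda>z. z)" and T = "mult_op B", OF ip ip0 linU linV linear_on_mult_op[OF Z smooth_X] linear_on_mult_op[OF G(1,2) sG]
      VU ren(3) US VT]
  have "unitarily_equivalent_on ?H (A_norm \<alpha>) (mult_op (\<lambda>z. z)) (lift_op U ` ?H) (ip_norm ip) (mult_op B)"
    by (rule unitarily_equivalent_on_cong[OF red(2) image_subsetI[OF u(1)]]) (use ip_norm_A_inner in auto)
  with hilb eqv red(1) show ?thesis by blast
qed


section \<open>Powers of the variable\<close>

text \<open>
  \<open>f(z) \<mapsto> n\<^bsup>-\<alpha>/2\<^esup> z\<^sup>n\<^sup>-\<^sup>1 f(z\<^sup>n)\<close>. Sending \<open>z\<^sup>k\<close> to a multiple of \<open>z\<^bsup>nk + n - 1\<^esup>\<close>, rather than of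
  \<open>z\<^bsup>nk\<^esup>\<close>, makes the weight of the image exactly \<open>n\<^sup>\<alpha> (k + 1)\<^sup>\<alpha>\<close>, so that the normalised map is isometric.
\<close>

definition dilate :: "real \<Rightarrow> nat \<Rightarrow> complex fps \<Rightarrow> complex fps" where
  "dilate \<alpha> n F = Abs_fps (\<lambda>i. if n dvd Suc i then of_real (real n powr (- \<alpha> / 2)) * F $ (Suc i div n - 1) else 0)"

text \<open>
  The adjoint of the preceding map for the inner product of exponent \<open>\<alpha>\<close>; its factor combines
  \<open>n\<^bsup>-\<alpha>/2\<^esup>\<close> with the ratio \<open>n\<^sup>\<alpha>\<close> of the weights.
\<close>

definition undilate :: "real \<Rightarrow> nat \<Rightarrow> complex fps \<Rightarrow> complex fps" where
  "undilate \<alpha> n F = Abs_fps (\<lambda>j. of_real (real n powr (\<alpha> / 2)) * F $ (n * j + (n - 1)))"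

context
  fixes n :: nat
  assumes n: "n \<ge> 1"
begin

lemma progression_props:
  "Suc (n * j + (n - 1)) = n * Suc j" "strict_mono (\<lambda>j. n * j + (n - 1))"
  "n dvd Suc i \<Longrightarrow> i = n * (Suc i div n - 1) + (n - 1)" "j \<le> n * j + (n - 1)"
  "wt \<alpha> (n * j + (n - 1)) = real n powr \<alpha> * wt \<alpha> j"
proof -
  show 1: "Suc (n * j + (n - 1)) = n * Suc j" for j using n by simp
  show "strict_mono (\<lambda>j. n * j + (n - 1))" by (intro strict_monoI add_strict_right_mono mult_strict_left_mono) (use n in auto)
  show "j \<le> n * j + (n - 1)" using n by (cases n) auto
  show "i = n * (Suc i div n - 1) + (n - 1)" if d: "n dvd Suc i"
  proof -
    obtain q where q: "Suc i = n * q" using d by blast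
    then have "q \<ge> 1" by (cases q) auto
    then obtain r where "q = Suc r" by (cases q) auto
    then show ?thesis using q n by simp
  qed
  have "real (n * j + (n - 1)) + 1 = real (Suc (n * j + (n - 1)))" by simp
  also have "\<dots> = real n * (real j + 1)" unfolding 1 by (simp add: algebra_simps)
  finally show "wt \<alpha> (n * j + (n - 1)) = real n powr \<alpha> * wt \<alpha> j"
    unfolding wt_def by (simp only:) (simp add: powr_mult)
qed

lemma dilate_nth: "dilate \<alpha> n F $ (n * j + (n - 1)) = of_real (real n powr (- \<alpha> / 2)) * F $ j"
  unfolding dilate_def fps_nth_Abs_fps progression_props(1) using n by simp

lemma dilate_nth_other: "\<not> n dvd Suc i \<Longrightarrow> dilate \<alpha> n F $ i = 0"
  by (simp add: dilate_def)

lemma not_in_progression: "i \<notin> range (\<lambda>j. n * j + (n - 1)) \<Longrightarrow> \<not> n dvd Suc i"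
  using progression_props(3) by (metis rangeI)

lemma scale_sq: "(norm (of_real (real n powr s) * z :: complex))\<^sup>2 = real n powr (2 * s) * (norm z)\<^sup>2"
  by (simp add: norm_mult power_mult_distrib power2_eq_square flip: powr_add)

lemma dilate_term:
  "wt \<alpha> (n * j + (n - 1)) * (norm (dilate \<alpha> n F $ (n * j + (n - 1))))\<^sup>2 = wt \<alpha> j * (norm (F $ j))\<^sup>2"
proof -
  have "real n powr \<alpha> * real n powr (2 * (- \<alpha> / 2)) = 1" using n by (simp flip: powr_add)
  then have "real n powr \<alpha> * wt \<alpha> j * (real n powr (2 * (- \<alpha> / 2)) * x) = wt \<alpha> j * x" for x :: real
    by (metis mult.assoc mult.commute mult_1)
  then show ?thesis unfolding dilate_nth scale_sq progression_props(5) .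
qed

lemma undilate_term:
  "wt \<alpha> j * (norm (undilate \<alpha> n F $ j))\<^sup>2 = wt \<alpha> (n * j + (n - 1)) * (norm (F $ (n * j + (n - 1))))\<^sup>2"
  unfolding undilate_def fps_nth_Abs_fps scale_sq progression_props(5) by simp

lemma bounded_op_dilate: "bounded_op \<alpha> (dilate \<alpha> n)"
proof -
  have "sqnorm \<alpha> (dilate \<alpha> n F) = sqnorm \<alpha> F" for F
  proof -
    have "(\<Sum>j. ennreal (wt \<alpha> (n * j + (n - 1)) * (norm (dilate \<alpha> n F $ (n * j + (n - 1))))\<^sup>2))
        = sqnorm \<alpha> (dilate \<alpha> n F)"
      unfolding weighted_sqnorm_def
      by (rule suminf_mono_reindex[OF progression_props(2)]) (simp add: dilate_nth_other not_in_progression)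
    then show ?thesis unfolding dilate_term by (simp add: weighted_sqnorm_def)
  qed
  then have "\<exists>K>0. \<forall>F\<in>wl2 \<alpha>. sqnorm \<alpha> (dilate \<alpha> n F) \<le> ennreal K * sqnorm \<alpha> F"
    by (intro exI[of _ 1]) simp
  then show ?thesis
    unfolding bounded_op_def by (auto intro!: fps_ext simp: dilate_def algebra_simps)
qed

lemma bounded_op_undilate: "bounded_op \<alpha> (undilate \<alpha> n)"
proof -
  let ?p = "\<lambda>j. n * j + (n - 1)"
  have "sqnorm \<alpha> (undilate \<alpha> n F) \<le> sqnorm \<alpha> F" for F
  proof -
    define f where "f i = (if i \<in> range ?p then ennreal (wt \<alpha> i * (norm (F $ i))\<^sup>2) else 0)" for i
    have "f (?p j) = ennreal (wt \<alpha> (?p j) * (norm (F $ ?p j))\<^sup>2)" for j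
      unfolding f_def by (rule if_P[OF rangeI])
    then have "sqnorm \<alpha> (undilate \<alpha> n F) = (\<Sum>j. f (?p j))"
      unfolding weighted_sqnorm_def undilate_term by presburger
    also have "\<dots> = suminf f"
      by (rule suminf_mono_reindex[OF progression_props(2)]) (simp add: f_def)
    also have "\<dots> \<le> sqnorm \<alpha> F"
      unfolding weighted_sqnorm_def by (intro suminf_le summableI) (simp add: f_def)
    finally show ?thesis .
  qed
  then have "\<exists>K>0. \<forall>F\<in>wl2 \<alpha>. sqnorm \<alpha> (undilate \<alpha> n F) \<le> ennreal K * sqnorm \<alpha> F"
    by (intro exI[of _ 1]) simp
  then show ?thesis
    unfolding bounded_op_def by (auto intro!: fps_ext simp: undilate_def algebra_simps)
qed

lemma undilate_dilate: "undilate \<alpha> n (dilate \<alpha> n F) = F"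
proof (rule fps_ext)
  fix j
  have "complex_of_real (real n powr (\<alpha> / 2)) * of_real (real n powr (- \<alpha> / 2)) = 1"
    using n by (simp flip: of_real_mult powr_add)
  then show "undilate \<alpha> n (dilate \<alpha> n F) $ j = F $ j"
    unfolding undilate_def fps_nth_Abs_fps dilate_nth by (simp flip: mult.assoc)
qed

lemma dilate_X: "dilate \<alpha> n (fps_X * F) = fps_X ^ n * dilate \<alpha> n F"
proof (rule fps_ext)
  fix i
  show "dilate \<alpha> n (fps_X * F) $ i = (fps_X ^ n * dilate \<alpha> n F) $ i"
  proof (cases "n dvd Suc i")
    case True
    define j where "j = Suc i div n - 1"
    have i: "i = n * j + (n - 1)" unfolding j_def by (rule progression_props(3)[OF True])
    show ?thesis
    proof (cases j)
      case 0
      then show ?thesis using n unfolding i dilate_nth by (simp add: fps_X_power_mult_nth)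
    next
      case (Suc k)
      have "dilate \<alpha> n (fps_X * F) $ i = of_real (real n powr (- \<alpha> / 2)) * F $ k"
        unfolding i dilate_nth by (simp add: Suc)
      also have "\<dots> = (fps_X ^ n * dilate \<alpha> n F) $ (n + (n * k + (n - 1)))"
        unfolding fps_X_power_mult_nth diff_add_inverse dilate_nth by simp
      also have "n + (n * k + (n - 1)) = i" by (simp add: i Suc)
      finally show ?thesis .
    qed
  next
    case False
    have "\<not> n dvd Suc (i - n)" if "n \<le> i"
    proof -
      have "Suc i = Suc (i - n) + n" using that by simp
      then have "n dvd Suc i \<longleftrightarrow> n dvd Suc (i - n)" by (simp only: dvd_add_triv_right_iff)
      then show ?thesis using False by simp
    qed
    then show ?thesis
      using False by (simp add: dilate_nth_other fps_X_power_mult_nth)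
  qed
qed

lemma undilate_X: "undilate \<alpha> n (fps_X ^ n * F) = fps_X * undilate \<alpha> n F"
proof (rule fps_ext)
  fix j
  show "undilate \<alpha> n (fps_X ^ n * F) $ j = (fps_X * undilate \<alpha> n F) $ j"
  proof (cases j)
    case 0
    then show ?thesis using n by (simp add: undilate_def fps_X_power_mult_nth)
  next
    case (Suc k)
    have "n * Suc k + (n - 1) - n = n * k + (n - 1)" by simp
    then show ?thesis using n unfolding Suc by (simp add: undilate_def fps_X_power_mult_nth)
  qed
qed

lemma dilate_adjoint:
  "(\<Sum>i. dilate \<alpha> n F $ i * cnj (G $ i) * of_real (wt \<alpha> i)) = (\<Sum>j. F $ j * cnj (undilate \<alpha> n G $ j) * of_real (wt \<alpha> j))"
proof -
  let ?p = "\<lambda>j. n * j + (n - 1)"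
  have "(\<Sum>j. dilate \<alpha> n F $ ?p j * cnj (G $ ?p j) * of_real (wt \<alpha> (?p j)))
      = (\<Sum>i. dilate \<alpha> n F $ i * cnj (G $ i) * of_real (wt \<alpha> i))"
    by (rule suminf_mono_reindex[OF progression_props(2)]) (simp add: dilate_nth_other not_in_progression)
  moreover have "dilate \<alpha> n F $ ?p j * cnj (G $ ?p j) * of_real (wt \<alpha> (?p j))
      = F $ j * cnj (undilate \<alpha> n G $ j) * of_real (wt \<alpha> j)" for j
  proof -
    have "real n powr (- \<alpha> / 2) * real n powr \<alpha> = real n powr (\<alpha> / 2)" by (simp flip: powr_add)
    then have "complex_of_real (real n powr (- \<alpha> / 2)) * of_real (real n powr \<alpha>) = of_real (real n powr (\<alpha> / 2))"
      by (simp flip: of_real_mult)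
    then show ?thesis
      unfolding dilate_nth progression_props(5) undilate_def fps_nth_Abs_fps
      by (simp add: mult_ac)
  qed
  ultimately show ?thesis by simp
qed

lemma power_reducing_shift:
  "\<exists>M. reducing_subspace (A_space \<alpha>) (A_inner \<alpha>) (mult_op (\<lambda>z. z ^ n)) M \<and>
     unitarily_equivalent_on (A_space \<alpha>) (A_norm \<alpha>) (mult_op (\<lambda>z. z)) M (A_norm \<alpha>) (mult_op (\<lambda>z. z ^ n))"
proof -
  let ?H = "A_space \<alpha>"
  define U where "U = dilate \<alpha> n"
  define V where "V = undilate \<alpha> n"
  have bU: "bounded_op \<alpha> U" and bV: "bounded_op \<alpha> V"
    unfolding U_def V_def by (rule bounded_op_dilate bounded_op_undilate)+
  note ip = inner_product_on_A_inner[of \<alpha>]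
  note u = taylor_fps_lift[OF bU] and v = taylor_fps_lift[OF bV]
  have Z: "(\<lambda>z::complex. z) holomorphic_on ball 0 1" "(\<lambda>z::complex. z) has_fps_expansion fps_X"
    by (auto intro: has_fps_expansion_fps_X)
  have Zn: "(\<lambda>z::complex. z ^ n) holomorphic_on ball 0 1" "(\<lambda>z::complex. z ^ n) has_fps_expansion fps_X ^ n"
    by (auto intro!: has_fps_expansion_fps_X_power holomorphic_intros)
  have sm: "smooth (fps_X ^ n)" by (intro smooth_power smooth_X)
  note mB = mult_op_in_A_space[where \<alpha> = \<alpha>, OF _ Zn sm] and mZ = mult_op_in_A_space[where \<alpha> = \<alpha>, OF _ Z smooth_X]
  note linU = linear_on_lift[OF bU] and linV = linear_on_lift[OF bV]
  have VU: "lift_op V (lift_op U f) = f" if "f \<in> ?H" for f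
    by (rule A_space_eqI[where \<alpha> = \<alpha>]) (use that u v in \<open>simp_all add: U_def V_def undilate_dilate\<close>)
  have US: "lift_op U (mult_op (\<lambda>z. z) f) = mult_op (\<lambda>z. z ^ n) (lift_op U f)" if "f \<in> ?H" for f
    by (rule A_space_eqI[where \<alpha> = \<alpha>]) (use that u mB mZ in \<open>simp_all add: U_def dilate_X\<close>)
  have VT: "lift_op V (mult_op (\<lambda>z. z ^ n) f) = mult_op (\<lambda>z. z) (lift_op V f)" if "f \<in> ?H" for f
    by (rule A_space_eqI[where \<alpha> = \<alpha>]) (use that v mB mZ in \<open>simp_all add: V_def undilate_X\<close>)
  have adj: "A_inner \<alpha> (lift_op U f) g = A_inner \<alpha> f (lift_op V g)" if "f \<in> ?H" "g \<in> ?H" for f g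
    using that dilate_adjoint[of \<alpha> "taylor_fps f" "taylor_fps g"]
    by (simp add: A_inner_def u[unfolded U_def] v[unfolded V_def] U_def V_def wt_def flip: taylor_fps_nth)
  note red = reducing_range[where H = ?H and ip = "A_inner \<alpha>" and ip0 = "A_inner \<alpha>" and U = "lift_op U" and V = "lift_op V"
      and S = "mult_op (\<lambda>z. z)" and T = "mult_op (\<lambda>z. z ^ n)", OF ip ip linU linV linear_on_mult_op[OF Z smooth_X] linear_on_mult_op[OF Zn sm]
      VU adj US VT]
  have "unitarily_equivalent_on ?H (A_norm \<alpha>) (mult_op (\<lambda>z. z)) (lift_op U ` ?H) (A_norm \<alpha>) (mult_op (\<lambda>z. z ^ n))"
    by (rule unitarily_equivalent_on_cong[OF red(2) image_subsetI[OF u(1)]]) (use ip_norm_A_inner in auto)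
  with red(1) show ?thesis by blast
qed

end

theorem theorem3p4:
  fixes \<alpha> :: real
  shows
    "(\<forall>n\<ge>1. \<exists>M.
        reducing_subspace (A_space \<alpha>) (A_inner \<alpha>) (mult_op (\<lambda>z. z ^ n)) M \<and>
        unitarily_equivalent_on (A_space \<alpha>) (A_norm \<alpha>) (mult_op (\<lambda>z. z))
          M (A_norm \<alpha>) (mult_op (\<lambda>z. z ^ n)))
     \<and>
     (\<forall>n\<ge>1. \<forall>B. finite_blaschke_product n B \<longrightarrow>
        (\<exists>ip. hilbert_space_on (A_space \<alpha>) ip \<and>
           equivalent_norms_on (A_space \<alpha>) (ip_norm ip) (A_norm \<alpha>) \<and>
           (\<exists>M. reducing_subspace (A_space \<alpha>) ip (mult_op B) M \<and>
              unitarily_equivalent_on (A_space \<alpha>) (A_norm \<alpha>) (mult_op (\<lambda>z. z))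
                M (ip_norm ip) (mult_op B))))"
  by (intro conjI allI impI power_reducing_shift blaschke_renormed_shift)

end
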